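(* Let $X$ be an $n$-dimensional normed space over $\mathbb{K}\in\{\mathbb{R},\mathbb{C}\}$. Then $\sqrt{n}\le \rho_\infty(X)\le n$. Moreover, $\rho_\infty(X)=n$ if and only if $X$ is Euclidean.
   Context: $X^*$ denotes the dual space of $X$ and $B_{X^*}$ its unit ball. For an integer $k\ge 1$, the algebraic tensor power $X^{\otimes k}$ carries the injective norm $\|z\|_{\varepsilon_k(X)}=\sup\{|(\lambda_1\otimes\cdots\otimes\lambda_k)(z)| : \lambda_1,\dots,\lambda_k\in B_{X^*}\}$ and the projective norm $\|z\|_{\pi_k(X)}=\inf\{\sum_{i=1}^m \|x_i^{(1)}\|_X\cdots\|x_i^{(k)}\|_X : m\in\mathbb{N},\ z=\sum_{i=1}^m x_i^{(1)}\otimes\cdots\otimes x_i^{(k)}\}$. Define $\rho_k(X)=\left(\sup_{z\in X^{\otimes k},\, z\ne 0}\frac{\|z\|_{\pi_k(X)}}{\|z\|_{\varepsilon_k(X)}}\right)^{1/k}$ and the tensor radius $\rho_\infty(X)=\lim_{k\to\infty}\rho_k(X)$ (this limit exists). A normed space is called Euclidean if its norm is induced by an inner product. *)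

theory Defs
  imports "HOL-Analysis.Analysis" "HOL-Library.Function_Algebras"
begin

text \<open>
  The scalar field is a type parameter 'k, later instantiated to real and complex; the vector
  space is a type 'a with an explicit scalar multiplication and an explicit norm, because the
  class of real normed vector spaces does not cover complex scalars.
\<close>

locale normed_space = vector_space smul
  for smul :: "'k::real_normed_field \<Rightarrow> 'a::ab_group_add \<Rightarrow> 'a" +
  fixes N :: "'a \<Rightarrow> real"
  assumes norm_eq_zero_iff: "N x = 0 \<longleftrightarrow> x = 0"
    and norm_add_le: "N (x + y) \<le> N x + N y"
    and norm_scale: "N (smul c x) = norm c * N x"

definition has_dimension :: "('k::field \<Rightarrow> 'a::ab_group_add \<Rightarrow> 'a) \<Rightarrow> nat \<Rightarrow> bool" where
  "has_dimension smul n \<longleftrightarrow>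
     (\<exists>B. finite B \<and> card B = n \<and> \<not> module.dependent smul B \<and> module.span smul B = UNIV)"

text \<open>
  The conjugation of the scalar field is a parameter, so that one definition serves for
  real scalars (identity) and complex scalars (complex conjugation).
\<close>

definition is_inner_product ::
  "('k::real_normed_field \<Rightarrow> 'k) \<Rightarrow> ('k \<Rightarrow> 'a::ab_group_add \<Rightarrow> 'a) \<Rightarrow> ('a \<Rightarrow> 'a \<Rightarrow> 'k) \<Rightarrow> bool" where
  "is_inner_product cj smul ip \<longleftrightarrow>
     (\<forall>y. Vector_Spaces.linear smul (*) (\<lambda>x. ip x y)) \<and>
     (\<forall>x y. ip y x = cj (ip x y)) \<and>
     (\<forall>x. x \<noteq> 0 \<longrightarrow> (\<exists>r>0. ip x x = of_real r))"

definition is_euclidean ::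
  "('k::real_normed_field \<Rightarrow> 'k) \<Rightarrow> ('k \<Rightarrow> 'a::ab_group_add \<Rightarrow> 'a) \<Rightarrow> ('a \<Rightarrow> real) \<Rightarrow> bool" where
  "is_euclidean cj smul N \<longleftrightarrow>
     (\<exists>ip. is_inner_product cj smul ip \<and> (\<forall>x. ip x x = of_real ((N x)\<^sup>2)))"

definition dual_unit_ball ::
  "('k::real_normed_field \<Rightarrow> 'a::ab_group_add \<Rightarrow> 'a) \<Rightarrow> ('a \<Rightarrow> real) \<Rightarrow> ('a \<Rightarrow> 'k) set" where
  "dual_unit_ball smul N =
     {f. Vector_Spaces.linear smul (*) f \<and> (\<forall>x. norm (f x) \<le> N x)}"

text \<open>
  A k-tuple of vectors is encoded as a function on nat of which only the values at indices
  below k are used.  The k-th algebraic tensor power is realized, as is standard, inside the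
  algebraic dual of the space of k-linear forms: the elementary tensor of x is evaluation of
  forms at x, and the tensor power is the linear span of the elementary tensors.  Tensors
  are extended by 0 to functions that are not k-linear forms.
\<close>

definition multilinear_form ::
  "('k::field \<Rightarrow> 'a::ab_group_add \<Rightarrow> 'a) \<Rightarrow> nat \<Rightarrow> ((nat \<Rightarrow> 'a) \<Rightarrow> 'k) \<Rightarrow> bool" where
  "multilinear_form smul k \<phi> \<longleftrightarrow>
     (\<forall>x y. (\<forall>i<k. x i = y i) \<longrightarrow> \<phi> x = \<phi> y) \<and>
     (\<forall>i<k. \<forall>x. Vector_Spaces.linear smul (*) (\<lambda>v. \<phi> (x(i := v))))"

type_synonym ('k, 'a) tensor = "((nat \<Rightarrow> 'a) \<Rightarrow> 'k) \<Rightarrow> 'k"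

definition elementary_tensor ::
  "('k::field \<Rightarrow> 'a::ab_group_add \<Rightarrow> 'a) \<Rightarrow> nat \<Rightarrow> (nat \<Rightarrow> 'a) \<Rightarrow> ('k, 'a) tensor" where
  "elementary_tensor smul k x = (\<lambda>\<phi>. if multilinear_form smul k \<phi> then \<phi> x else 0)"

definition tensor_power ::
  "('k::field \<Rightarrow> 'a::ab_group_add \<Rightarrow> 'a) \<Rightarrow> nat \<Rightarrow> ('k, 'a) tensor set" where
  "tensor_power smul k =
     module.span (\<lambda>c z \<phi>. c * z \<phi>) (range (elementary_tensor smul k))"

text \<open>
  The value of the functional given by the tensor product of l 0, ..., l (k - 1) at a tensor z
  is z applied to the k-linear form that sends x to the product of the l i (x i).
\<close>

definition tensor_functional ::
  "nat \<Rightarrow> (nat \<Rightarrow> 'a \<Rightarrow> 'k::field) \<Rightarrow> ('k, 'a) tensor \<Rightarrow> 'k" where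
  "tensor_functional k l z = z (\<lambda>x. \<Prod>i<k. l i (x i))"

definition injective_norm ::
  "('k::real_normed_field \<Rightarrow> 'a::ab_group_add \<Rightarrow> 'a) \<Rightarrow> ('a \<Rightarrow> real) \<Rightarrow> nat \<Rightarrow> ('k, 'a) tensor \<Rightarrow> real"
where
  "injective_norm smul N k z =
     Sup {norm (tensor_functional k l z) | l. \<forall>i<k. l i \<in> dual_unit_ball smul N}"

definition projective_norm ::
  "('k::real_normed_field \<Rightarrow> 'a::ab_group_add \<Rightarrow> 'a) \<Rightarrow> ('a \<Rightarrow> real) \<Rightarrow> nat \<Rightarrow> ('k, 'a) tensor \<Rightarrow> real"
where
  "projective_norm smul N k z =
     Inf {\<Sum>i<m. \<Prod>j<k. N (x i j) | (m::nat) (x :: nat \<Rightarrow> nat \<Rightarrow> 'a).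
            z = (\<Sum>i<m. elementary_tensor smul k (x i))}"

text \<open>
  The supremum is taken in the nonnegative reals: inserting 0 only matters for the zero space,
  where the set of ratios is empty and its supremum is read as 0.
\<close>

definition rho ::
  "('k::real_normed_field \<Rightarrow> 'a::ab_group_add \<Rightarrow> 'a) \<Rightarrow> ('a \<Rightarrow> real) \<Rightarrow> nat \<Rightarrow> real" where
  "rho smul N k =
     root k (Sup (insert 0 {projective_norm smul N k z / injective_norm smul N k z | z.
                              z \<in> tensor_power smul k \<and> z \<noteq> 0}))"

definition tensor_radius ::
  "('k::real_normed_field \<Rightarrow> 'a::ab_group_add \<Rightarrow> 'a) \<Rightarrow> ('a \<Rightarrow> real) \<Rightarrow> real" where
  "tensor_radius smul N = lim (\<lambda>k. rho smul N k)"

lemma vector_space_tensor: "vector_space (\<lambda>c (z :: 'b \<Rightarrow> 'k::field) \<phi>. c * z \<phi>)"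
  by unfold_locales (auto simp: fun_eq_iff algebra_simps)

lemma elementary_tensor_in_tensor_power:
  "elementary_tensor smul k x \<in> tensor_power smul k"
  unfolding tensor_power_def
  by (intro module.span_base vector_space_tensor[THEN module_iff_vector_space[THEN iffD2]]) auto

lemma multilinear_form_add:
  assumes "multilinear_form smul k \<phi>" "i < k"
  shows "\<phi> (x(i := u + v)) = \<phi> (x(i := u)) + \<phi> (x(i := v))"
proof -
  interpret Vector_Spaces.linear smul "(*)" "\<lambda>v. \<phi> (x(i := v))"
    using assms by (simp add: multilinear_form_def)
  show ?thesis by (rule add)
qed

lemma multilinear_form_smul:
  assumes "multilinear_form smul k \<phi>" "i < k"
  shows "\<phi> (x(i := smul c u)) = c * \<phi> (x(i := u))"
proof -
  interpret Vector_Spaces.linear smul "(*)" "\<lambda>v. \<phi> (x(i := v))"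
    using assms by (simp add: multilinear_form_def)
  show ?thesis by (rule scale)
qed

lemma elementary_tensor_add:
  "i < k \<Longrightarrow> elementary_tensor smul k (x(i := u + v)) =
     elementary_tensor smul k (x(i := u)) + elementary_tensor smul k (x(i := v))"
  by (auto simp: elementary_tensor_def multilinear_form_add)

lemma elementary_tensor_smul:
  "i < k \<Longrightarrow> elementary_tensor smul k (x(i := smul c u)) =
     (\<lambda>\<phi>. c * elementary_tensor smul k (x(i := u)) \<phi>)"
  by (auto simp: elementary_tensor_def multilinear_form_smul)

lemma multilinear_form_prod:
  assumes "\<And>i. i < k \<Longrightarrow> Vector_Spaces.linear smul (*) (l i)"
  shows "multilinear_form smul k (\<lambda>x. \<Prod>i<k. l i (x i))"
proof -
  have "Vector_Spaces.linear smul (*) (\<lambda>v. \<Prod>j<k. l j ((x(i := v)) j))" if i: "i < k" for i x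
  proof -
    interpret L: Vector_Spaces.linear smul "(*)" "l i" using assms i .
    have eq: "(\<Prod>j<k. l j ((x(i := v)) j)) = l i v * (\<Prod>j\<in>{..<k} - {i}. l j (x j))" for v
      using i by (subst prod.remove[of _ i]) (auto intro!: prod.cong)
    show ?thesis
      unfolding eq by unfold_locales (auto simp: L.add L.scale algebra_simps)
  qed
  moreover have "(\<Prod>i<k. l i (x i)) = (\<Prod>i<k. l i (y i))" if "\<forall>i<k. x i = y i" for x y
    using that by (intro prod.cong) auto
  ultimately show ?thesis
    unfolding multilinear_form_def by blast
qed

lemma tensor_functional_elementary:
  assumes "\<And>i. i < k \<Longrightarrow> Vector_Spaces.linear smul (*) (l i)"
  shows "tensor_functional k l (elementary_tensor smul k x) = (\<Prod>i<k. l i (x i))"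
  using multilinear_form_prod[OF assms]
  by (simp add: tensor_functional_def elementary_tensor_def)

end

theory Submission
  imports Defs "Jordan_Normal_Form.Determinant"
begin

text \<open>
  For the upper bound, let \<open>e\<close> be an orthonormal basis for an inner product whose unit ball is the
  ellipsoid of maximal volume inside the unit ball of \<open>X\<close>. Maximality says that a quadratic form on
  the dual which is dominated by the squared dual norm has trace at most \<open>n\<close>; by induction on \<open>k\<close>, the
  coordinates of \<open>z\<close> satisfy \<open>\<Sum>\<^sub>I \<bar>z\<^sub>I\<bar>\<^sup>2 \<le> n\<^sup>k \<epsilon>(z)\<^sup>2\<close>, and Cauchy-Schwarz applied to the expansion of \<open>z\<close>
  in the basis gives \<open>\<pi>(z) \<le> (n \<Sum>\<^sub>i N(e\<^sub>i)\<^sup>2)\<^bsup>k/2\<^esup> \<epsilon>(z)\<close>. Here \<open>N(e\<^sub>i) \<le> 1\<close>, and if \<open>N\<close> is not the norm of the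
  ellipsoid then some orthonormal basis contains a vector with \<open>N(e\<^sub>i) < 1\<close>, so that the tensor
  radius is strictly less than \<open>n\<close>.

  For the lower bound, a tensor with random signs as coordinates and the form with the same
  coefficients pair to \<open>n\<^sup>k\<close>, while over a Euclidean space both have norm at most \<open>(1 + o(1))\<^sup>k\<close>. Hence the
  tensor radius is at least \<open>n / d\<close> whenever \<open>N \<le> \<bar>\<cdot>\<bar> \<le> d N\<close> for a Euclidean norm \<open>\<bar>\<cdot>\<bar>\<close>; take \<open>d = 1\<close> in the
  Euclidean case, and \<open>d = sqrt n\<close> for the ellipsoid in general. The limit exists by Fekete's
  lemma, since the ratio constants are supermultiplicative.
\<close>

section \<open>Hahn-Banach extension in finite dimension\<close>

text \<open>The ellipsoid enters the upper bound only through the trace inequality, which reads the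
  same in every orthonormal basis of the ellipsoid. This freedom settles the equality case: one unit
  vector with \<open>N\<close> below 1 can be completed to such a basis. Applied to a one-element
  family, the inequality says \<open>\<bar>\<cdot>\<bar> \<le> sqrt n N\<close>, the origin of
  \<open>d = sqrt n\<close>. A sign tensor has to be controlled on all \<open>k\<close>-tuples of
  vectors. A finite set that norms Euclidean space up to the factor \<open>1 - \<delta>\<close>
  replaces each slot; the union bound over its \<open>k\<close>-tuples costs a logarithm linear in
  \<open>k\<close>, which disappears under the \<open>k\<close>-th root, and \<open>\<delta>\<close>
  tends to 0 afterwards. Real and complex scalars share one argument: the conjugation is a
  parameter, and the Hahn-Banach theorem, whose two proofs differ, is a locale assumption.\<close>

lemma linear_functional_extend:
  fixes s :: "'k::field \<Rightarrow> 'v::ab_group_add \<Rightarrow> 'v"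
  assumes "vector_space s" "module.subspace s U" "b \<notin> U"
  shows "\<exists>h. Vector_Spaces.linear s (*) h \<and> h b = 1 \<and> (\<forall>u\<in>U. h u = 0)"
proof -
  interpret V: vector_space s by fact
  interpret K: vector_space "(*) :: 'k \<Rightarrow> 'k \<Rightarrow> 'k" by unfold_locales (auto simp: algebra_simps)
  interpret VK: vector_space_pair s "(*) :: 'k \<Rightarrow> 'k \<Rightarrow> 'k" by unfold_locales
  obtain B where B: "B \<subseteq> U" "V.independent B" "U \<subseteq> V.span B"
    using V.maximal_independent_subset[of U] by blast
  have "V.span B = U"
    using B assms(2) by (meson V.span_minimal subset_antisym)
  then have "b \<notin> V.span B" using assms(3) by simp
  then have ind: "V.independent (insert b B)"
    using B(2) by (simp add: V.independent_insertI)
  obtain h where h: "Vector_Spaces.linear s (*) h" "\<forall>x\<in>insert b B. h x = (if x = b then 1 else 0)"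
    using VK.linear_independent_extend[OF ind, of "\<lambda>x. if x = b then 1 else 0"] by blast
  have "h u = 0" if "u \<in> U" for u
  proof -
    have "u \<in> V.span B" using that B by blast
    moreover have "\<And>x. x \<in> B \<Longrightarrow> h x = 0" using h(2) \<open>b \<notin> V.span B\<close> V.span_base by auto
    ultimately show ?thesis using VK.linear_eq_0_on_span[OF h(1)] by blast
  qed
  then show ?thesis using h by auto
qed

text \<open>The intended \<open>p\<close> is the projective norm, which off the tensor power is an
  infimum over the empty set; hence \<open>p\<close> is controlled on \<open>W\<close> only.
  Functionals are total on the type, so extending \<open>f\<close> means correcting it by a multiple
  of a functional that vanishes on \<open>U\<close>.\<close>

lemma hahn_banach_step:
  fixes s :: "real \<Rightarrow> 'v::ab_group_add \<Rightarrow> 'v" and p :: "'v \<Rightarrow> real"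
  assumes "vector_space s" "module.subspace s W"
    and p_add: "\<And>x y. x \<in> W \<Longrightarrow> y \<in> W \<Longrightarrow> p (x + y) \<le> p x + p y"
    and p_scale: "\<And>c x. x \<in> W \<Longrightarrow> p (s c x) = \<bar>c\<bar> * p x"
    and U: "module.subspace s U" "U \<subseteq> W" and b: "b \<in> W"
    and f: "Vector_Spaces.linear s (*) f" "\<And>u. u \<in> U \<Longrightarrow> \<bar>f u\<bar> \<le> p u"
  shows "\<exists>g. Vector_Spaces.linear s (*) g \<and> (\<forall>u\<in>U. g u = f u) \<and>
           (\<forall>u\<in>U. \<forall>t. \<bar>g (u + s t b)\<bar> \<le> p (u + s t b))"
proof (cases "b \<in> U")
  case True
  interpret V: vector_space s by fact
  show ?thesis
    using True f U by (intro exI[of _ f]) (auto intro!: f(2) V.subspace_add V.subspace_scale)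
next
  case False
  interpret V: vector_space s by fact
  interpret VK: vector_space_pair s "(*) :: real \<Rightarrow> real \<Rightarrow> real" by unfold_locales (auto simp: algebra_simps)
  interpret f: Vector_Spaces.linear s "(*)" f by fact
  obtain h where h: "Vector_Spaces.linear s (*) h" "h b = 1" "\<forall>u\<in>U. h u = 0"
    using linear_functional_extend[OF assms(1) U(1) False] by blast
  interpret h: Vector_Spaces.linear s "(*)" h by fact
  note W = V.subspace_add[OF assms(2)] V.subspace_scale[OF assms(2)] V.subspace_diff[OF assms(2)]
  note Us = V.subspace_add[OF U(1)] V.subspace_scale[OF U(1)] V.subspace_diff[OF U(1)]
  have key: "f u - p (u - b) \<le> p (v + b) - f v" if "u \<in> U" "v \<in> U" for u v
  proof -
    have "f u + f v \<le> p (u + v)"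
      using f(2)[of "u + v"] that Us by (simp add: f.add)
    also have "u + v = (u - b) + (v + b)" by simp
    also have "p \<dots> \<le> p (u - b) + p (v + b)"
      using that U b W by (intro p_add) auto
    finally show ?thesis by simp
  qed
  \<comment> \<open>By \<open>key\<close>, every lower bound for the value at \<open>b\<close> lies
    below every upper bound; the supremum of the lower bounds is taken as that value, so that
    \<open>g b = c\<close> below.\<close>
  define c where "c = (SUP u\<in>U. f u - p (u - b))"
  have zU: "0 \<in> U" using U V.subspace_0 by blast
  have bdd: "bdd_above ((\<lambda>u. f u - p (u - b)) ` U)"
    using key[OF _ zU] by (intro bdd_aboveI[of _ "p (0 + b) - f 0"]) auto
  have c1: "f u - p (u - b) \<le> c" if "u \<in> U" for u
    unfolding c_def using that bdd by (rule cSUP_upper)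
  have c2: "c \<le> p (v + b) - f v" if "v \<in> U" for v
    unfolding c_def using zU key that by (intro cSUP_least) auto
  define g where "g x = f x + (c - f b) * h x" for x
  have lin: "Vector_Spaces.linear s (*) g"
    unfolding g_def by unfold_locales (auto simp: f.add f.scale h.add h.scale algebra_simps)
  have bound: "g (u + s t b) \<le> p (u + s t b)" if u: "u \<in> U" for u t
  proof -
    have gu: "g (u + s t b) = f u + c * t"
      using u h by (simp add: g_def f.add f.scale h.add h.scale algebra_simps)
    consider "t = 0" | "t > 0" | "t < 0" by linarith
    then show ?thesis
    proof cases
      case 1
      then show ?thesis using f(2)[OF u] gu by auto
    next
      case 2
      define v where "v = s (1/t) u"
      have v: "v \<in> U" "u = s t v" using u Us 2 by (auto simp: v_def)
      have "f u + c * t = t * (f v + c)"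
        using v by (simp add: f.scale algebra_simps)
      also have "\<dots> \<le> t * p (v + b)"
        using c2[OF v(1)] 2 by (intro mult_left_mono) auto
      also have "\<dots> = p (s t (v + b))"
        using 2 v U b W by (subst p_scale) auto
      also have "s t (v + b) = u + s t b" by (simp add: v V.scale_right_distrib)
      finally show ?thesis using gu by simp
    next
      case 3
      define v where "v = s (1/(-t)) u"
      have v: "v \<in> U" "u = s (-t) v" using u Us(2)[OF u, of "1/(-t)"] 3 by (auto simp: v_def)
      have "f u + c * t = (-t) * (f v - c)"
        using v by (simp only: f.scale) (simp add: algebra_simps)
      also have "\<dots> \<le> (-t) * p (v - b)"
        using c1[OF v(1)] 3 by (intro mult_left_mono) auto
      also have "\<dots> = p (s (-t) (v - b))"
        using 3 v U b W by (subst p_scale) auto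
      also have "s (-t) (v - b) = u + s t b" by (simp add: v V.scale_right_diff_distrib)
      finally show ?thesis using gu by simp
    qed
  qed
  have "\<bar>g (u + s t b)\<bar> \<le> p (u + s t b)" if u: "u \<in> U" for u t
  proof -
    interpret g: Vector_Spaces.linear s "(*)" g by fact
    have "- g (u + s t b) = g (s (-1) u + s (-t) b)"
      by (simp only: g.add g.scale)
    also have "\<dots> \<le> p (s (-1) u + s (-t) b)"
      using Us(2)[OF u] by (rule bound)
    also have "s (-1) u + s (-t) b = s (-1) (u + s t b)" by (simp add: V.scale_right_distrib)
    also have "p \<dots> = p (u + s t b)" using u U b W by (subst p_scale) auto
    finally show ?thesis using bound[OF u, of t] by linarith
  qed
  then show ?thesis
    using lin h by (intro exI[of _ g]) (auto simp: g_def)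
qed

text \<open>Finitely many one-step extensions suffice, one for each vector of \<open>S\<close>. They
  start from the line through \<open>x0\<close>, where the value \<open>p x0\<close> can be
  prescribed, and later steps do not change it.\<close>

lemma hahn_banach_real:
  fixes s :: "real \<Rightarrow> 'v::ab_group_add \<Rightarrow> 'v" and p :: "'v \<Rightarrow> real"
  assumes "vector_space s" "finite S"
    and p_add: "\<And>x y. x \<in> module.span s S \<Longrightarrow> y \<in> module.span s S \<Longrightarrow> p (x + y) \<le> p x + p y"
    and p_scale: "\<And>c x. x \<in> module.span s S \<Longrightarrow> p (s c x) = \<bar>c\<bar> * p x"
    and x0: "x0 \<in> module.span s S"
  shows "\<exists>f. Vector_Spaces.linear s (*) f \<and> f x0 = p x0 \<and> (\<forall>x\<in>module.span s S. \<bar>f x\<bar> \<le> p x)"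
proof -
  interpret V: vector_space s by fact
  let ?W = "V.span S"
  have W: "V.subspace ?W" by simp
  have p0: "p 0 = 0" using p_scale[of 0 0] V.span_zero by simp
  have pnn: "p x \<ge> 0" if "x \<in> ?W" for x
    using p_add[of x "s (-1) x"] p_scale[OF that, of "-1"] that p0 V.span_neg[OF that] by simp
  have "\<exists>f. Vector_Spaces.linear s (*) f \<and> f x0 = p x0 \<and> (\<forall>x\<in>V.span (insert x0 T). \<bar>f x\<bar> \<le> p x)"
    if "finite T" "T \<subseteq> ?W" for T
    using that
  proof (induction T rule: finite_induct)
    case empty
    have "\<exists>f. Vector_Spaces.linear s (*) f \<and> f x0 = p x0"
    proof (cases "x0 = 0")
      case True
      have "Vector_Spaces.linear s (*) (\<lambda>x. 0::real)" by unfold_locales (auto simp: algebra_simps)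
      then show ?thesis using True p0 by (intro exI[of _ "\<lambda>x. 0"]) simp
    next
      case False
      then have "x0 \<notin> {0}" by simp
      then obtain h where h: "Vector_Spaces.linear s (*) h" "h x0 = (1::real)"
        using linear_functional_extend[OF assms(1) V.subspace_single_0] by blast
      interpret h: Vector_Spaces.linear s "(*)" h by fact
      have "Vector_Spaces.linear s (*) (\<lambda>x. p x0 * h x)"
        by unfold_locales (auto simp: h.add h.scale algebra_simps)
      then show ?thesis using h(2) by (intro exI[of _ "\<lambda>x. p x0 * h x"]) simp
    qed
    then obtain f where f: "Vector_Spaces.linear s (*) f" "f x0 = p x0" by blast
    interpret f: Vector_Spaces.linear s "(*)" f by fact
    have "\<bar>f x\<bar> \<le> p x" if "x \<in> V.span {x0}" for x
    proof -
      obtain k where "x = s k x0" using \<open>x \<in> V.span {x0}\<close> V.span_breakdown_eq[of x x0 "{}"] by auto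
      then show ?thesis using x0 f(2) pnn by (simp add: f.scale p_scale abs_mult)
    qed
    then show ?case using f by auto
  next
    case (insert b T)
    then obtain f where f: "Vector_Spaces.linear s (*) f" "f x0 = p x0" "\<forall>x\<in>V.span (insert x0 T). \<bar>f x\<bar> \<le> p x"
      by auto
    have sub: "V.span (insert x0 T) \<subseteq> ?W"
      using x0 insert.prems by (intro V.span_minimal) auto
    obtain g where g: "Vector_Spaces.linear s (*) g" "\<forall>u\<in>V.span (insert x0 T). g u = f u"
      "\<forall>u\<in>V.span (insert x0 T). \<forall>t. \<bar>g (u + s t b)\<bar> \<le> p (u + s t b)"
      using hahn_banach_step[OF assms(1) W p_add p_scale V.subspace_span sub _ f(1)] f(3) insert.prems
      by blast
    have "\<bar>g x\<bar> \<le> p x" if "x \<in> V.span (insert b (insert x0 T))" for x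
    proof -
      obtain k where k: "x - s k b \<in> V.span (insert x0 T)"
        using \<open>x \<in> V.span (insert b (insert x0 T))\<close> by (auto simp: V.span_breakdown_eq)
      then show ?thesis using g(3)[rule_format, OF k, of k] by simp
    qed
    moreover have "g x0 = p x0" using g(2) f(2) V.span_base by auto
    ultimately show ?case using g(1) by (auto simp: insert_commute)
  qed
  from this[OF assms(2) V.span_superset] obtain f where
    f: "Vector_Spaces.linear s (*) f" "f x0 = p x0" "\<forall>x\<in>V.span (insert x0 S). \<bar>f x\<bar> \<le> p x" by blast
  then show ?thesis using V.span_mono[of S "insert x0 S"] by blast
qed

text \<open>A complex functional is determined by its real part \<open>u\<close> through
  \<open>f x = u x - \<i> * u (\<i> x)\<close>, so the real theorem is applied to the underlying
  real space, which is spanned by \<open>S\<close> together with its multiples by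
  \<open>\<i>\<close>.\<close>

lemma hahn_banach_complex:
  fixes s :: "complex \<Rightarrow> 'v::ab_group_add \<Rightarrow> 'v" and p :: "'v \<Rightarrow> real"
  assumes "vector_space s" "finite S"
    and p_add: "\<And>x y. x \<in> module.span s S \<Longrightarrow> y \<in> module.span s S \<Longrightarrow> p (x + y) \<le> p x + p y"
    and p_scale: "\<And>c x. x \<in> module.span s S \<Longrightarrow> p (s c x) = norm c * p x"
    and x0: "x0 \<in> module.span s S"
  shows "\<exists>f. Vector_Spaces.linear s (*) f \<and> f x0 = of_real (p x0) \<and> (\<forall>x\<in>module.span s S. norm (f x) \<le> p x)"
proof -
  interpret V: vector_space s by fact
  define r where "r a x = s (complex_of_real a) x" for a x
  have vr: "vector_space r"
    by unfold_locales (auto simp: r_def V.scale_right_distrib V.scale_left_distrib)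
  interpret R: vector_space r by (rule vr)
  let ?T = "S \<union> s \<i> ` S"
  have "R.subspace (V.span S)"
    unfolding R.subspace_def by (auto simp: r_def V.span_add V.span_scale V.span_zero)
  then have RV: "R.span ?T \<subseteq> V.span S"
    by (intro R.span_minimal) (auto intro: V.span_scale V.span_base)
  have split: "s c x = r (Re c) x + r (Im c) (s \<i> x)" for c x
  proof -
    have "s c x = s (of_real (Re c) + of_real (Im c) * \<i>) x"
      by (metis complex_eq mult.commute)
    then show ?thesis by (simp add: r_def V.scale_left_distrib)
  qed
  have rs: "r a (s c x) = s c (r a x)" for a c x
    by (simp add: r_def mult.commute)
  have ispan: "s \<i> x \<in> R.span ?T" if "x \<in> R.span ?T" for x
    using that
  proof (induction rule: R.span_induct_alt)
    case base
    then show ?case by (simp add: R.span_zero)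
  next
    case (step a x y)
    have "s \<i> x \<in> R.span ?T"
    proof (cases "x \<in> S")
      case False
      then obtain t where t: "x = s \<i> t" "t \<in> S" using step by auto
      then have "s \<i> x = r (-1) t" by (simp add: r_def)
      then show ?thesis using t by (metis R.span_base R.span_scale UnI1)
    qed (auto intro: R.span_base)
    then show ?case using step
      by (simp add: V.scale_right_distrib rs[symmetric] R.span_add R.span_scale)
  qed
  have "V.subspace (R.span ?T)"
    unfolding V.subspace_def
    by (auto intro: R.span_add R.span_zero) (subst split, intro R.span_add R.span_scale ispan)
  then have "V.span S \<subseteq> R.span ?T"
    by (intro V.span_minimal) (auto intro: R.span_base)
  with RV have sp: "R.span ?T = V.span S" by blast
  have "\<exists>u. Vector_Spaces.linear r (*) u \<and> u x0 = p x0 \<and> (\<forall>x\<in>R.span ?T. \<bar>u x\<bar> \<le> p x)"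
    using assms(2) x0 by (intro hahn_banach_real[OF vr]) (auto simp: sp p_add p_scale r_def)
  then obtain u where u: "Vector_Spaces.linear r (*) u" "u x0 = p x0" "\<forall>x\<in>V.span S. \<bar>u x\<bar> \<le> p x"
    unfolding sp by blast
  interpret u: Vector_Spaces.linear r "(*)" u by fact
  define f where "f x = Complex (u x) (- u (s \<i> x))" for x
  have f_scale: "f (s c x) = c * f x" for c x
  proof -
    have "s \<i> (s c x) = r (Re c) (s \<i> x) + r (- Im c) x"
      unfolding split[of c x] by (simp add: V.scale_right_distrib rs[symmetric])
    then have "u (s \<i> (s c x)) = Re c * u (s \<i> x) - Im c * u x" by (simp only: u.add u.scale)
    moreover have "u (s c x) = Re c * u x + Im c * u (s \<i> x)"
      unfolding split[of c x] by (simp only: u.add u.scale)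
    ultimately show ?thesis
      unfolding f_def by (simp add: complex_eq_iff)
  qed
  have lin: "Vector_Spaces.linear s (*) f"
  proof unfold_locales
    show "f (x + y) = f x + f y" for x y
      by (auto simp: f_def complex_eq_iff u.add V.scale_right_distrib)
  qed (auto simp: f_scale algebra_simps)
  have bd: "norm (f x) \<le> p x" if "x \<in> V.span S" for x
  proof (cases "f x = 0")
    case True
    then show ?thesis using u(3) that by (metis abs_ge_zero norm_zero order_trans)
  next
    case False
    \<comment> \<open>Rotating \<open>x\<close> by this unimodular number makes the value of
      \<open>f\<close> real and nonnegative, hence a value of \<open>u\<close>, and \<open>u\<close>
      is bounded by \<open>p\<close>.\<close>
    define c where "c = cnj (f x) / norm (f x)"
    have nc: "norm c = 1" using False by (simp add: c_def norm_divide)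
    have "f (s c x) = of_real (norm (f x))"
      using False unfolding f_scale c_def
      by (simp add: field_simps complex_norm_square power2_eq_square flip: of_real_mult)
         (metis complex_norm_square mult.commute power2_eq_square)
    then have "u (s c x) = norm (f x)" unfolding f_def by (metis complex.sel(1) Re_complex_of_real)
    then have "norm (f x) \<le> p (s c x)" using u(3) that V.span_scale[OF that] by (metis abs_le_D1)
    also have "\<dots> = p x" using p_scale[OF that] nc by simp
    finally show ?thesis .
  qed
  have "f x0 = of_real (p x0)"
  proof -
    \<comment> \<open>The real part of \<open>f x0\<close> already equals the bound
      \<open>p x0\<close> for its modulus, which leaves no room for an imaginary part.\<close>
    have "(u x0)^2 + (u (s \<i> x0))^2 \<le> (p x0)^2"
      using bd[OF x0] unfolding f_def by (simp add: norm_complex_def real_le_lsqrt sqrt_le_D)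
    then have "u (s \<i> x0) = 0" using u(2) by simp
    then show ?thesis using u(2) by (simp add: f_def complex_eq_iff)
  qed
  then show ?thesis using lin bd by blast
qed

section \<open>Random signs\<close>

lemma sum_PiE_Suc:
  fixes g :: "(nat \<Rightarrow> 'b) \<Rightarrow> 'c::comm_monoid_add"
  assumes "finite A"
  shows "(\<Sum>I\<in>{..<Suc k} \<rightarrow>\<^sub>E A. g I) = (\<Sum>I\<in>{..<k} \<rightarrow>\<^sub>E A. \<Sum>a\<in>A. g (I(k := a)))"
proof -
  have "(\<Sum>I\<in>{..<Suc k} \<rightarrow>\<^sub>E A. g I) = (\<Sum>(a, I)\<in>A \<times> ({..<k} \<rightarrow>\<^sub>E A). g (I(k := a)))"
    unfolding lessThan_Suc PiE_insert_eq
    by (subst sum.reindex, rule inj_combinator) (auto simp: case_prod_unfold)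
  also have "\<dots> = (\<Sum>a\<in>A. \<Sum>I\<in>{..<k} \<rightarrow>\<^sub>E A. g (I(k := a)))"
    by (rule sum.cartesian_product[symmetric])
  finally show ?thesis by (simp add: sum.swap[of _ A])
qed

text \<open>A weakening of \<open>cosh x \<le> exp (x\<^sup>2 / 2)\<close> that follows from
  \<open>exp y \<le> 1 + y + y\<^sup>2\<close> and \<open>exp (- y) \<le> 1 / (1 + y)\<close> on the
  unit interval; the weaker exponent only affects the constant \<open>exp 1\<close> in the average
  over signs.\<close>

lemma exp_add_exp_uminus_le:
  fixes x :: real
  assumes "\<bar>x\<bar> \<le> 1"
  shows "exp x + exp (- x) \<le> 2 * exp (x\<^sup>2)"
proof -
  have *: "exp y + exp (- y) \<le> 2 * exp (y\<^sup>2)" if y: "0 \<le> y" "y \<le> 1" for y :: real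
  proof -
    have "exp (- y) \<le> 1 / (1 + y)"
      using exp_ge_add_one_self[of y] y by (simp add: exp_minus divide_simps)
    also have "\<dots> \<le> 1 - y + y\<^sup>2"
    proof -
      have "(1 - y + y\<^sup>2) * (1 + y) = 1 + y ^ 3" by (simp add: algebra_simps power2_eq_square power3_eq_cube)
      then have "1 \<le> (1 - y + y\<^sup>2) * (1 + y)" using y by simp
      then show ?thesis using y by (simp add: divide_le_eq)
    qed
    finally have "exp y + exp (- y) \<le> 2 * (1 + y\<^sup>2)" using exp_bound[OF y] by simp
    also have "\<dots> \<le> 2 * exp (y\<^sup>2)" using exp_ge_add_one_self[of "y\<^sup>2"] by (simp only: mult_le_cancel_left_pos zero_less_numeral)
    finally show ?thesis .
  qed
  show ?thesis using *[of "\<bar>x\<bar>"] assms by (cases "x \<ge> 0") (auto simp: add.commute)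
qed

text \<open>The average of \<open>\<Sum>\<^sub>f 2 cosh (\<Sum>\<^sub>i \<sigma> i * c f i)\<close> over all choices of signs is at most \<open>2e card F\<close>.\<close>

lemma exists_signs_real:
  fixes c :: "'f \<Rightarrow> 'i \<Rightarrow> real"
  assumes "finite I" "finite F" "F \<noteq> {}" and le1: "\<And>f. f \<in> F \<Longrightarrow> (\<Sum>i\<in>I. (c f i)\<^sup>2) \<le> 1"
  shows "\<exists>\<sigma>. (\<forall>i\<in>I. \<sigma> i = 1 \<or> \<sigma> i = -1) \<and> (\<forall>f\<in>F. \<bar>\<Sum>i\<in>I. \<sigma> i * c f i\<bar> \<le> 1 + ln (2 * card F))"
proof -
  define S where "S = I \<rightarrow>\<^sub>E {-1, 1::real}"
  \<comment> \<open>Chosen so that \<open>exp R\<close> is \<open>2 * exp 1 * card F\<close>, the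
    bound for the average: if every choice of signs had a sum exceeding \<open>R\<close> in modulus,
    every choice would lie strictly above it.\<close>
  define R where "R = 1 + ln (2 * card F)"
  have finS: "finite S" using assms by (auto simp: S_def intro!: finite_PiE)
  have cS: "real (card S) = 2 ^ card I" using assms by (simp add: S_def card_PiE card_insert_if)
  have c1: "\<bar>c f i\<bar> \<le> 1" if "f \<in> F" "i \<in> I" for f i
  proof -
    have "(c f i)\<^sup>2 \<le> (\<Sum>i\<in>I. (c f i)\<^sup>2)" using that assms by (intro member_le_sum) auto
    with le1[OF that(1)] have "(c f i)\<^sup>2 \<le> 1" by linarith
    then show ?thesis by (simp add: abs_square_le_1)
  qed
  have gen: "(\<Sum>\<sigma>\<in>S. exp (e * (\<Sum>i\<in>I. \<sigma> i * c f i))) \<le> 2 ^ card I * exp 1"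
    if f: "f \<in> F" and e: "e = 1 \<or> e = -1" for f e
  proof -
    have "(\<Sum>\<sigma>\<in>S. exp (e * (\<Sum>i\<in>I. \<sigma> i * c f i))) = (\<Sum>\<sigma>\<in>S. \<Prod>i\<in>I. exp (e * (\<sigma> i * c f i)))"
      using assms by (simp add: exp_sum sum_distrib_left)
    also have "\<dots> = (\<Prod>i\<in>I. \<Sum>s\<in>{-1,1}. exp (e * (s * c f i)))"
      unfolding S_def using assms by (subst prod_sum_PiE) auto
    also have "\<dots> = (\<Prod>i\<in>I. exp (c f i) + exp (- c f i))"
      using e by (intro prod.cong) auto
    also have "\<dots> \<le> (\<Prod>i\<in>I. 2 * exp ((c f i)\<^sup>2))"
      using c1 f by (intro prod_mono conjI exp_add_exp_uminus_le) (auto intro: add_nonneg_nonneg)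
    also have "\<dots> = 2 ^ card I * exp (\<Sum>i\<in>I. (c f i)\<^sup>2)"
      using assms by (simp add: prod.distrib exp_sum)
    also have "\<dots> \<le> 2 ^ card I * exp 1" using le1[OF f] by simp
    finally show ?thesis .
  qed
  have "\<exists>\<sigma>\<in>S. \<forall>f\<in>F. \<bar>\<Sum>i\<in>I. \<sigma> i * c f i\<bar> \<le> R"
  proof (rule ccontr)
    assume neg: "\<not> ?thesis"
    let ?g = "\<lambda>\<sigma> f. exp (1 * (\<Sum>i\<in>I. \<sigma> i * c f i)) + exp (-1 * (\<Sum>i\<in>I. \<sigma> i * c f i))"
    have low: "exp R < (\<Sum>f\<in>F. ?g \<sigma> f)" if s: "\<sigma> \<in> S" for \<sigma>
    proof -
      obtain f where f: "f \<in> F" "\<bar>\<Sum>i\<in>I. \<sigma> i * c f i\<bar> > R" using neg s by (auto simp: not_le)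
      have "exp R < exp \<bar>\<Sum>i\<in>I. \<sigma> i * c f i\<bar>" using f by simp
      also have "\<dots> \<le> ?g \<sigma> f"
        by (cases "(\<Sum>i\<in>I. \<sigma> i * c f i) \<ge> 0") (auto intro: less_imp_le)
      also have "\<dots> \<le> (\<Sum>f\<in>F. ?g \<sigma> f)"
        using f(1) assms by (intro member_le_sum) (auto intro: add_nonneg_nonneg)
      finally show ?thesis .
    qed
    have "S \<noteq> {}" using assms by (auto simp: S_def PiE_eq_empty_iff)
    then have "(\<Sum>\<sigma>\<in>S. exp R) < (\<Sum>\<sigma>\<in>S. \<Sum>f\<in>F. ?g \<sigma> f)"
      using finS low by (intro sum_strict_mono) auto
    also have "\<dots> = (\<Sum>f\<in>F. (\<Sum>\<sigma>\<in>S. exp (1 * (\<Sum>i\<in>I. \<sigma> i * c f i))) + (\<Sum>\<sigma>\<in>S. exp (-1 * (\<Sum>i\<in>I. \<sigma> i * c f i))))"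
      by (subst sum.swap) (simp add: sum.distrib)
    also have "\<dots> \<le> (\<Sum>f\<in>F. 2 ^ card I * exp 1 + 2 ^ card I * exp 1)"
      by (intro sum_mono add_mono gen) auto
    also have "\<dots> = 2 ^ card I * (exp 1 * (2 * card F))" by simp
    also have "exp 1 * (2 * card F) = exp R"
      using assms by (simp add: R_def exp_add card_gt_0_iff)
    finally show False using cS by simp
  qed
  then obtain \<sigma> where "\<sigma> \<in> S" "\<forall>f\<in>F. \<bar>\<Sum>i\<in>I. \<sigma> i * c f i\<bar> \<le> R" by blast
  then show ?thesis by (intro exI[of _ \<sigma>]) (auto simp: S_def R_def PiE_iff)
qed

text \<open>The real statement is applied to coordinates of \<open>c f i\<close> in the real basis
  of the scalar field, divided by \<open>R\<close>: one functional for each \<open>f\<close> and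
  each basis element. Adding up the coordinates costs the factor \<open>DIM('k)\<close>.\<close>

lemma exists_signs:
  fixes c :: "'f \<Rightarrow> 'i \<Rightarrow> 'k::{real_normed_field, euclidean_space}"
    and R :: real
  assumes "finite I" "finite F" "F \<noteq> {}" "R > 0"
    and le: "\<And>f. f \<in> F \<Longrightarrow> (\<Sum>i\<in>I. (norm (c f i))\<^sup>2) \<le> R\<^sup>2"
  shows "\<exists>\<sigma>. (\<forall>i\<in>I. \<sigma> i = 1 \<or> \<sigma> i = -1) \<and>
           (\<forall>f\<in>F. norm (\<Sum>i\<in>I. of_real (\<sigma> i) * c f i) \<le> R * DIM('k) * (1 + ln (2 * (card F * DIM('k)))))"
proof -
  let ?c = "\<lambda>(f, b) i. (c f i \<bullet> b) / R"
  have "(\<Sum>i\<in>I. (?c fb i)\<^sup>2) \<le> 1" if fb: "fb \<in> F \<times> Basis" for fb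
  proof -
    obtain f b where [simp]: "fb = (f, b)" and f: "f \<in> F" "b \<in> Basis" using fb by auto
    have "(\<Sum>i\<in>I. (?c fb i)\<^sup>2) = (\<Sum>i\<in>I. (c f i \<bullet> b)\<^sup>2) / R\<^sup>2"
      by (simp add: power_divide sum_divide_distrib)
    also have "\<dots> \<le> (\<Sum>i\<in>I. (norm (c f i))\<^sup>2) / R\<^sup>2"
    proof (intro divide_right_mono sum_mono)
      show "(c f i \<bullet> b)\<^sup>2 \<le> (norm (c f i))\<^sup>2" for i
        using Basis_le_norm[OF f(2), of "c f i"] by (metis abs_ge_zero power2_abs power_mono)
    qed simp
    also have "\<dots> \<le> 1" using le[OF f(1)] \<open>R > 0\<close> by simp
    finally show ?thesis .
  qed
  moreover have "finite (F \<times> (Basis :: 'k set))" "F \<times> (Basis :: 'k set) \<noteq> {}"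
    using assms by auto
  ultimately have "\<exists>\<sigma>. (\<forall>i\<in>I. \<sigma> i = 1 \<or> \<sigma> i = -1) \<and> (\<forall>fb\<in>F \<times> Basis.
      \<bar>\<Sum>i\<in>I. \<sigma> i * ?c fb i\<bar> \<le> 1 + ln (2 * card (F \<times> (Basis :: 'k set))))"
    using assms(1) by (intro exists_signs_real)
  then obtain \<sigma> where
    s: "\<forall>i\<in>I. \<sigma> i = 1 \<or> \<sigma> i = -1"
      "\<forall>fb\<in>F \<times> Basis. \<bar>\<Sum>i\<in>I. \<sigma> i * ?c fb i\<bar> \<le> 1 + ln (2 * card (F \<times> (Basis :: 'k set)))"
    by blast
  have "norm (\<Sum>i\<in>I. of_real (\<sigma> i) * c f i) \<le> R * DIM('k) * (1 + ln (2 * (card F * DIM('k))))"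
    if f: "f \<in> F" for f
  proof -
    have "norm (\<Sum>i\<in>I. of_real (\<sigma> i) * c f i) \<le> (\<Sum>b\<in>Basis. \<bar>(\<Sum>i\<in>I. of_real (\<sigma> i) * c f i) \<bullet> b\<bar>)"
      by (rule norm_le_l1)
    also have "\<dots> \<le> (\<Sum>b\<in>(Basis :: 'k set). R * (1 + ln (2 * (card F * DIM('k)))))"
    proof (rule sum_mono)
      fix b :: 'k assume b: "b \<in> Basis"
      have "(\<Sum>i\<in>I. of_real (\<sigma> i) * c f i) \<bullet> b = R * (\<Sum>i\<in>I. \<sigma> i * ?c (f, b) i)"
        using \<open>R > 0\<close> by (simp add: inner_sum_left sum_distrib_left scaleR_conv_of_real[symmetric])
      then show "\<bar>(\<Sum>i\<in>I. of_real (\<sigma> i) * c f i) \<bullet> b\<bar> \<le> R * (1 + ln (2 * (card F * DIM('k))))"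
        using s(2)[rule_format, of "(f, b)"] f b \<open>R > 0\<close> by (simp add: abs_mult card_cartesian_product)
    qed
    finally show ?thesis by (simp add: mult_ac)
  qed
  with s(1) show ?thesis by blast
qed

section \<open>Finite norming sets for Euclidean space, and sign tensors\<close>

lemma finite_net_unit_ball:
  assumes "\<eta> > 0"
  shows "\<exists>G :: 'k::euclidean_space set. finite G \<and> (\<forall>x. norm x \<le> 1 \<longrightarrow> (\<exists>g\<in>G. norm (x - g) < \<eta>))"
proof -
  have "compact (cball (0::'k) 1)" by simp
  then obtain G where "finite G" "cball (0::'k) 1 \<subseteq> (\<Union>x\<in>G. ball x \<eta>)"
    using assms unfolding compact_eq_totally_bounded by blast
  then show ?thesis
    by (intro exI[of _ G]) (auto simp: subset_iff dist_norm norm_minus_commute)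
qed

text \<open>The sign estimate handles finitely many functionals, so the Euclidean ball is replaced
  by points of a product net. A net point close to the unit vector that norms \<open>l\<close> still
  detects \<open>l\<close> up to the factor \<open>1 - \<delta>\<close>.\<close>

lemma finite_norming_set:
  assumes "0 < \<delta>" "\<delta> < 1"
  shows "\<exists>F :: (nat \<Rightarrow> 'k::{real_normed_field, euclidean_space}) set. finite F \<and> F \<noteq> {} \<and>
    (\<forall>f\<in>F. L2_set (\<lambda>i. norm (f i)) {..<n} \<le> 1 + \<delta>) \<and>
    (\<forall>l M. (\<forall>f\<in>F. norm (\<Sum>i<n. l i * f i) \<le> M) \<longrightarrow> L2_set (\<lambda>i. norm (l i)) {..<n} \<le> M / (1 - \<delta>))"
proof -
  \<comment> \<open>Coordinatewise errors below \<open>\<eta>\<close> add up to a Euclidean error of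
    at most \<open>n * \<eta> \<le> \<delta>\<close>; \<open>n + 1\<close> keeps the denominator
    positive for \<open>n = 0\<close>.\<close>
  define \<eta> where "\<eta> = \<delta> / (n + 1)"
  have "\<eta> > 0" using assms by (simp add: \<eta>_def)
  then obtain G :: "'k set" where G: "finite G" "\<And>x. norm x \<le> 1 \<Longrightarrow> \<exists>g\<in>G. norm (x - g) < \<eta>"
    using finite_net_unit_ball by metis
  \<comment> \<open>The bound \<open>1 + \<delta>\<close> leaves room for approximants of unit
    vectors. The zero vector keeps \<open>F\<close> nonempty and forces \<open>M \<ge> 0\<close>,
    which is the claim when \<open>L = 0\<close>.\<close>
  define F where "F = insert (\<lambda>_. 0) {f \<in> {..<n} \<rightarrow>\<^sub>E G. L2_set (\<lambda>i. norm (f i)) {..<n} \<le> 1 + \<delta>}"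
  have "finite F" using G by (auto simp: F_def intro!: finite_PiE)
  moreover have "L2_set (\<lambda>i. norm (f i)) {..<n} \<le> 1 + \<delta>" if "f \<in> F" for f
    using that assms by (auto simp: F_def L2_set_def)
  moreover have "L2_set (\<lambda>i. norm (l i)) {..<n} \<le> M / (1 - \<delta>)"
    if M: "\<And>f. f \<in> F \<Longrightarrow> norm (\<Sum>i<n. l i * f i) \<le> M" for l M
  proof -
    define L where "L = L2_set (\<lambda>i. norm (l i)) {..<n}"
    have L0: "L \<ge> 0" by (simp add: L_def)
    have L2: "(\<Sum>i<n. (norm (l i))\<^sup>2) = L\<^sup>2" by (simp add: L_def L2_set_def sum_nonneg)
    have "L \<le> M / (1 - \<delta>)"
    proof (cases "L = 0")
      case True
      have "M \<ge> 0" using M[of "\<lambda>_. 0"] by (simp add: F_def)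
      with True assms show ?thesis by simp
    next
      case False
      then have Lp: "L > 0" using L0 by simp
      define v where "v i = of_real ((norm (l i))\<^sup>2 / L) / l i" for i
      have nv: "norm (v i) = norm (l i) / L" for i
        using Lp by (cases "l i = 0") (auto simp: v_def norm_divide norm_power power2_eq_square simp flip: of_real_power of_real_divide)
      have lv: "(\<Sum>i<n. l i * v i) = of_real L"
      proof -
        have "l i * v i = of_real ((norm (l i))\<^sup>2 / L)" for i
          using Lp by (cases "l i = 0") (auto simp: v_def)
        then have "(\<Sum>i<n. l i * v i) = of_real ((\<Sum>i<n. (norm (l i))\<^sup>2) / L)"
          by (simp only: sum_divide_distrib of_real_sum)
        then show ?thesis using Lp unfolding L2 by (simp add: power2_eq_square)
      qed
      have nvL: "L2_set (\<lambda>i. norm (v i)) {..<n} = 1"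
        using Lp by (simp add: L2_set_def nv power_divide L2 flip: sum_divide_distrib)
      have "norm (v i) \<le> 1" if "i < n" for i
        using member_le_L2_set[of "{..<n}" i "\<lambda>i. norm (v i)"] nvL that by simp
      then have "\<forall>i\<in>{..<n}. \<exists>g. g \<in> G \<and> norm (v i - g) < \<eta>" using G(2) by blast
      then obtain g where g: "\<And>i. i < n \<Longrightarrow> g i \<in> G \<and> norm (v i - g i) < \<eta>"
        by (metis lessThan_iff)
      define f where "f = restrict g {..<n}"
      have fd: "L2_set (\<lambda>i. norm (v i - f i)) {..<n} \<le> \<delta>"
      proof -
        have "L2_set (\<lambda>i. norm (v i - f i)) {..<n} \<le> (\<Sum>i<n. norm (v i - f i))"
          by (rule L2_set_le_sum) auto
        also have "\<dots> \<le> (\<Sum>i<n. \<eta>)" using g by (intro sum_mono) (auto simp: f_def less_imp_le)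
        also have "\<dots> \<le> \<delta>" using assms by (simp add: \<eta>_def field_simps)
        finally show ?thesis .
      qed
      have "L2_set (\<lambda>i. norm (f i)) {..<n} \<le> L2_set (\<lambda>i. norm (v i) + norm (v i - f i)) {..<n}"
        by (intro L2_set_mono) (auto simp: norm_minus_commute intro: norm_triangle_sub)
      also have "\<dots> \<le> 1 + \<delta>" using L2_set_triangle_ineq[of "\<lambda>i. norm (v i)" "\<lambda>i. norm (v i - f i)" "{..<n}"] fd nvL by simp
      finally have "f \<in> F" using g by (auto simp: F_def f_def)
      have "L = norm (\<Sum>i<n. l i * f i + l i * (v i - f i))"
        using lv Lp by (simp add: algebra_simps)
      also have "\<dots> \<le> norm (\<Sum>i<n. l i * f i) + norm (\<Sum>i<n. l i * (v i - f i))"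
        unfolding sum.distrib by (rule norm_triangle_ineq)
      also have "norm (\<Sum>i<n. l i * f i) \<le> M" using M \<open>f \<in> F\<close> .
      also have "norm (\<Sum>i<n. l i * (v i - f i)) \<le> (\<Sum>i<n. \<bar>norm (l i)\<bar> * \<bar>norm (v i - f i)\<bar>)"
        by (intro order.trans[OF norm_sum]) (simp add: norm_mult)
      also have "\<dots> \<le> L * L2_set (\<lambda>i. norm (v i - f i)) {..<n}"
        unfolding L_def by (rule L2_set_mult_ineq)
      also have "\<dots> \<le> L * \<delta>" using fd L0 by (rule mult_left_mono)
      finally show ?thesis using assms by (simp add: field_simps)
    qed
    then show ?thesis by (simp add: L_def)
  qed
  moreover have "F \<noteq> {}" by (simp add: F_def)
  ultimately show ?thesis by (intro exI[of _ F] conjI ballI allI impI) blast+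
qed

text \<open>One slot is freed at a time. With the other slots in \<open>F\<close>, contraction
  leaves a linear form in the last slot, whose Euclidean norm \<open>F\<close> detects at the cost
  of \<open>1 / (1 - \<delta>)\<close>. The last vector is then absorbed into the coefficients, and
  one slot fewer remains.\<close>

lemma multilinear_norming_set:
  fixes t :: "(nat \<Rightarrow> nat) \<Rightarrow> 'k::{real_normed_field, euclidean_space}"
  assumes \<delta>: "0 < \<delta>" "\<delta> < 1"
    and F: "\<And>l M. (\<And>f. f \<in> F \<Longrightarrow> norm (\<Sum>i<n. l i * f i) \<le> M) \<Longrightarrow> L2_set (\<lambda>i. norm (l i :: 'k)) {..<n} \<le> M / (1 - \<delta>)"
    and M: "\<And>f. f \<in> {..<k} \<rightarrow>\<^sub>E F \<Longrightarrow> norm (\<Sum>I\<in>{..<k} \<rightarrow>\<^sub>E {..<n}. t I * (\<Prod>j<k. f j (I j))) \<le> M"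
  shows "norm (\<Sum>I\<in>{..<k} \<rightarrow>\<^sub>E {..<n}. t I * (\<Prod>j<k. v j (I j)))
           \<le> M / (1 - \<delta>) ^ k * (\<Prod>j<k. L2_set (\<lambda>i. norm (v j i)) {..<n})"
  using M
proof (induction k arbitrary: t M)
  case 0
  from "0.prems"[of "\<lambda>_. undefined"] show ?case by simp
next
  case (Suc k)
  let ?t = "\<lambda>I. \<Sum>i<n. t (I(k := i)) * v k i"
  let ?L = "L2_set (\<lambda>i. norm (v k i)) {..<n}"
  have split: "(\<Sum>I\<in>{..<Suc k} \<rightarrow>\<^sub>E {..<n}. t I * (\<Prod>j<Suc k. w j (I j)))
     = (\<Sum>i<n. (\<Sum>I\<in>{..<k} \<rightarrow>\<^sub>E {..<n}. t (I(k := i)) * (\<Prod>j<k. w j (I j))) * w k i)" for w :: "nat \<Rightarrow> nat \<Rightarrow> 'k"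
  proof -
    have "(\<Sum>I\<in>{..<Suc k} \<rightarrow>\<^sub>E {..<n}. t I * (\<Prod>j<Suc k. w j (I j)))
      = (\<Sum>I\<in>{..<k} \<rightarrow>\<^sub>E {..<n}. \<Sum>i<n. t (I(k := i)) * (\<Prod>j<k. w j (I j)) * w k i)"
      by (subst sum_PiE_Suc) (auto intro!: sum.cong prod.cong simp: mult.assoc)
    then show ?thesis by (subst (asm) sum.swap) (simp add: sum_distrib_right)
  qed
  have step: "norm (\<Sum>I\<in>{..<k} \<rightarrow>\<^sub>E {..<n}. ?t I * (\<Prod>j<k. f j (I j))) \<le> M / (1 - \<delta>) * ?L"
    if f: "f \<in> {..<k} \<rightarrow>\<^sub>E F" for f
  proof -
    define l where "l i = (\<Sum>I\<in>{..<k} \<rightarrow>\<^sub>E {..<n}. t (I(k := i)) * (\<Prod>j<k. f j (I j)))" for i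
    have "norm (\<Sum>i<n. l i * g i) \<le> M" if g: "g \<in> F" for g
    proof -
      have mem: "f(k := g) \<in> {..<Suc k} \<rightarrow>\<^sub>E F" using f g by (auto simp: PiE_iff extensional_def less_Suc_eq)
      have "(\<Prod>j<k. (f(k := g)) j (I j)) = (\<Prod>j<k. f j (I j))" for I :: "nat \<Rightarrow> nat"
        by (intro prod.cong) auto
      then show ?thesis using Suc.prems[OF mem] unfolding split l_def by simp
    qed
    then have lM: "L2_set (\<lambda>i. norm (l i)) {..<n} \<le> M / (1 - \<delta>)" by (rule F)
    have "(\<Sum>I\<in>{..<k} \<rightarrow>\<^sub>E {..<n}. ?t I * (\<Prod>j<k. f j (I j))) = (\<Sum>i<n. l i * v k i)"
      unfolding l_def sum_distrib_right by (subst sum.swap) (intro sum.cong, auto simp: mult_ac)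
    also have "norm \<dots> \<le> (\<Sum>i<n. \<bar>norm (l i)\<bar> * \<bar>norm (v k i)\<bar>)"
      by (intro order.trans[OF norm_sum]) (simp add: norm_mult)
    also have "\<dots> \<le> L2_set (\<lambda>i. norm (l i)) {..<n} * ?L" by (rule L2_set_mult_ineq)
    also have "\<dots> \<le> M / (1 - \<delta>) * ?L" using lM by (intro mult_right_mono) auto
    finally show ?thesis .
  qed
  have "(\<Sum>I\<in>{..<Suc k} \<rightarrow>\<^sub>E {..<n}. t I * (\<Prod>j<Suc k. v j (I j))) = (\<Sum>I\<in>{..<k} \<rightarrow>\<^sub>E {..<n}. ?t I * (\<Prod>j<k. v j (I j)))"
    unfolding split sum_distrib_right by (subst sum.swap) (intro sum.cong, auto simp: mult_ac)
  also have "norm \<dots> \<le> M / (1 - \<delta>) * ?L / (1 - \<delta>) ^ k * (\<Prod>j<k. L2_set (\<lambda>i. norm (v j i)) {..<n})"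
    by (rule Suc.IH[OF step])
  finally show ?case by (simp only: prod.lessThan_Suc power_Suc) (simp add: field_simps)
qed

text \<open>The union bound over \<open>card F ^ k\<close> tuples has a logarithm linear in
  \<open>k\<close>, whence \<open>C * (k + 1)\<close> with \<open>C\<close> independent of
  \<open>k\<close>. The factor \<open>(1 + \<delta>) ^ k\<close> bounds the Euclidean norm of the
  coefficients of a product of \<open>k\<close> elements of \<open>F\<close>, and
  \<open>(1 - \<delta>) ^ k\<close> is the price of passing from \<open>F\<close> to all
  vectors.\<close>

lemma exists_sign_tensor:
  assumes \<delta>: "0 < \<delta>" "\<delta> < 1"
  shows "\<exists>C>0. \<forall>k. \<exists>\<sigma> :: (nat \<Rightarrow> nat) \<Rightarrow> real. (\<forall>I\<in>{..<k} \<rightarrow>\<^sub>E {..<n}. \<sigma> I = 1 \<or> \<sigma> I = -1) \<and>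
    (\<forall>v :: nat \<Rightarrow> nat \<Rightarrow> 'k::{real_normed_field, euclidean_space}.
      norm (\<Sum>I\<in>{..<k} \<rightarrow>\<^sub>E {..<n}. of_real (\<sigma> I) * (\<Prod>j<k. v j (I j)))
        \<le> ((1 + \<delta>) / (1 - \<delta>)) ^ k * (C * (real k + 1)) * (\<Prod>j<k. L2_set (\<lambda>i. norm (v j i)) {..<n}))"
proof -
  obtain F :: "(nat \<Rightarrow> 'k) set" where F: "finite F" "F \<noteq> {}"
    "\<And>f. f \<in> F \<Longrightarrow> L2_set (\<lambda>i. norm (f i)) {..<n} \<le> 1 + \<delta>"
    "\<And>l M. (\<And>f. f \<in> F \<Longrightarrow> norm (\<Sum>i<n. l i * f i) \<le> M) \<Longrightarrow> L2_set (\<lambda>i. norm (l i)) {..<n} \<le> M / (1 - \<delta>)"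
    using finite_norming_set[OF \<delta>, where ?'k = 'k and n = n] by metis
  have cF: "card F \<ge> 1" using F by (simp add: Suc_leI card_gt_0_iff)
  define C where "C = real DIM('k) * (1 + ln (2 * real DIM('k)) + ln (card F))"
  have D: "real DIM('k) \<ge> 1" using DIM_positive[where 'a = 'k] by linarith
  have lnD: "ln (2 * real DIM('k)) \<ge> 0" using D by (intro ln_ge_zero) linarith
  have lnF: "ln (real (card F)) \<ge> 0" using cF by simp
  have "C > 0" unfolding C_def using D lnD lnF by (intro mult_pos_pos) linarith+
  moreover have "\<exists>\<sigma> :: (nat \<Rightarrow> nat) \<Rightarrow> real. (\<forall>I\<in>{..<k} \<rightarrow>\<^sub>E {..<n}. \<sigma> I = 1 \<or> \<sigma> I = -1) \<and>
    (\<forall>v :: nat \<Rightarrow> nat \<Rightarrow> 'k.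
      norm (\<Sum>I\<in>{..<k} \<rightarrow>\<^sub>E {..<n}. of_real (\<sigma> I) * (\<Prod>j<k. v j (I j)))
        \<le> ((1 + \<delta>) / (1 - \<delta>)) ^ k * (C * (real k + 1)) * (\<Prod>j<k. L2_set (\<lambda>i. norm (v j i)) {..<n}))" for k
  proof -
    let ?I = "{..<k} \<rightarrow>\<^sub>E {..<n}" and ?F = "{..<k} \<rightarrow>\<^sub>E F"
    have fin: "finite ?I" "finite ?F" "?F \<noteq> {}" using F by (auto intro!: finite_PiE simp: PiE_eq_empty_iff)
    have R: "(1 + \<delta>) ^ k > 0" using \<delta> by simp
    have le: "(\<Sum>I\<in>?I. (norm (\<Prod>j<k. f j (I j)))\<^sup>2) \<le> ((1 + \<delta>) ^ k)\<^sup>2" if f: "f \<in> ?F" for f :: "nat \<Rightarrow> nat \<Rightarrow> 'k"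
    proof -
      have "(\<Sum>I\<in>?I. (norm (\<Prod>j<k. f j (I j)))\<^sup>2) = (\<Sum>I\<in>?I. \<Prod>j<k. (norm (f j (I j)))\<^sup>2)"
        by (simp add: prod_power_distrib flip: prod_norm)
      also have "\<dots> = (\<Prod>j<k. \<Sum>i<n. (norm (f j i))\<^sup>2)"
        by (subst prod_sum_PiE) auto
      also have "\<dots> = (\<Prod>j<k. (L2_set (\<lambda>i. norm (f j i)) {..<n})\<^sup>2)"
        by (simp add: L2_set_def sum_nonneg)
      also have "\<dots> \<le> (\<Prod>j<k. (1 + \<delta>)\<^sup>2)"
        using f F(3) by (intro prod_mono conjI power_mono) (auto simp: PiE_iff)
      also have "\<dots> = ((1 + \<delta>) ^ k)\<^sup>2" by (simp add: power_mult[symmetric] mult.commute)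
      finally show ?thesis .
    qed
    have "\<exists>\<sigma>. (\<forall>I\<in>?I. \<sigma> I = 1 \<or> \<sigma> I = -1) \<and>
      (\<forall>f\<in>?F. norm (\<Sum>I\<in>?I. of_real (\<sigma> I) * (\<Prod>j<k. f j (I j)) :: 'k) \<le> (1 + \<delta>) ^ k * DIM('k) * (1 + ln (2 * (card ?F * DIM('k)))))"
      by (rule exists_signs[OF fin R le])
    then obtain \<sigma> :: "(nat \<Rightarrow> nat) \<Rightarrow> real" where s: "\<forall>I\<in>?I. \<sigma> I = 1 \<or> \<sigma> I = -1"
      "\<And>f. f \<in> ?F \<Longrightarrow> norm (\<Sum>I\<in>?I. of_real (\<sigma> I) * (\<Prod>j<k. f j (I j)) :: 'k) \<le> (1 + \<delta>) ^ k * DIM('k) * (1 + ln (2 * (card ?F * DIM('k))))"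
      by blast
    have "ln (2 * (real (card ?F) * DIM('k))) = ln (2 * real DIM('k)) + k * ln (card F)"
      using F(1,2) cF D by (simp add: card_PiE ln_mult ln_realpow)
    also have "1 + \<dots> \<le> (1 + ln (2 * real DIM('k)) + ln (card F)) * (real k + 1)"
    proof -
      have "0 \<le> real k * (1 + ln (2 * real DIM('k)))" using lnD by simp
      then show ?thesis using lnF by (simp add: algebra_simps)
    qed
    finally have "DIM('k) * (1 + ln (2 * (real (card ?F) * DIM('k)))) \<le> C * (real k + 1)"
      unfolding C_def mult.assoc by (intro mult_left_mono) auto
    then have "(1 + \<delta>) ^ k * (DIM('k) * (1 + ln (2 * (real (card ?F) * DIM('k))))) \<le> (1 + \<delta>) ^ k * (C * (real k + 1))"
      using R by (intro mult_left_mono) auto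
    then have M: "norm (\<Sum>I\<in>?I. of_real (\<sigma> I) * (\<Prod>j<k. f j (I j)) :: 'k) \<le> (1 + \<delta>) ^ k * (C * (real k + 1))"
      if "f \<in> ?F" for f using s(2)[OF that] by (simp add: mult.assoc)
    have "norm (\<Sum>I\<in>?I. of_real (\<sigma> I) * (\<Prod>j<k. v j (I j)) :: 'k)
        \<le> (1 + \<delta>) ^ k * (C * (real k + 1)) / (1 - \<delta>) ^ k * (\<Prod>j<k. L2_set (\<lambda>i. norm (v j i)) {..<n})" for v
      by (rule multilinear_norming_set[OF \<delta> F(4) M])
    then show ?thesis using s(1) by (intro exI[of _ \<sigma>]) (auto simp: power_divide)
  qed
  ultimately show ?thesis by blast
qed

section \<open>Inner products and coordinates\<close>

text \<open>Laws shared by the identity on the reals and complex conjugation. There is no real part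
  among them, so identities between squared norms are proved inside the field by way of
  \<open>mult_cj\<close>.\<close>

locale conj_field =
  fixes cj :: "'k::{real_normed_field, euclidean_space} \<Rightarrow> 'k"
  assumes cj_add: "cj (x + y) = cj x + cj y"
    and cj_mult: "cj (x * y) = cj x * cj y"
    and cj_of_real: "cj (of_real r) = of_real r"
    and cj_cj: "cj (cj x) = x"
    and mult_cj: "x * cj x = of_real ((norm x)\<^sup>2)"
    and norm_cj: "norm (cj x) = norm x"
begin

lemma cj_0 [simp]: "cj 0 = 0" and cj_1 [simp]: "cj 1 = 1"
  using cj_of_real[of 0] cj_of_real[of 1] by simp_all

lemma cj_minus: "cj (- x) = - cj x"
  using cj_add[of x "- x"] by (simp add: eq_neg_iff_add_eq_0 add.commute)

lemma cj_diff: "cj (x - y) = cj x - cj y"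
  using cj_add[of x "- y"] by (simp add: cj_minus)

lemma cj_sum: "cj (\<Sum>i\<in>A. f i) = (\<Sum>i\<in>A. cj (f i))"
  by (induction A rule: infinite_finite_induct) (auto simp: cj_add)

end

locale fin_dim_space = vector_space smul + conj_field cj
  for smul :: "'k::{real_normed_field, euclidean_space} \<Rightarrow> 'a::ab_group_add \<Rightarrow> 'a" and cj :: "'k \<Rightarrow> 'k" +
  fixes n :: nat
  assumes has_dim: "has_dimension smul n"
begin

lemma dim_UNIV: "dim UNIV = n"
  using has_dim dim_eq_card_independent dim_span unfolding has_dimension_def by metis

lemma span_UNIV_of_independent:
  assumes "independent S" "finite S" "card S = n"
  shows "span S = UNIV"
proof -
  obtain B where B: "finite B" "independent B" "span B = UNIV"
    using has_dim unfolding has_dimension_def by blast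
  interpret F: finite_dimensional_vector_space smul B using B by unfold_locales
  show ?thesis using F.card_ge_dim_independent[of S UNIV] assms dim_UNIV by auto
qed

text \<open>A basis with its dual basis. Numbering both by \<open>i < n\<close> suits matrices as
  well as the multi-indices of tensor coordinates.\<close>

definition coords :: "(nat \<Rightarrow> 'a) \<Rightarrow> (nat \<Rightarrow> 'a \<Rightarrow> 'k) \<Rightarrow> bool" where
  "coords b c \<longleftrightarrow> (\<forall>i<n. Vector_Spaces.linear smul (*) (c i)) \<and>
     (\<forall>x. x = (\<Sum>i<n. smul (c i x) (b i))) \<and> (\<forall>i<n. \<forall>j<n. c i (b j) = (if i = j then 1 else 0))"

lemma coords_sum:
  assumes "coords b c" "i < n"
  shows "c i (\<Sum>j\<in>J. smul (a j) (x j)) = (\<Sum>j\<in>J. a j * c i (x j))"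
proof -
  interpret Vector_Spaces.linear smul "(*)" "c i" using assms by (auto simp: coords_def)
  show ?thesis by (simp add: sum scale)
qed

lemma coords_comb:
  assumes "coords b c" "i < n"
  shows "c i (\<Sum>j<n. smul (a j) (b j)) = a i"
proof -
  have "c i (\<Sum>j<n. smul (a j) (b j)) = (\<Sum>j<n. a j * (if i = j then 1 else 0))"
    unfolding coords_sum[OF assms] using assms by (intro sum.cong) (auto simp: coords_def)
  then show ?thesis using assms(2) by (simp add: if_distrib[of "\<lambda>z. _ * z"] cong: if_cong)
qed

lemma exists_coords: "\<exists>b c. coords b c"
proof -
  obtain B where B: "finite B" "independent B" "span B = UNIV" "card B = n"
    using has_dim unfolding has_dimension_def by blast
  obtain b where b: "bij_betw b {..<n} B"
    using ex_bij_betw_nat_finite[OF B(1)] B(4) by (auto simp: lessThan_atLeast0)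
  define c where "c i x = representation B x (b i)" for i x
  interpret K: vector_space "(*) :: 'k \<Rightarrow> 'k \<Rightarrow> 'k" by unfold_locales (auto simp: algebra_simps)
  have "Vector_Spaces.linear smul (*) (c i)" for i
    unfolding c_def using B by unfold_locales (auto simp: representation_add representation_scale)
  moreover have "x = (\<Sum>i<n. smul (c i x) (b i))" for x
  proof -
    have "x = (\<Sum>v\<in>B. smul (representation B x v) v)"
      using sum_representation_eq[OF B(2), of x B] B by simp
    then show ?thesis unfolding c_def by (subst (asm) sum.reindex_bij_betw[OF b, symmetric])
  qed
  moreover have "c i (b j) = (if i = j then 1 else 0)" if "i < n" "j < n" for i j
    using that b unfolding c_def
    by (subst representation_basis[OF B(2)]) (auto simp: bij_betw_def inj_on_def)
  ultimately show ?thesis unfolding coords_def by blast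
qed

definition sq :: "('a \<Rightarrow> 'a \<Rightarrow> 'k) \<Rightarrow> 'a \<Rightarrow> real" where "sq ip x = norm (ip x x)"

definition orthonormal :: "('a \<Rightarrow> 'a \<Rightarrow> 'k) \<Rightarrow> nat \<Rightarrow> (nat \<Rightarrow> 'a) \<Rightarrow> bool" where
  "orthonormal ip m e \<longleftrightarrow> (\<forall>i<m. \<forall>j<m. ip (e i) (e j) = (if i = j then 1 else 0))"

context
  fixes ip assumes ip: "is_inner_product cj smul ip"
begin

lemma ip_linear: "Vector_Spaces.linear smul (*) (\<lambda>x. ip x y)"
  using ip unfolding is_inner_product_def by blast

lemma ip_sum_left: "ip (\<Sum>j\<in>J. smul (a j) (x j)) y = (\<Sum>j\<in>J. a j * ip (x j) y)"
proof -
  interpret Vector_Spaces.linear smul "(*)" "\<lambda>x. ip x y" by (rule ip_linear)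
  show ?thesis by (simp add: sum scale)
qed

lemma ip_cj: "ip y x = cj (ip x y)"
  using ip unfolding is_inner_product_def by blast

lemma ip_sum_right: "ip y (\<Sum>j\<in>J. smul (a j) (x j)) = (\<Sum>j\<in>J. cj (a j) * ip y (x j))"
  unfolding ip_cj[of y] ip_sum_left cj_sum cj_mult by (simp add: ip_cj[of _ y])

lemma ip_zero [simp]: "ip 0 y = 0"
proof -
  interpret Vector_Spaces.linear smul "(*)" "\<lambda>x. ip x y" by (rule ip_linear)
  show ?thesis by (rule zero)
qed

lemma ip_sq: "ip x x = of_real (sq ip x)"
proof (cases "x = 0")
  case False
  then obtain r where "r > 0" "ip x x = of_real r" using ip unfolding is_inner_product_def by blast
  then show ?thesis by (simp add: sq_def)
qed (simp add: sq_def)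

lemma sq_pos: "x \<noteq> 0 \<Longrightarrow> sq ip x > 0"
proof -
  assume "x \<noteq> 0"
  then obtain r where "r > 0" "ip x x = of_real r" using ip unfolding is_inner_product_def by blast
  then show ?thesis by (simp add: sq_def)
qed

text \<open>A Gram-Schmidt step: as \<open>m < n\<close>, some vector lies outside the span, and its
  component orthogonal to the span can be normalised.\<close>

lemma orthonormal_extend1:
  assumes "orthonormal ip m e" "m < n"
  shows "\<exists>v. orthonormal ip (Suc m) (e(m := v))"
proof -
  have "span (e ` {..<m}) \<noteq> UNIV"
  proof
    assume "span (e ` {..<m}) = UNIV"
    then have "dim UNIV \<le> card (e ` {..<m})" by (intro dim_le_card) auto
    also have "\<dots> \<le> m" using card_image_le[of "{..<m}" e] by simp
    finally show False using assms dim_UNIV by simp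
  qed
  then obtain x where x: "x \<notin> span (e ` {..<m})" by blast
  define y where "y = x - (\<Sum>i<m. smul (ip x (e i)) (e i))"
  have "(\<Sum>i<m. smul (ip x (e i)) (e i)) \<in> span (e ` {..<m})"
    by (intro span_sum span_scale span_base) auto
  then have y0: "y \<noteq> 0" using x by (auto simp: y_def)
  have orth: "ip y (e j) = 0" if j: "j < m" for j
  proof -
    interpret Vector_Spaces.linear smul "(*)" "\<lambda>x. ip x (e j)" by (rule ip_linear)
    have "(\<Sum>i<m. ip x (e i) * ip (e i) (e j)) = (\<Sum>i<m. ip x (e i) * (if i = j then 1 else 0))"
      using assms(1) j by (intro sum.cong) (auto simp: orthonormal_def)
    then show ?thesis using j
      by (simp add: y_def diff ip_sum_left if_distrib[of "\<lambda>z. _ * z"] cong: if_cong)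
  qed
  define s where "s = 1 / sqrt (sq ip y)"
  define v where "v = smul (of_real s) y"
  have sl: "ip (smul a u) w = a * ip u w" for a u w
  proof -
    interpret Vector_Spaces.linear smul "(*)" "\<lambda>x. ip x w" by (rule ip_linear)
    show ?thesis by (rule scale)
  qed
  have sr: "ip u (smul a w) = cj a * ip u w" for a u w
    unfolding ip_cj[of u] sl cj_mult by (simp add: ip_cj[of _ u])
  have "ip v v = of_real s * (of_real s * ip y y)"
    unfolding v_def sl sr cj_of_real ..
  also have "\<dots> = of_real (s * s * sq ip y)"
    unfolding ip_sq[of y] by simp
  also have "s * s * sq ip y = 1" using sq_pos[OF y0] by (simp add: s_def)
  finally have vv: "ip v v = 1" by simp
  have ve: "ip v (e j) = 0" "ip (e j) v = 0" if "j < m" for j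
    using orth[OF that] by (simp_all add: v_def sl sr ip_cj[of "e j"])
  show ?thesis
    using assms(1) vv ve by (intro exI[of _ v]) (auto simp: orthonormal_def less_Suc_eq)
qed

text \<open>That the given vectors are kept matters in the equality case, where a prescribed unit
  vector must belong to the basis.\<close>

lemma orthonormal_extend:
  assumes "orthonormal ip m e" "m \<le> n"
  shows "\<exists>e'. orthonormal ip n e' \<and> (\<forall>i<m. e' i = e i)"
  using assms(2,1)
proof (induction m arbitrary: e rule: inc_induct)
  case base
  then show ?case by blast
next
  case (step m)
  then obtain v where "orthonormal ip (Suc m) (e(m := v))" using orthonormal_extend1 by blast
  then obtain e' where "orthonormal ip n e'" "\<forall>i<Suc m. e' i = (e(m := v)) i" using step.IH by blast
  then show ?case by (intro exI[of _ e']) auto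
qed

lemma orthonormal_coords:
  assumes e: "orthonormal ip n e"
  shows "coords e (\<lambda>i x. ip x (e i))"
proof -
  have inj: "inj_on e {..<n}"
    using e unfolding orthonormal_def inj_on_def by (metis lessThan_iff zero_neq_one)
  have coef: "ip (\<Sum>i<n. smul (a i) (e i)) (e j) = a j" if "j < n" for a j
  proof -
    have "(\<Sum>i<n. a i * ip (e i) (e j)) = (\<Sum>i<n. a i * (if i = j then 1 else 0))"
      using e that by (intro sum.cong) (auto simp: orthonormal_def)
    then show ?thesis using that
      by (simp add: ip_sum_left if_distrib[of "\<lambda>z. _ * z"] cong: if_cong)
  qed
  have "independent (e ` {..<n})"
  proof
    assume "dependent (e ` {..<n})"
    then obtain u where u: "\<exists>v\<in>e ` {..<n}. u v \<noteq> 0" "(\<Sum>v\<in>e ` {..<n}. smul (u v) v) = 0"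
      by (auto simp: dependent_finite)
    from u(2) have "(\<Sum>i<n. smul (u (e i)) (e i)) = 0" by (simp add: sum.reindex[OF inj])
    then have "u (e j) = 0" if "j < n" for j using coef[OF that, of "\<lambda>i. u (e i)"] by simp
    with u(1) show False by auto
  qed
  then have sp: "span (e ` {..<n}) = UNIV"
    using inj by (intro span_UNIV_of_independent) (auto simp: card_image)
  have "x = (\<Sum>i<n. smul (ip x (e i)) (e i))" for x
  proof -
    have "x \<in> span (e ` {..<n})" using sp by simp
    then obtain u where "x = (\<Sum>v\<in>e ` {..<n}. smul (u v) v)" by (auto simp: span_finite)
    then have x: "x = (\<Sum>i<n. smul (u (e i)) (e i))" by (simp add: sum.reindex[OF inj])
    then have "ip x (e j) = u (e j)" if "j < n" for j using coef[OF that] by simp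
    then show ?thesis using x by (metis (no_types, lifting) lessThan_iff sum.cong)
  qed
  then show ?thesis using e ip_linear by (auto simp: coords_def orthonormal_def)
qed

lemma sq_comb:
  assumes e: "orthonormal ip n e"
  shows "sq ip (\<Sum>i<n. smul (a i) (e i)) = (\<Sum>i<n. (norm (a i))\<^sup>2)"
proof -
  have "ip (\<Sum>i<n. smul (a i) (e i)) (\<Sum>i<n. smul (a i) (e i))
      = (\<Sum>i<n. cj (a i) * (\<Sum>j<n. a j * ip (e j) (e i)))"
    by (simp add: ip_sum_left ip_sum_right sum_distrib_left mult_ac)
  also have "\<dots> = (\<Sum>i<n. cj (a i) * a i)"
  proof (rule sum.cong)
    fix i assume "i \<in> {..<n}"
    then have "(\<Sum>j<n. a j * ip (e j) (e i)) = (\<Sum>j<n. a j * (if j = i then 1 else 0))"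
      using e by (intro sum.cong) (auto simp: orthonormal_def)
    then show "cj (a i) * (\<Sum>j<n. a j * ip (e j) (e i)) = cj (a i) * a i"
      using \<open>i \<in> {..<n}\<close> by (simp add: if_distrib[of "\<lambda>z. _ * z"] cong: if_cong)
  qed simp
  also have "\<dots> = of_real (\<Sum>i<n. (norm (a i))\<^sup>2)"
    by (simp add: mult.commute[of "cj _"] mult_cj)
  finally show ?thesis by (simp add: sq_def sum_nonneg del: of_real_sum)
qed

end

text \<open>Declaring an arbitrary basis orthonormal gives a Euclidean structure; in this way the
  ellipsoid enters the final proof.\<close>

lemma coords_inner_product:
  assumes "coords b c"
  shows "is_inner_product cj smul (\<lambda>x y. \<Sum>i<n. c i x * cj (c i y))"
    and "orthonormal (\<lambda>x y. \<Sum>i<n. c i x * cj (c i y)) n b"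
    and "(\<Sum>i<n. c i x * cj (c i x)) = of_real (\<Sum>i<n. (norm (c i x))\<^sup>2)"
proof -
  interpret K: vector_space "(*) :: 'k \<Rightarrow> 'k \<Rightarrow> 'k" by unfold_locales (auto simp: algebra_simps)
  have l: "Vector_Spaces.linear smul (*) (c i)" if "i < n" for i using assms that by (simp add: coords_def)
  have ladd: "c i (x + y) = c i x + c i y" if "i < n" for i x y
  proof -
    interpret Vector_Spaces.linear smul "(*)" "c i" using l that .
    show ?thesis by (rule add)
  qed
  have lscale: "c i (smul a x) = a * c i x" if "i < n" for i x a
  proof -
    interpret Vector_Spaces.linear smul "(*)" "c i" using l that .
    show ?thesis by (rule scale)
  qed
  have eq: "(\<Sum>i<n. c i x * cj (c i x)) = of_real (\<Sum>i<n. (norm (c i x))\<^sup>2)" for x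
    by (simp add: mult_cj)
  then show "(\<Sum>i<n. c i x * cj (c i x)) = of_real (\<Sum>i<n. (norm (c i x))\<^sup>2)" .
  show "is_inner_product cj smul (\<lambda>x y. \<Sum>i<n. c i x * cj (c i y))"
    unfolding is_inner_product_def
  proof (intro conjI allI impI)
    show "Vector_Spaces.linear smul (*) (\<lambda>x. \<Sum>i<n. c i x * cj (c i y))" for y
      by unfold_locales
        (simp_all add: ladd lscale algebra_simps sum.distrib sum_distrib_left)
    show "(\<Sum>i<n. c i y * cj (c i x)) = cj (\<Sum>i<n. c i x * cj (c i y))" for x y
      by (simp add: cj_sum cj_mult cj_cj mult.commute)
    fix x :: 'a assume x: "x \<noteq> 0"
    have "\<exists>i<n. c i x \<noteq> 0"
    proof (rule ccontr)
      assume "\<not> ?thesis"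
      then have "(\<Sum>i<n. smul (c i x) (b i)) = 0" by simp
      with x assms show False by (metis coords_def)
    qed
    then have "(\<Sum>i<n. (norm (c i x))\<^sup>2) > 0" by (auto intro!: sum_pos2)
    then show "\<exists>r>0. (\<Sum>i<n. c i x * cj (c i x)) = of_real r" using eq by blast
  qed
  show "orthonormal (\<lambda>x y. \<Sum>i<n. c i x * cj (c i y)) n b"
    unfolding orthonormal_def
  proof (intro allI impI)
    fix i j assume ij: "i < n" "j < n"
    have "(\<Sum>l<n. c l (b i) * cj (c l (b j))) = (\<Sum>l<n. if l = i then (if i = j then 1 else 0) else 0)"
      using assms ij by (intro sum.cong) (auto simp: coords_def)
    then show "(\<Sum>l<n. c l (b i) * cj (c l (b j))) = (if i = j then 1 else 0)" using ij by simp
  qed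
qed

end

section \<open>The ellipsoid of maximal volume\<close>

text \<open>In the Leibniz expansion, a permutation other than the identity moves at least two
  indices, so its term has two factors that vanish at 0 and adds nothing to the derivative; the
  identity contributes the trace.\<close>

lemma det_one_plus_derivative:
  fixes A :: "nat \<Rightarrow> nat \<Rightarrow> 'k::real_normed_field"
  shows "((\<lambda>x. Determinant.det (mat n n (\<lambda>(i, j). (if i = j then 1 else 0) + x * A i j)))
           has_field_derivative (\<Sum>i<n. A i i)) (at 0)"
proof -
  let ?f = "\<lambda>p i x. (if i = p i then 1 else 0) + x * A i (p i)"
  let ?P = "{p. p permutes {0..<n}}"
  have eq: "(\<lambda>x. Determinant.det (mat n n (\<lambda>(i, j). (if i = j then 1 else 0) + x * A i j)))
      = (\<lambda>x. \<Sum>p\<in>?P. signof p * (\<Prod>i=0..<n. ?f p i x))"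
    by (subst det_def'[of _ n]) (auto intro!: ext sum.cong prod.cong simp: permutes_in_image)
  have fin: "finite ?P" by (simp add: finite_permutations)
  have "((\<lambda>x. \<Sum>p\<in>?P. signof p * (\<Prod>i=0..<n. ?f p i x)) has_field_derivative
      (\<Sum>p\<in>?P. signof p * (\<Sum>i=0..<n. A i (p i) * (\<Prod>j\<in>{0..<n} - {i}. ?f p j 0)))) (at 0)"
    by (intro DERIV_sum DERIV_cmult has_field_derivative_prod) (auto intro!: derivative_eq_intros)
  also have "(\<Sum>p\<in>?P. signof p * (\<Sum>i=0..<n. A i (p i) * (\<Prod>j\<in>{0..<n} - {i}. ?f p j 0)))
     = (\<Sum>p\<in>?P. if p = id then (\<Sum>i=0..<n. A i i) else 0)"
  proof (rule sum.cong)
    fix p assume "p \<in> ?P"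
    then have p: "p permutes {0..<n}" by simp
    show "signof p * (\<Sum>i=0..<n. A i (p i) * (\<Prod>j\<in>{0..<n} - {i}. ?f p j 0))
        = (if p = id then (\<Sum>i=0..<n. A i i) else 0)"
    proof (cases "p = id")
      case False
      then obtain a where a: "p a \<noteq> a" by (auto simp: fun_eq_iff)
      then have an: "a \<in> {0..<n}" using p by (metis permutes_not_in)
      have pa: "p a \<in> {0..<n}" using p an by (simp only: permutes_in_image)
      have ppa: "p (p a) \<noteq> p a" using a p by (metis permutes_inj inj_eq)
      \<comment> \<open>Differentiation removes a single factor \<open>i\<close>; of the two moved
        indices \<open>a\<close> and \<open>p a\<close> at least one is left.\<close>
      have "(\<Prod>j\<in>{0..<n} - {i}. ?f p j 0) = 0" for i
      proof -
        obtain j where "j \<in> {0..<n} - {i}" "p j \<noteq> j" using a an pa ppa by (cases "a = i") auto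
        then show ?thesis by (intro prod_zero bexI[of _ j]) auto
      qed
      then show ?thesis using False by (simp only: mult_zero_right sum.neutral_const if_False)
    qed simp
  qed simp
  also have "\<dots> = (\<Sum>i<n. A i i)"
    using fin by (simp add: permutes_id lessThan_atLeast0)
  finally show ?thesis unfolding eq .
qed

text \<open>Comparison of first-order terms as \<open>t\<close> tends to 0 from the right: the
  left-hand side is \<open>norm (1 + t u + o(t))\<close> and the right-hand side is
  \<open>1 + n t / 2 + o(t)\<close>, because \<open>1 + c * t\<^sup>2\<close> has no first-order
  part.\<close>

lemma first_order_bound:
  fixes g :: "'k::real_normed_field \<Rightarrow> 'k" and u c :: real
  assumes g: "(g has_field_derivative of_real u) (at 0)" "g 0 = 1" and c: "c \<ge> 0"
    and le: "\<And>t. 0 < t \<Longrightarrow> norm (g (of_real t)) \<le> sqrt ((1 + t) * (1 + c * t\<^sup>2)) ^ n"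
  shows "u \<le> n / 2"
proof -
  define h where "h t = sqrt ((1 + t) * (1 + c * t\<^sup>2)) ^ n" for t :: real
  have "(h has_real_derivative n / 2) (at 0)"
    unfolding h_def by (auto intro!: derivative_eq_intros)
  then have h: "((\<lambda>t. (h t - h 0) / t) \<longlongrightarrow> n / 2) (at_right 0)"
    by (auto simp: has_field_derivative_iff intro: filterlim_mono[OF _ order_refl at_le])
  have "((\<lambda>x. (g x - g 0) / x) \<longlongrightarrow> of_real u) (at 0)" using g by (simp add: has_field_derivative_iff)
  moreover have "filterlim (of_real :: real \<Rightarrow> 'k) (at 0) (at_right 0)"
  proof (rule filterlim_atI)
    show "((of_real :: real \<Rightarrow> 'k) \<longlongrightarrow> 0) (at_right 0)"
      by (rule tendsto_eq_intros refl | simp)+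
    show "\<forall>\<^sub>F x in at_right (0::real). (of_real x :: 'k) \<noteq> 0"
      by (auto simp: eventually_at_filter)
  qed
  ultimately have "((\<lambda>t. (g (of_real t) - g 0) / of_real t) \<longlongrightarrow> of_real u) (at_right (0::real))"
    by (rule filterlim_compose)
  then have "((\<lambda>t. norm ((g (of_real t) - g 0) / of_real t - of_real u)) \<longlongrightarrow> 0) (at_right (0::real))"
    by (simp add: tendsto_norm_zero LIM_zero)
  then have lim: "((\<lambda>t. u - norm ((g (of_real t) - g 0) / of_real t - of_real u)) \<longlongrightarrow> u - 0) (at_right (0::real))"
    by (intro tendsto_diff tendsto_const)
  have "u - norm ((g (of_real t) - g 0) / of_real t - of_real u) \<le> (h t - h 0) / t" if t: "t > 0" for t
  proof -
    define r where "r = (g (of_real t) - g 0) / of_real t - of_real u"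
    have "g (of_real t) = of_real (1 + t * u) + of_real t * r"
      using t g(2) by (simp add: r_def field_simps)
    then have "norm (of_real (1 + t * u) :: 'k) \<le> norm (g (of_real t)) + norm (of_real t * r)"
      by (metis add_diff_cancel_right' norm_triangle_ineq4)
    moreover have "norm (of_real (1 + t * u) :: 'k) \<ge> 1 + t * u"
      unfolding norm_of_real by simp
    ultimately have "1 + t * u \<le> h t + t * norm r"
      using le[OF t] t by (simp add: h_def norm_mult)
    moreover have "h 0 = 1" by (simp add: h_def)
    ultimately have "u * t - norm r * t \<le> h t - h 0" by (simp add: mult.commute)
    then have "u - norm r \<le> (h t - h 0) / t" using t by (simp add: field_simps)
    then show ?thesis by (simp add: r_def)
  qed
  then have "\<forall>\<^sub>F t in at_right 0. u - norm ((g (of_real t) - g 0) / of_real t - of_real u) \<le> (h t - h 0) / t"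
    by (auto simp: eventually_at_filter)
  from tendsto_le[OF _ h lim this] show ?thesis by simp
qed

text \<open>Matrices and coefficient vectors are functions with the product topology, so compactness
  is Tychonoff's theorem; vanishing off \<open>A\<close> makes the remaining factors
  singletons.\<close>

lemma compact_box:
  fixes R :: real
  shows "compact {T :: 'p \<Rightarrow> 'k::{real_normed_field, euclidean_space}. \<forall>p. if p \<in> A then norm (T p) \<le> R else T p = 0}"
proof -
  have "{T :: 'p \<Rightarrow> 'k. \<forall>p. if p \<in> A then norm (T p) \<le> R else T p = 0}
      = PiE UNIV (\<lambda>p. if p \<in> A then cball 0 R else {0})"
    by (auto simp: PiE_def Pi_def)
  moreover have "compactin (product_topology (\<lambda>_. euclidean) UNIV)
      (PiE UNIV (\<lambda>p. if p \<in> A then cball (0::'k) R else {0}))"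
    by (simp add: compactin_PiE)
  ultimately show ?thesis by (simp add: euclidean_product_topology)
qed

locale normed_fin_dim = normed_space smul N + fin_dim_space smul cj n
  for smul :: "'k::{real_normed_field, euclidean_space} \<Rightarrow> 'a::ab_group_add \<Rightarrow> 'a" and N cj n
begin

lemma N_0 [simp]: "N 0 = 0" by (simp add: norm_eq_zero_iff)

lemma N_minus [simp]: "N (- x) = N x"
  using norm_scale[of "-1" x] by simp

lemma N_nonneg [simp]: "N x \<ge> 0"
  using norm_add_le[of x "- x"] by simp

lemma N_pos: "x \<noteq> 0 \<Longrightarrow> N x > 0"
  using norm_eq_zero_iff[of x] N_nonneg[of x] by linarith

lemma N_sum_le: "N (\<Sum>i\<in>A. f i) \<le> (\<Sum>i\<in>A. N (f i))"
proof (induction A rule: infinite_finite_induct)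
  case (insert a A)
  then show ?case using norm_add_le[of "f a" "sum f A"] by simp
qed simp_all

lemma N_diff_abs: "\<bar>N x - N y\<bar> \<le> N (x - y)"
  using norm_add_le[of "x - y" y] norm_add_le[of "y - x" x] N_minus[of "x - y"] by simp

lemma N_comb_le: "N (\<Sum>i\<in>A. smul (a i) (v i)) \<le> L2_set (\<lambda>i. norm (a i)) A * L2_set (\<lambda>i. N (v i)) A"
proof -
  have "N (\<Sum>i\<in>A. smul (a i) (v i)) \<le> (\<Sum>i\<in>A. \<bar>norm (a i)\<bar> * \<bar>N (v i)\<bar>)"
    by (intro order.trans[OF N_sum_le]) (simp add: norm_scale)
  also have "\<dots> \<le> L2_set (\<lambda>i. norm (a i)) A * L2_set (\<lambda>i. N (v i)) A" by (rule L2_set_mult_ineq)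
  finally show ?thesis .
qed

lemma continuous_N_comb:
  assumes "\<And>q. q \<in> Q \<Longrightarrow> continuous_on S (g q)"
  shows "continuous_on S (\<lambda>t. N (\<Sum>q\<in>Q. smul (g q t) (v q)))"
  unfolding continuous_on_def
proof
  fix t assume t: "t \<in> S"
  have "((\<lambda>s. \<Sum>q\<in>Q. norm (g q s - g q t) * N (v q)) \<longlongrightarrow> (\<Sum>q\<in>Q. norm (g q t - g q t) * N (v q))) (at t within S)"
    using assms t by (intro tendsto_intros) (auto simp: continuous_on_def)
  then have lim: "((\<lambda>s. \<Sum>q\<in>Q. norm (g q s - g q t) * N (v q)) \<longlongrightarrow> 0) (at t within S)" by simp
  have "norm (N (\<Sum>q\<in>Q. smul (g q s) (v q)) - N (\<Sum>q\<in>Q. smul (g q t) (v q))) \<le> (\<Sum>q\<in>Q. norm (g q s - g q t) * N (v q))" for s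
  proof -
    have "norm (N (\<Sum>q\<in>Q. smul (g q s) (v q)) - N (\<Sum>q\<in>Q. smul (g q t) (v q)))
      \<le> N (\<Sum>q\<in>Q. smul (g q s - g q t) (v q))"
      using N_diff_abs[of "\<Sum>q\<in>Q. smul (g q s) (v q)" "\<Sum>q\<in>Q. smul (g q t) (v q)"]
      by (simp add: sum_subtractf scale_left_diff_distrib)
    also have "\<dots> \<le> (\<Sum>q\<in>Q. norm (g q s - g q t) * N (v q))"
      by (intro order.trans[OF N_sum_le]) (simp add: norm_scale)
    finally show ?thesis .
  qed
  then have "((\<lambda>s. N (\<Sum>q\<in>Q. smul (g q s) (v q)) - N (\<Sum>q\<in>Q. smul (g q t) (v q))) \<longlongrightarrow> 0) (at t within S)"
    by (rule Lim_null_comparison[OF always_eventually[OF allI] lim])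
  then show "((\<lambda>s. N (\<Sum>q\<in>Q. smul (g q s) (v q))) \<longlongrightarrow> N (\<Sum>q\<in>Q. smul (g q t) (v q))) (at t within S)"
    by (rule LIM_zero_cancel)
qed

text \<open>Equivalence of norms: on the Euclidean unit sphere of the coefficients, \<open>N\<close>
  attains a positive minimum \<open>m\<close>, and \<open>R = 1 / m\<close>. For
  \<open>n = 0\<close> the sphere is empty and any positive \<open>m\<close> serves.\<close>

lemma coords_bounded:
  assumes "coords b c"
  shows "\<exists>R>0. \<forall>x. L2_set (\<lambda>i. norm (c i x)) {..<n} \<le> R * N x"
proof -
  let ?B = "{a :: nat \<Rightarrow> 'k. \<forall>p. if p \<in> {..<n} then norm (a p) \<le> 1 else a p = 0}"
  let ?S = "?B \<inter> {a. L2_set (\<lambda>i. norm (a i)) {..<n} = 1}"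
  let ?N = "\<lambda>a. N (\<Sum>i<n. smul (a i) (b i))"
  have "closed {a :: nat \<Rightarrow> 'k. L2_set (\<lambda>i. norm (a i)) {..<n} = 1}"
    unfolding L2_set_def by (intro closed_Collect_eq continuous_intros) auto
  then have comp: "compact ?S" by (intro compact_Int_closed compact_box) auto
  have cont: "continuous_on ?S ?N"
    by (rule continuous_N_comb) (auto intro: continuous_on_subset[OF continuous_on_product_coordinates])
  have "\<exists>m>0. \<forall>a\<in>?S. m \<le> ?N a"
  proof (cases "?S = {}")
    case False
    then obtain a where a: "a \<in> ?S" "\<forall>a'\<in>?S. ?N a \<le> ?N a'"
      using continuous_attains_inf[OF comp _ cont] by blast
    have "?N a \<noteq> 0"
    proof
      assume "?N a = 0"
      then have "(\<Sum>i<n. smul (a i) (b i)) = 0" by (simp add: norm_eq_zero_iff)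
      moreover have "a i = c i (\<Sum>i<n. smul (a i) (b i))" if "i < n" for i using coords_comb[OF assms that] by simp
      moreover have "c i 0 = 0" if "i < n" for i using coords_sum[OF assms that, of "\<lambda>_. 0" _ "{}"] by simp
      ultimately have "a i = 0" if "i < n" for i using that by metis
      then have "L2_set (\<lambda>i. norm (a i)) {..<n} = 0" by (simp add: L2_set_def)
      then show False using a(1) by simp
    qed
    then have "?N a > 0" using N_nonneg by (metis order_le_imp_less_or_eq)
    then show ?thesis using a(2) by blast
  qed (auto intro: exI[of _ 1])
  then obtain m where m: "m > 0" "\<And>a. a \<in> ?S \<Longrightarrow> m \<le> ?N a" by blast
  have "L2_set (\<lambda>i. norm (c i x)) {..<n} \<le> (1 / m) * N x" for x
  proof -
    define L where "L = L2_set (\<lambda>i. norm (c i x)) {..<n}"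
    show ?thesis
    proof (cases "L = 0")
      case True
      then show ?thesis using m by (simp add: L_def)
    next
      case False
      then have L: "L > 0" by (simp add: L_def less_le)
      define a where "a i = (if i < n then c i x / of_real L else 0)" for i
      have "L2_set (\<lambda>i. norm (a i)) {..<n} = L2_set (\<lambda>i. (1 / L) * norm (c i x)) {..<n}"
        using L by (intro L2_set_cong) (auto simp: a_def norm_divide)
      also have "\<dots> = 1" using L by (subst L2_set_right_distrib[symmetric]) (auto simp: L_def)
      finally have a1: "L2_set (\<lambda>i. norm (a i)) {..<n} = 1" .
      then have "a \<in> ?S" using member_le_L2_set[of "{..<n}" _ "\<lambda>i. norm (a i)"] by (auto simp: a_def)
      then have "m \<le> ?N a" by (rule m)
      also have "(\<Sum>i<n. smul (a i) (b i)) = smul (of_real (1 / L)) (\<Sum>i<n. smul (c i x) (b i))"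
        by (simp add: scale_sum_right a_def divide_inverse mult.commute)
      also have "(\<Sum>i<n. smul (c i x) (b i)) = x" using assms by (metis coords_def)
      also have "N (smul (of_real (1 / L)) x) = N x / L" using L by (simp add: norm_scale norm_divide)
      finally show ?thesis using m L unfolding L_def[symmetric] by (simp add: field_simps)
    qed
  qed
  then show ?thesis using m by (intro exI[of _ "1 / m"]) auto
qed

text \<open>For finite \<open>J\<close>, the map from Euclidean space on \<open>J\<close> into
  \<open>X\<close> given by \<open>w\<close> is a contraction: it sends the unit ball to an
  ellipsoid inside the unit ball of \<open>X\<close>. Dually, the quadratic form that sums
  \<open>\<bar>f (w j)\<bar>\<^sup>2\<close> is dominated by the squared dual norm of
  \<open>f\<close>.\<close>

definition feasible :: "'j set \<Rightarrow> ('j \<Rightarrow> 'a) \<Rightarrow> bool" where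
  "feasible J w \<longleftrightarrow> (\<forall>a. N (\<Sum>j\<in>J. smul (a j) (w j)) \<le> L2_set (\<lambda>j. norm (a j)) J)"

lemma feasibleD: "feasible J w \<Longrightarrow> N (\<Sum>j\<in>J. smul (a j) (w j)) \<le> L2_set (\<lambda>j. norm (a j)) J"
  by (simp add: feasible_def)

text \<open>A basis spanning an ellipsoid of maximal volume inside the unit ball.\<close>

lemma exists_max_det:
  "\<exists>y c. coords y c \<and> feasible {..<n} y \<and>
     (\<forall>T. feasible {..<n} (\<lambda>l. \<Sum>i<n. smul (T (i, l)) (y i)) \<longrightarrow> norm (Determinant.det (mat n n T)) \<le> 1)"
proof -
  obtain b \<beta> where b: "coords b \<beta>" using exists_coords by blast
  obtain R where R: "R > 0" "\<And>x. L2_set (\<lambda>i. norm (\<beta> i x)) {..<n} \<le> R * N x" using coords_bounded[OF b] by blast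
  let ?y = "\<lambda>T l. \<Sum>i<n. smul (T (i, l)) (b i)"
  define K where "K = {T :: nat \<times> nat \<Rightarrow> 'k. \<forall>p. if p \<in> {..<n} \<times> {..<n} then norm (T p) \<le> R else T p = 0}"
  define Fs where "Fs = {T :: nat \<times> nat \<Rightarrow> 'k. feasible {..<n} (?y T)}"
  have yy: "(\<Sum>l<n. smul (a l) (?y T l)) = (\<Sum>i<n. smul (\<Sum>l<n. T (i, l) * a l) (b i))" for a :: "nat \<Rightarrow> 'k" and T
    by (simp add: scale_sum_right scale_sum_left mult.commute) (rule sum.swap)
  have coord: "continuous_on UNIV (\<lambda>T :: nat \<times> nat \<Rightarrow> 'k. T p)" for p by simp
  have "Fs = (\<Inter>a. {T. N (\<Sum>i<n. smul (\<Sum>l<n. T (i, l) * a l) (b i)) \<le> L2_set (\<lambda>j. norm (a j)) {..<n}})"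
    by (auto simp: Fs_def feasible_def yy)
  moreover have "closed \<dots>"
    by (intro closed_INT ballI closed_Collect_le continuous_N_comb continuous_intros coord)
  ultimately have comp: "compact (K \<inter> Fs)" unfolding K_def by (intro compact_Int_closed compact_box) auto
  have cont: "continuous_on (K \<inter> Fs) (\<lambda>T. norm (Determinant.det (mat n n T)))"
  proof -
    have "Determinant.det (mat n n T) = (\<Sum>p\<in>{p. p permutes {0..<n}}. signof p * (\<Prod>i=0..<n. T (i, p i)))" for T :: "nat \<times> nat \<Rightarrow> 'k"
      by (subst det_def'[of _ n]) (auto intro!: sum.cong prod.cong simp: permutes_in_image)
    then show ?thesis
      by (auto intro!: continuous_intros continuous_on_subset[OF coord])
  qed
  have feas_cong: "feasible {..<n} u \<longleftrightarrow> feasible {..<n} v" if "\<And>l. l < n \<Longrightarrow> u l = v l" for u v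
  proof -
    have "(\<Sum>j<n. smul (a j) (u j)) = (\<Sum>j<n. smul (a j) (v j))" for a
      using that by (intro sum.cong) auto
    then show ?thesis unfolding feasible_def by simp
  qed
  \<comment> \<open>Feasibility alone bounds the entries by \<open>R\<close>, and entries outside
    the \<open>n\<close> by \<open>n\<close> block affect neither feasibility nor the determinant;
    so a maximum over the compact set is one over all of \<open>Fs\<close>.\<close>
  have restr: "\<exists>T'\<in>K \<inter> Fs. mat n n T' = mat n n T" if T: "T \<in> Fs" for T
  proof -
    define T' where "T' p = (if p \<in> {..<n} \<times> {..<n} then T p else 0)" for p
    have "norm (T (i, l)) \<le> R" if il: "i < n" "l < n" for i l
    proof -
      have "N (\<Sum>j<n. smul (if j = l then 1 else 0) (?y T j)) \<le> L2_set (\<lambda>j. norm (if j = l then 1 else 0 :: 'k)) {..<n}"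
        using T by (intro feasibleD) (simp add: Fs_def)
      moreover have "(\<Sum>j<n. smul (if j = l then 1 else 0) (?y T j)) = ?y T l"
        using il by (simp add: if_distrib[of "\<lambda>z. smul z _"] cong: if_cong)
      moreover have "L2_set (\<lambda>j. norm (if j = l then 1 else 0 :: 'k)) {..<n} = 1"
        using il unfolding L2_set_def by (simp add: if_distrib[of norm] if_distrib[of "\<lambda>z. z\<^sup>2"] cong: if_cong)
      ultimately have "N (?y T l) \<le> 1" by simp
      then have "R * N (?y T l) \<le> R" using R by simp
      moreover have "norm (T (i, l)) = norm (\<beta> i (?y T l))" using coords_comb[OF b il(1)] by simp
      moreover have "\<dots> \<le> L2_set (\<lambda>i. norm (\<beta> i (?y T l))) {..<n}"
        using il by (intro member_le_L2_set) auto
      ultimately show ?thesis using R(2)[of "?y T l"] by linarith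
    qed
    then have "T' \<in> K" by (auto simp: K_def T'_def)
    moreover have "feasible {..<n} (?y T') \<longleftrightarrow> feasible {..<n} (?y T)"
      by (rule feas_cong) (simp add: T'_def)
    then have "T' \<in> Fs" using T by (simp add: Fs_def)
    moreover have "mat n n T' = mat n n T" by (rule eq_matI) (auto simp: T'_def)
    ultimately show ?thesis by blast
  qed
  \<comment> \<open>A multiple of \<open>b\<close> small enough to be feasible shows that the
    maximal determinant is nonzero, hence that the maximiser gives a basis.\<close>
  define \<eta> where "\<eta> = 1 / (1 + L2_set (\<lambda>i. N (b i)) {..<n})"
  have \<eta>: "\<eta> > 0" unfolding \<eta>_def by (simp add: add_pos_nonneg)
  define T1 where "T1 = (\<lambda>(i, l). if i = (l::nat) then of_real \<eta> else 0 :: 'k)"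
  have T1: "T1 \<in> Fs"
  proof -
    have "N (\<Sum>l<n. smul (a l) (?y T1 l)) \<le> L2_set (\<lambda>j. norm (a j)) {..<n}" for a
    proof -
      have "(\<Sum>l<n. T1 (i, l) * a l) = of_real \<eta> * a i" if "i < n" for i
        using that by (simp add: T1_def if_distrib[of "\<lambda>z. z * _"] cong: if_cong)
      then have "N (\<Sum>l<n. smul (a l) (?y T1 l)) = N (\<Sum>i<n. smul (of_real \<eta> * a i) (b i))"
        unfolding yy by simp
      also have "\<dots> \<le> L2_set (\<lambda>i. norm (of_real \<eta> * a i)) {..<n} * L2_set (\<lambda>i. N (b i)) {..<n}" by (rule N_comb_le)
      also have "\<dots> = \<eta> * L2_set (\<lambda>i. N (b i)) {..<n} * L2_set (\<lambda>i. norm (a i)) {..<n}"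
        using \<eta> by (simp add: norm_mult L2_set_right_distrib[symmetric])
      also have "\<dots> \<le> 1 * L2_set (\<lambda>i. norm (a i)) {..<n}"
        by (intro mult_right_mono) (auto simp: \<eta>_def divide_simps add_pos_nonneg add_nonneg_eq_0_iff)
      finally show ?thesis by simp
    qed
    then show ?thesis by (simp add: Fs_def feasible_def)
  qed
  have "mat n n T1 = of_real \<eta> \<cdot>\<^sub>m 1\<^sub>m n" by (rule eq_matI) (auto simp: T1_def)
  then have dT1: "Determinant.det (mat n n T1) \<noteq> 0" using \<eta> by simp
  have "K \<inter> Fs \<noteq> {}" using restr[OF T1] by blast
  then obtain T0 where T0: "T0 \<in> K \<inter> Fs"
    "\<And>T. T \<in> K \<inter> Fs \<Longrightarrow> norm (Determinant.det (mat n n T)) \<le> norm (Determinant.det (mat n n T0))"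
    using continuous_attains_sup[OF comp _ cont] by blast
  have max: "norm (Determinant.det (mat n n T)) \<le> norm (Determinant.det (mat n n T0))" if "T \<in> Fs" for T
    using restr[OF that] T0(2) by metis
  have d0: "Determinant.det (mat n n T0) \<noteq> 0" using max[OF T1] dT1 by auto
  have car: "mat n n T0 \<in> carrier_mat n n" by simp
  obtain S where S: "S \<in> carrier_mat n n" "S * mat n n T0 = 1\<^sub>m n" "mat n n T0 * S = 1\<^sub>m n"
    using det_non_zero_imp_unit[OF car d0, of "()"] by (auto simp: Units_def ring_mat_def)
  have S1: "(\<Sum>m<n. S $$ (i, m) * T0 (m, l)) = (if i = l then 1 else 0)" if "i < n" "l < n" for i l
  proof -
    have "(S * mat n n T0) $$ (i, l) = (\<Sum>m<n. S $$ (i, m) * T0 (m, l))"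
      using S(1) that by (auto simp: scalar_prod_def lessThan_atLeast0)
    then show ?thesis using S(2) that by simp
  qed
  have S2: "(\<Sum>m<n. T0 (i, m) * S $$ (m, l)) = (if i = l then 1 else 0)" if "i < n" "l < n" for i l
  proof -
    have "(mat n n T0 * S) $$ (i, l) = (\<Sum>m<n. T0 (i, m) * S $$ (m, l))"
      using S(1) that by (auto simp: scalar_prod_def lessThan_atLeast0)
    then show ?thesis using S(3) that by simp
  qed
  define y where "y = ?y T0"
  define c where "c i x = (\<Sum>l<n. S $$ (i, l) * \<beta> l x)" for i x
  interpret KK: vector_space "(*) :: 'k \<Rightarrow> 'k \<Rightarrow> 'k" by unfold_locales (auto simp: algebra_simps)
  have \<beta>_add: "\<beta> l (x + z) = \<beta> l x + \<beta> l z" and \<beta>_scale: "\<beta> l (smul a x) = a * \<beta> l x" if "l < n" for l x z a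
  proof -
    interpret Vector_Spaces.linear smul "(*)" "\<beta> l" using b that by (simp add: coords_def)
    show "\<beta> l (x + z) = \<beta> l x + \<beta> l z" "\<beta> l (smul a x) = a * \<beta> l x" by (rule add, rule scale)
  qed
  have "coords y c"
    unfolding coords_def
  proof (intro conjI allI impI)
    show "Vector_Spaces.linear smul (*) (c i)" for i
      unfolding c_def by unfold_locales
        (simp_all add: \<beta>_add \<beta>_scale algebra_simps sum.distrib sum_distrib_left)
    show "x = (\<Sum>i<n. smul (c i x) (y i))" for x
    proof -
      have "(\<Sum>i<n. smul (c i x) (y i)) = (\<Sum>i<n. smul (\<Sum>l<n. T0 (i, l) * c l x) (b i))"
        unfolding y_def by (rule yy)
      also have "\<dots> = (\<Sum>i<n. smul (\<beta> i x) (b i))"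
      proof (intro sum.cong refl)
        fix i assume i: "i \<in> {..<n}"
        have "(\<Sum>l<n. T0 (i, l) * c l x) = (\<Sum>m<n. (\<Sum>l<n. T0 (i, l) * S $$ (l, m)) * \<beta> m x)"
          by (simp add: c_def sum_distrib_left sum_distrib_right mult.assoc) (rule sum.swap)
        also have "\<dots> = (\<Sum>m<n. (if i = m then 1 else 0) * \<beta> m x)"
          using i S2 by (intro sum.cong) auto
        finally show "smul (\<Sum>l<n. T0 (i, l) * c l x) (b i) = smul (\<beta> i x) (b i)"
          using i by (simp add: if_distrib[of "\<lambda>z. z * _"] cong: if_cong)
      qed
      finally show ?thesis using b by (metis coords_def)
    qed
    show "c i (y j) = (if i = j then 1 else 0)" if "i < n" "j < n" for i j
    proof -
      have "c i (y j) = (\<Sum>m<n. S $$ (i, m) * T0 (m, j))"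
        unfolding c_def y_def by (intro sum.cong) (auto simp: coords_comb[OF b])
      then show ?thesis using S1 that by simp
    qed
  qed
  moreover have "feasible {..<n} y" using T0 by (simp add: y_def Fs_def)
  moreover have "norm (Determinant.det (mat n n T)) \<le> 1"
    if T: "feasible {..<n} (\<lambda>l. \<Sum>i<n. smul (T (i, l)) (y i))" for T
  proof -
    \<comment> \<open>The matrix product \<open>T0 T\<close> expresses the competitor in the
      original basis \<open>b\<close>; by multiplicativity of the determinant, maximality of
      \<open>T0\<close> becomes the bound 1 for \<open>T\<close> relative to
      \<open>y\<close>.\<close>
    define T' where "T' = (\<lambda>(m, l). \<Sum>i<n. T0 (m, i) * T (i, l))"
    have "(\<Sum>i<n. smul (T (i, l)) (y i)) = ?y T' l" for l
      using yy[of "\<lambda>i. T (i, l)" T0] by (simp add: y_def T'_def)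
    then have "T' \<in> Fs" using T by (simp add: Fs_def)
    moreover have "mat n n T' = mat n n T0 * mat n n T"
      by (rule eq_matI) (auto simp: T'_def scalar_prod_def lessThan_atLeast0)
    then have "Determinant.det (mat n n T') = Determinant.det (mat n n T0) * Determinant.det (mat n n T)"
      by (simp add: det_mult[of _ n])
    ultimately have "norm (Determinant.det (mat n n T0)) * norm (Determinant.det (mat n n T)) \<le> norm (Determinant.det (mat n n T0)) * 1"
      using max[of T'] by (simp add: norm_mult)
    then show ?thesis by (rule mult_left_le_imp_le) (use d0 in simp)
  qed
  ultimately show ?thesis by blast
qed

end


section \<open>First-order optimality of the maximal ellipsoid\<close>

context conj_field begin

lemma norm_sum_mult_sq_le:
  fixes a b :: "'j \<Rightarrow> 'k"
  shows "(norm (\<Sum>j\<in>J. a j * b j))\<^sup>2 \<le> (\<Sum>j\<in>J. (norm (a j))\<^sup>2) * (\<Sum>j\<in>J. (norm (b j))\<^sup>2)"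
proof -
  have "norm (\<Sum>j\<in>J. a j * b j) \<le> (\<Sum>j\<in>J. norm (a j) * norm (b j))"
    by (intro order.trans[OF norm_sum]) (simp add: norm_mult)
  then have "(norm (\<Sum>j\<in>J. a j * b j))\<^sup>2 \<le> (\<Sum>j\<in>J. norm (a j) * norm (b j))\<^sup>2"
    by (intro power_mono) auto
  also have "\<dots> \<le> (\<Sum>j\<in>J. (norm (a j))\<^sup>2) * (\<Sum>j\<in>J. (norm (b j))\<^sup>2)"
    by (rule Cauchy_Schwarz_ineq_sum)
  finally show ?thesis .
qed

lemma norm_sq_diff:
  "of_real ((norm (a - of_real r * q))\<^sup>2)
     = of_real ((norm a)\<^sup>2) - of_real r * (a * cj q + q * cj a) + of_real (r\<^sup>2 * (norm q)\<^sup>2)"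
proof -
  have "of_real (r\<^sup>2 * (norm q)\<^sup>2) = of_real r * of_real r * (q * cj q)"
    unfolding mult_cj by (simp add: power2_eq_square)
  then show ?thesis
    unfolding mult_cj[symmetric] by (simp add: cj_diff cj_mult cj_of_real algebra_simps)
qed

end

context normed_fin_dim begin

text \<open>
  First-order optimality of the determinant at \<open>y\<close>: with \<open>W\<close> the matrix of \<open>w\<close> in the basis \<open>y\<close>
  and \<open>K = W W\<^sup>*\<close>, the basis \<open>y (1 + \<tau>/2 K)\<close> is feasible up to the factor
  \<open>sqrt ((1 + \<tau>) (1 + O(\<tau>\<^sup>2)))\<close>, so that \<open>det (1 + \<tau>/2 K) = 1 + \<tau>/2 tr K + O(\<tau>\<^sup>2)\<close> gives \<open>tr K \<le> n\<close>.
\<close>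

lemma max_det_trace_le:
  assumes y: "coords y c" "feasible {..<n} y"
    and max: "\<And>T. feasible {..<n} (\<lambda>l. \<Sum>i<n. smul (T (i, l)) (y i)) \<Longrightarrow> norm (Determinant.det (mat n n T)) \<le> 1"
    and w: "feasible J w"
  shows "(\<Sum>j\<in>J. \<Sum>i<n. (norm (c i (w j)))\<^sup>2) \<le> n"
proof -
  define W where "W i j = c i (w j)" for i j
  define t where "t = (\<Sum>j\<in>J. \<Sum>i<n. (norm (W i j))\<^sup>2)"
  define K where "K i l = (\<Sum>j\<in>J. W i j * cj (W l j))" for i l
  define g where "g x = Determinant.det (mat n n (\<lambda>(i, l). (if i = l then 1 else 0) + x * (K i l * of_real (1/2))))" for x
  have t0: "t \<ge> 0" unfolding t_def by (intro sum_nonneg) auto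
  have "(\<Sum>i<n. K i i * of_real (1/2)) = of_real (t / 2)"
  proof -
    have "(\<Sum>i<n. K i i) = of_real (\<Sum>i<n. \<Sum>j\<in>J. (norm (W i j))\<^sup>2)" by (simp add: K_def mult_cj)
    also have "(\<Sum>i<n. \<Sum>j\<in>J. (norm (W i j))\<^sup>2) = t" unfolding t_def by (rule sum.swap)
    finally show ?thesis by (simp add: sum_divide_distrib[symmetric])
  qed
  then have g': "(g has_field_derivative of_real (t / 2)) (at 0)"
    using det_one_plus_derivative[of n "\<lambda>i l. K i l * of_real (1/2)"] unfolding g_def by (simp only:)
  have "mat n n (\<lambda>(i, l). (if i = l then 1 else 0 :: 'k) + 0 * (K i l * of_real (1/2))) = 1\<^sub>m n"
    by (rule eq_matI) auto
  then have g0: "g 0 = 1" unfolding g_def by simp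
  have bound: "norm (g (of_real \<tau>)) \<le> sqrt ((1 + \<tau>) * (1 + t\<^sup>2 / 4 * \<tau>\<^sup>2)) ^ n" if \<tau>: "\<tau> > 0" for \<tau>
  proof -
    define s where "s = sqrt ((1 + \<tau>) * (1 + t\<^sup>2 / 4 * \<tau>\<^sup>2))"
    have s2: "s\<^sup>2 = (1 + \<tau>) * (1 + t\<^sup>2 / 4 * \<tau>\<^sup>2)" unfolding s_def using \<tau> by simp
    have s: "s > 0" unfolding s_def using \<tau> by (simp add: add_pos_nonneg)
    define T where "T = (\<lambda>(i, l). of_real (1 / s) * ((if i = l then 1 else 0) + of_real \<tau> * (K i l * of_real (1/2))))"
    have "feasible {..<n} (\<lambda>l. \<Sum>i<n. smul (T (i, l)) (y i))"
      unfolding feasible_def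
    proof
      fix a :: "nat \<Rightarrow> 'k"
      \<comment> \<open>In matrix notation \<open>p = W\<^sup>* a\<close> and
        \<open>q = W W\<^sup>* a = K a\<close>.\<close>
      define p where "p j = (\<Sum>l<n. cj (W l j) * a l)" for j
      define q where "q i = (\<Sum>j\<in>J. W i j * p j)" for i
      define Sa where "Sa = (\<Sum>i<n. (norm (a i))\<^sup>2)"
      define P2 where "P2 = (\<Sum>j\<in>J. (norm (p j))\<^sup>2)"
      define Q2 where "Q2 = (\<Sum>i<n. (norm (q i))\<^sup>2)"
      define A2 where "A2 = (\<Sum>i<n. (norm (a i - of_real (\<tau>/2) * q i))\<^sup>2)"
      have nn: "Sa \<ge> 0" "P2 \<ge> 0" "Q2 \<ge> 0" "A2 \<ge> 0"
        by (auto simp: Sa_def P2_def Q2_def A2_def sum_nonneg)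
      have Kq: "(\<Sum>l<n. K i l * a l) = q i" for i
      proof -
        have "(\<Sum>l<n. K i l * a l) = (\<Sum>l<n. \<Sum>j\<in>J. W i j * (cj (W l j) * a l))"
          by (simp add: K_def sum_distrib_right mult.assoc)
        also have "\<dots> = q i" by (subst sum.swap) (simp add: q_def p_def sum_distrib_left)
        finally show ?thesis .
      qed
      have pw: "(\<Sum>j\<in>J. smul (p j) (w j)) = (\<Sum>i<n. smul (q i) (y i))"
      proof -
        have "(\<Sum>j\<in>J. smul (p j) (w j)) = (\<Sum>j\<in>J. smul (p j) (\<Sum>i<n. smul (W i j) (y i)))"
          using y(1) unfolding coords_def W_def by metis
        also have "\<dots> = (\<Sum>j\<in>J. \<Sum>i<n. smul (W i j * p j) (y i))"
          by (simp add: scale_sum_right mult.commute)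
        also have "\<dots> = (\<Sum>i<n. smul (q i) (y i))"
          by (subst sum.swap) (simp add: q_def scale_sum_left)
        finally show ?thesis .
      qed
      have "(\<Sum>l<n. smul (a l) (\<Sum>i<n. smul (T (i, l)) (y i))) = (\<Sum>i<n. smul (\<Sum>l<n. T (i, l) * a l) (y i))"
        by (simp add: scale_sum_right scale_sum_left mult.commute) (rule sum.swap)
      also have "\<dots> = (\<Sum>i<n. smul (of_real (1 / s) * (a i + of_real (\<tau>/2) * q i)) (y i))"
      proof (intro sum.cong refl)
        fix i assume i: "i \<in> {..<n}"
        have "(\<Sum>l<n. T (i, l) * a l)
          = of_real (1/s) * ((\<Sum>l<n. (if i = l then 1 else 0) * a l) + of_real (\<tau>/2) * (\<Sum>l<n. K i l * a l))"
          unfolding T_def by (simp add: sum_distrib_left sum.distrib[symmetric] algebra_simps)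
        also have "(\<Sum>l<n. (if i = l then 1 else 0) * a l) = a i"
          using i by (simp add: if_distrib[of "\<lambda>z. z * _"] cong: if_cong)
        finally show "smul (\<Sum>l<n. T (i, l) * a l) (y i) = smul (of_real (1 / s) * (a i + of_real (\<tau>/2) * q i)) (y i)"
          unfolding Kq by simp
      qed
      also have "\<dots> = smul (of_real (1 / s)) (\<Sum>i<n. smul (a i + of_real (\<tau>/2) * q i) (y i))"
        by (simp add: scale_sum_right)
      also have "(\<Sum>i<n. smul (a i + of_real (\<tau>/2) * q i) (y i))
          = (\<Sum>i<n. smul (a i - of_real (\<tau>/2) * q i) (y i)) + smul (of_real \<tau>) (\<Sum>i<n. smul (q i) (y i))"
      proof -
        \<comment> \<open>The triangle inequality is applied to
          \<open>(a - \<tau>/2 K a) + \<tau> K a\<close>: feasibility of \<open>y\<close> bounds the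
          first part and, through \<open>pw\<close>, feasibility of \<open>w\<close> bounds the
          second. The subtracted term later cancels the first-order part of the square.\<close>
        have "a i + of_real (\<tau>/2) * q i = (a i - of_real (\<tau>/2) * q i) + of_real \<tau> * q i" for i
          by (simp add: field_simps)
        then show ?thesis by (simp only: scale_left_distrib sum.distrib scale_sum_right scale_scale)
      qed
      also have "N (smul (of_real (1 / s)) \<dots>) \<le> 1 / s * (sqrt A2 + \<tau> * sqrt P2)"
      proof -
        have "N (\<Sum>i<n. smul (a i - of_real (\<tau>/2) * q i) (y i)) \<le> sqrt A2"
          using feasibleD[OF y(2)] by (simp add: A2_def L2_set_def)
        moreover have "N (smul (of_real \<tau>) (\<Sum>i<n. smul (q i) (y i))) \<le> \<tau> * sqrt P2"
          using feasibleD[OF w, of p] \<tau> unfolding pw by (simp add: norm_scale P2_def L2_set_def)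
        ultimately have "N ((\<Sum>i<n. smul (a i - of_real (\<tau>/2) * q i) (y i)) + smul (of_real \<tau>) (\<Sum>i<n. smul (q i) (y i)))
          \<le> sqrt A2 + \<tau> * sqrt P2" by (intro order.trans[OF norm_add_le] add_mono)
        then show ?thesis unfolding norm_scale using s by (simp add: norm_divide divide_right_mono)
      qed
      also have "\<dots> \<le> sqrt Sa"
      proof -
        have aq: "(\<Sum>i<n. a i * cj (q i)) = of_real P2"
        proof -
          have "(\<Sum>i<n. a i * cj (q i)) = (\<Sum>i<n. \<Sum>j\<in>J. cj (W i j) * a i * cj (p j))"
            by (simp add: q_def cj_sum cj_mult sum_distrib_left mult_ac)
          also have "\<dots> = (\<Sum>j\<in>J. p j * cj (p j))"
            by (subst sum.swap) (simp add: p_def sum_distrib_right)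
          also have "\<dots> = of_real P2" by (simp add: mult_cj P2_def)
          finally show ?thesis .
        qed
        have qa: "(\<Sum>i<n. q i * cj (a i)) = of_real P2"
        proof -
          have "(\<Sum>i<n. q i * cj (a i)) = cj (\<Sum>i<n. a i * cj (q i))"
            by (simp add: cj_sum cj_mult cj_cj mult.commute)
          then show ?thesis unfolding aq cj_of_real .
        qed
        have "(of_real A2 :: 'k) = of_real Sa - of_real (\<tau>/2) * ((\<Sum>i<n. a i * cj (q i)) + (\<Sum>i<n. q i * cj (a i))) + of_real ((\<tau>/2)\<^sup>2 * Q2)"
          unfolding A2_def Sa_def Q2_def of_real_sum norm_sq_diff
          by (simp only: sum.distrib sum_subtractf sum_distrib_left[symmetric] of_real_mult of_real_sum)
        also have "\<dots> = of_real (Sa - \<tau> * P2 + (\<tau>/2)\<^sup>2 * Q2)"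
          unfolding aq qa by simp
        finally have A2: "A2 = Sa - \<tau> * P2 + (\<tau>/2)\<^sup>2 * Q2" by (simp only: of_real_eq_iff)
        \<comment> \<open>Cauchy-Schwarz twice, with \<open>t\<close> the squared Hilbert-Schmidt
          norm of \<open>W\<close>, gives \<open>Q2 \<le> t\<^sup>2 Sa\<close>, the origin of the
          constant \<open>t\<^sup>2 / 4\<close>.\<close>
        have "Q2 \<le> (\<Sum>i<n. (\<Sum>j\<in>J. (norm (W i j))\<^sup>2) * P2)"
          unfolding Q2_def q_def P2_def by (intro sum_mono norm_sum_mult_sq_le)
        also have "\<dots> = t * P2" unfolding t_def sum.swap[of _ _ J] by (simp add: sum_distrib_right)
        finally have Q2t: "Q2 \<le> t * P2" .
        have "P2 \<le> (\<Sum>j\<in>J. (\<Sum>l<n. (norm (cj (W l j)))\<^sup>2) * Sa)"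
          unfolding P2_def p_def Sa_def by (intro sum_mono norm_sum_mult_sq_le)
        also have "\<dots> = t * Sa" unfolding t_def by (simp add: sum_distrib_right norm_cj)
        finally have P2t: "P2 \<le> t * Sa" .
        have "Q2 \<le> t * (t * Sa)" using Q2t mult_left_mono[OF P2t t0] by linarith
        then have Q2': "(\<tau>/2)\<^sup>2 * Q2 \<le> (\<tau>/2)\<^sup>2 * (t * (t * Sa))" by (intro mult_left_mono) auto
        \<comment> \<open>Convexity in the form \<open>(x + \<tau> y)\<^sup>2 \<le> (1 + \<tau>)
          (x\<^sup>2 + \<tau> y\<^sup>2)\<close>. In \<open>A2 + \<tau> P2\<close> the contributions
          of \<open>P2\<close> cancel and \<open>Sa + (\<tau>/2)\<^sup>2 Q2\<close> remains.\<close>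
        have "(sqrt A2 + \<tau> * sqrt P2)\<^sup>2 = (1 + \<tau>) * ((sqrt A2)\<^sup>2 + \<tau> * (sqrt P2)\<^sup>2) - \<tau> * (sqrt A2 - sqrt P2)\<^sup>2"
          by (simp only: power2_eq_square) (simp add: algebra_simps)
        also have "\<dots> \<le> (1 + \<tau>) * ((sqrt A2)\<^sup>2 + \<tau> * (sqrt P2)\<^sup>2)" using \<tau> by simp
        also have "\<dots> = (1 + \<tau>) * (Sa + (\<tau>/2)\<^sup>2 * Q2)" using nn A2 by simp
        also have "\<dots> \<le> (1 + \<tau>) * (Sa + (\<tau>/2)\<^sup>2 * (t * (t * Sa)))"
          using \<tau> Q2' by (intro mult_left_mono) auto
        also have "\<dots> = s\<^sup>2 * Sa" unfolding s2 by (simp add: power2_eq_square algebra_simps)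
        also have "\<dots> = (s * sqrt Sa)\<^sup>2" using nn by (simp add: power_mult_distrib)
        finally have "sqrt A2 + \<tau> * sqrt P2 \<le> s * sqrt Sa"
          by (rule power2_le_imp_le) (use s nn in auto)
        then show ?thesis using s by (simp add: field_simps)
      qed
      also have "sqrt Sa = L2_set (\<lambda>j. norm (a j)) {..<n}" by (simp add: Sa_def L2_set_def)
      finally show "N (\<Sum>l<n. smul (a l) (\<Sum>i<n. smul (T (i, l)) (y i))) \<le> L2_set (\<lambda>j. norm (a j)) {..<n}" .
    qed
    then have "norm (Determinant.det (mat n n T)) \<le> 1" by (rule max)
    also have "mat n n T = of_real (1 / s) \<cdot>\<^sub>m mat n n (\<lambda>(i, l). (if i = l then 1 else 0) + of_real \<tau> * (K i l * of_real (1/2)))"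
      by (rule eq_matI) (auto simp: T_def)
    finally have "norm (of_real (1 / s) ^ n * g (of_real \<tau>)) \<le> 1" unfolding g_def by simp
    then show ?thesis unfolding s_def[symmetric] using s
      by (simp add: norm_mult norm_power norm_divide field_simps)
  qed
  have "t / 2 \<le> n / 2" by (rule first_order_bound[OF g' g0 _ bound]) simp
  then show ?thesis by (simp add: t_def W_def)
qed

end

section \<open>The injective and projective norms\<close>

lemma sum_fun_apply: "(\<Sum>i\<in>A. f i) x = (\<Sum>i\<in>A. f i x)"
  by (induction A rule: infinite_finite_induct) auto

lemma linear_form_sum:
  assumes "Vector_Spaces.linear s (*) f"
  shows "f (\<Sum>i\<in>A. s (a i) (x i)) = (\<Sum>i\<in>A. a i * f (x i))"
proof -
  interpret Vector_Spaces.linear s "(*)" f by fact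
  show ?thesis by (simp add: sum scale)
qed

lemma sum_elementary_tensor_apply:
  "(\<Sum>i\<in>A. elementary_tensor s k (x i)) \<phi> = (if multilinear_form s k \<phi> then \<Sum>i\<in>A. \<phi> (x i) else 0)"
  by (simp add: sum_fun_apply elementary_tensor_def)

lemma multilinear_form_cong: "multilinear_form s k \<phi> \<Longrightarrow> (\<And>i. i < k \<Longrightarrow> x i = y i) \<Longrightarrow> \<phi> x = \<phi> y"
  by (simp add: multilinear_form_def)

lemma multilinear_form_linear:
  "multilinear_form s k \<phi> \<Longrightarrow> i < k \<Longrightarrow> Vector_Spaces.linear s (*) (\<lambda>v. \<phi> (x(i := v)))"
  by (simp add: multilinear_form_def)

lemma (in vector_space) multilinear_form_sum_scaled:
  assumes "\<And>i. i \<in> A \<Longrightarrow> multilinear_form scale k (\<psi> i)"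
  shows "multilinear_form scale k (\<lambda>x. \<Sum>i\<in>A. a i * \<psi> i x)"
proof -
  interpret K: vector_space "(*) :: 'a \<Rightarrow> 'a \<Rightarrow> 'a" by unfold_locales (auto simp: algebra_simps)
  have "Vector_Spaces.linear scale (*) (\<lambda>v. \<Sum>i\<in>A. a i * \<psi> i (x(j := v)))" if "j < k" for j x
    using multilinear_form_add[OF assms that] multilinear_form_smul[OF assms that]
    by unfold_locales (simp_all add: algebra_simps sum.distrib sum_distrib_left)
  moreover have "(\<Sum>i\<in>A. a i * \<psi> i x) = (\<Sum>i\<in>A. a i * \<psi> i y)" if "\<forall>i<k. x i = y i" for x y
    using assms that by (intro sum.cong) (auto simp: multilinear_form_def)
  ultimately show ?thesis unfolding multilinear_form_def by blast
qed

context normed_fin_dim begin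

text \<open>A scalar is absorbed into slot 0, which exists only for \<open>k > 0\<close>; hence the
  recurring restriction to positive \<open>k\<close>.\<close>

lemma tensor_scale_elementary:
  assumes "k > 0"
  shows "(\<lambda>\<phi>. a * elementary_tensor smul k x \<phi>) = elementary_tensor smul k (x(0 := smul a (x 0)))"
  using elementary_tensor_smul[OF assms, of smul x a "x 0"] by simp

text \<open>As scalars are absorbed into a slot, sums without coefficients exhaust the span, and the
  infimum that defines the projective norm of a tensor runs over a nonempty set.\<close>

lemma tensor_power_rep:
  assumes "k > 0" "z \<in> tensor_power smul k"
  shows "\<exists>(m::nat) x. z = (\<Sum>i<m. elementary_tensor smul k (x i))"
proof -
  interpret T: vector_space "\<lambda>c (z :: ('k, 'a) tensor) \<phi>. c * z \<phi>" by (rule vector_space_tensor)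
  from assms(2) show ?thesis
    unfolding tensor_power_def
  proof (induction rule: T.span_induct_alt)
    case base
    show ?case by (intro exI[of _ 0]) simp
  next
    case (step a e z)
    from step(1) obtain y where e: "e = elementary_tensor smul k y" by (rule rangeE)
    from step(2) obtain m :: nat and x where z: "z = (\<Sum>i<m. elementary_tensor smul k (x i))" by blast
    define x' where "x' i = (if i = m then y(0 := smul a (y 0)) else x i)" for i
    have "(\<Sum>i<m. elementary_tensor smul k (x' i)) = z"
      unfolding z by (intro sum.cong) (auto simp: x'_def)
    then have "(\<lambda>\<phi>. a * e \<phi>) + z = (\<Sum>i<Suc m. elementary_tensor smul k (x' i))"
      unfolding e tensor_scale_elementary[OF assms(1)] by (simp add: x'_def add.commute)
    then show ?case by blast
  qed
qed

lemma sum_elementary_in_tensor_power: "(\<Sum>i\<in>A. elementary_tensor smul k (x i)) \<in> tensor_power smul k"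
proof -
  interpret T: vector_space "\<lambda>c (z :: ('k, 'a) tensor) \<phi>. c * z \<phi>" by (rule vector_space_tensor)
  show ?thesis
    using elementary_tensor_in_tensor_power[of smul k] unfolding tensor_power_def by (intro T.span_sum) auto
qed

lemma projective_bdd_below:
  "bdd_below {\<Sum>i<m. \<Prod>j<k. N (x i j) | (m::nat) x. z = (\<Sum>i<m. elementary_tensor smul k (x i))}"
  by (rule bdd_belowI[of _ 0]) (auto intro!: sum_nonneg prod_nonneg)

text \<open>Allowing any finite index set in place of an initial segment makes room for
  representations indexed by disjoint sums and by multi-indices.\<close>

lemma projective_norm_le:
  assumes "finite A" "z = (\<Sum>i\<in>A. elementary_tensor smul k (x i))"
  shows "projective_norm smul N k z \<le> (\<Sum>i\<in>A. \<Prod>j<k. N (x i j))"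
proof -
  obtain h where h: "bij_betw h {..<card A} A"
    using ex_bij_betw_nat_finite[OF assms(1)] by (auto simp: lessThan_atLeast0)
  have "z = (\<Sum>i<card A. elementary_tensor smul k (x (h i)))"
    unfolding assms(2) by (rule sum.reindex_bij_betw[OF h, symmetric])
  moreover have "(\<Sum>i\<in>A. \<Prod>j<k. N (x i j)) = (\<Sum>i<card A. \<Prod>j<k. N (x (h i) j))"
    by (rule sum.reindex_bij_betw[OF h, symmetric])
  ultimately show ?thesis
    unfolding projective_norm_def
    by (intro cInf_lower projective_bdd_below) (auto intro!: exI[of _ "card A"] exI[of _ "\<lambda>i. x (h i)"])
qed

lemma projective_norm_greatest:
  assumes "k > 0" "z \<in> tensor_power smul k"
    and "\<And>(m::nat) x. z = (\<Sum>i<m. elementary_tensor smul k (x i)) \<Longrightarrow> B \<le> (\<Sum>i<m. \<Prod>j<k. N (x i j))"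
  shows "B \<le> projective_norm smul N k z"
  unfolding projective_norm_def
  using tensor_power_rep[OF assms(1,2)] assms(3) by (intro cInf_greatest) auto

lemma projective_norm_nonneg:
  "k > 0 \<Longrightarrow> z \<in> tensor_power smul k \<Longrightarrow> 0 \<le> projective_norm smul N k z"
  by (rule projective_norm_greatest) (auto intro!: sum_nonneg prod_nonneg)

text \<open>The easy half of the duality between the projective norm and bounded
  \<open>k\<close>-linear forms; it supplies the lower bounds for projective norms.\<close>

lemma tensor_apply_le:
  assumes "k > 0" "z \<in> tensor_power smul k" "multilinear_form smul k \<phi>" "M > 0"
    and "\<And>x. norm (\<phi> x) \<le> M * (\<Prod>j<k. N (x j))"
  shows "norm (z \<phi>) \<le> M * projective_norm smul N k z"
proof -
  have "norm (z \<phi>) / M \<le> projective_norm smul N k z"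
  proof (rule projective_norm_greatest[OF assms(1,2)])
    fix m :: nat and x assume z: "z = (\<Sum>i<m. elementary_tensor smul k (x i))"
    have "norm (z \<phi>) \<le> (\<Sum>i<m. M * (\<Prod>j<k. N (x i j)))"
      unfolding z sum_elementary_tensor_apply using assms(3,5)
      by (auto intro!: order.trans[OF norm_sum] sum_mono)
    then show "norm (z \<phi>) / M \<le> (\<Sum>i<m. \<Prod>j<k. N (x i j))"
      using assms(4) by (simp add: field_simps sum_distrib_left[symmetric])
  qed
  then show ?thesis using assms(4) by (simp add: field_simps)
qed

lemma dual_linear: "f \<in> dual_unit_ball smul N \<Longrightarrow> Vector_Spaces.linear smul (*) f"
  and dual_le: "f \<in> dual_unit_ball smul N \<Longrightarrow> norm (f x) \<le> N x"
  by (simp_all add: dual_unit_ball_def)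

lemma zero_in_dual: "(\<lambda>_. 0) \<in> dual_unit_ball smul N"
proof -
  interpret K: vector_space "(*) :: 'k \<Rightarrow> 'k \<Rightarrow> 'k" by unfold_locales (auto simp: algebra_simps)
  have "Vector_Spaces.linear smul (*) (\<lambda>_. 0 :: 'k)" by unfold_locales simp_all
  then show ?thesis by (simp add: dual_unit_ball_def)
qed

lemma tensor_functional_sum:
  assumes "\<And>i. i < k \<Longrightarrow> l i \<in> dual_unit_ball smul N"
  shows "tensor_functional k l (\<Sum>i\<in>A. elementary_tensor smul k (x i)) = (\<Sum>i\<in>A. \<Prod>j<k. l j (x i j))"
  unfolding tensor_functional_def sum_elementary_tensor_apply
  using multilinear_form_prod[of k smul l] assms dual_linear by simp

lemma injective_norm_upper:
  assumes "k > 0" "z \<in> tensor_power smul k" "\<And>i. i < k \<Longrightarrow> l i \<in> dual_unit_ball smul N"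
  shows "norm (tensor_functional k l z) \<le> injective_norm smul N k z"
proof -
  obtain m :: nat and x where z: "z = (\<Sum>i<m. elementary_tensor smul k (x i))"
    using tensor_power_rep[OF assms(1,2)] by blast
  have "norm (tensor_functional k l z) \<le> (\<Sum>i<m. \<Prod>j<k. N (x i j))"
    if "\<forall>i<k. l i \<in> dual_unit_ball smul N" for l
    unfolding z using that
    by (subst tensor_functional_sum)
       (auto intro!: order.trans[OF norm_sum] sum_mono prod_mono dual_le simp: prod_norm[symmetric])
  then have "bdd_above {norm (tensor_functional k l z) | l. \<forall>i<k. l i \<in> dual_unit_ball smul N}"
    by (intro bdd_aboveI[of _ "\<Sum>i<m. \<Prod>j<k. N (x i j)"]) auto
  then show ?thesis unfolding injective_norm_def using assms(3) by (intro cSup_upper) auto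
qed

lemma injective_norm_least:
  assumes "\<And>l. (\<And>i. i < k \<Longrightarrow> l i \<in> dual_unit_ball smul N) \<Longrightarrow> norm (tensor_functional k l z) \<le> B"
  shows "injective_norm smul N k z \<le> B"
proof -
  let ?S = "{norm (tensor_functional k l z) | l. \<forall>i<k. l i \<in> dual_unit_ball smul N}"
  have "norm (tensor_functional k (\<lambda>i x. 0) z) \<in> ?S"
    using zero_in_dual by (intro CollectI exI[of _ "\<lambda>i x. 0"]) simp
  then have "?S \<noteq> {}" by (metis empty_iff)
  then show ?thesis unfolding injective_norm_def by (rule cSup_least) (use assms in blast)
qed

lemma injective_norm_nonneg:
  assumes "k > 0" "z \<in> tensor_power smul k"
  shows "0 \<le> injective_norm smul N k z"
  using order.trans[OF norm_ge_zero injective_norm_upper[OF assms zero_in_dual]] .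

lemma multilinear_expand_partial:
  assumes ec: "coords e c" and \<phi>: "multilinear_form smul k \<phi>" and "m \<le> k"
  shows "\<phi> x = (\<Sum>I\<in>{..<m} \<rightarrow>\<^sub>E {..<n}. (\<Prod>j<m. c (I j) (x j)) * \<phi> (\<lambda>j. if j < m then e (I j) else x j))"
  using \<open>m \<le> k\<close>
proof (induction m)
  case 0
  show ?case by simp
next
  case (Suc m)
  \<comment> \<open>Only slot \<open>m\<close> is expanded; the others, already basis vectors or
    still \<open>x j\<close>, stay fixed, so the arity of \<open>\<phi>\<close> is the same
    throughout the induction.\<close>
  have slot: "\<phi> (\<lambda>j. if j < m then e (I j) else x j)
      = (\<Sum>i<n. c i (x m) * \<phi> (\<lambda>j. if j < Suc m then e ((I(m := i)) j) else x j))" for I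
  proof -
    let ?b = "\<lambda>j. if j < m then e (I j) else x j"
    have "(\<Sum>i<n. smul (c i (x m)) (e i)) = x m" using ec unfolding coords_def by metis
    then have "?b = ?b(m := \<Sum>i<n. smul (c i (x m)) (e i))" by (simp add: fun_eq_iff)
    then have "\<phi> ?b = \<phi> (?b(m := \<Sum>i<n. smul (c i (x m)) (e i)))" by simp
    also have "\<dots> = (\<Sum>i<n. c i (x m) * \<phi> (?b(m := e i)))"
      by (rule linear_form_sum, rule multilinear_form_linear[OF \<phi>]) (use Suc.prems in simp)
    also have "\<dots> = (\<Sum>i<n. c i (x m) * \<phi> (\<lambda>j. if j < Suc m then e ((I(m := i)) j) else x j))"
      by (intro sum.cong refl arg_cong2[where f = "(*)"] arg_cong[where f = \<phi>]) (auto simp: fun_eq_iff less_Suc_eq)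
    finally show ?thesis .
  qed
  have "\<phi> x = (\<Sum>I\<in>{..<m} \<rightarrow>\<^sub>E {..<n}. \<Sum>i<n. (\<Prod>j<m. c (I j) (x j)) * (c i (x m) * \<phi> (\<lambda>j. if j < Suc m then e ((I(m := i)) j) else x j)))"
    using Suc unfolding slot sum_distrib_left by simp
  also have "\<dots> = (\<Sum>I\<in>{..<m} \<rightarrow>\<^sub>E {..<n}. \<Sum>i<n. (\<Prod>j<Suc m. c ((I(m := i)) j) (x j)) * \<phi> (\<lambda>j. if j < Suc m then e ((I(m := i)) j) else x j))"
  proof (intro sum.cong refl)
    fix I i
    have "(\<Prod>j<Suc m. c ((I(m := i)) j) (x j)) = (\<Prod>j<m. c (I j) (x j)) * c i (x m)" by simp
    then show "(\<Prod>j<m. c (I j) (x j)) * (c i (x m) * \<phi> (\<lambda>j. if j < Suc m then e ((I(m := i)) j) else x j))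
      = (\<Prod>j<Suc m. c ((I(m := i)) j) (x j)) * \<phi> (\<lambda>j. if j < Suc m then e ((I(m := i)) j) else x j)"
      by (simp only: mult.assoc)
  qed
  also have "\<dots> = (\<Sum>I\<in>{..<Suc m} \<rightarrow>\<^sub>E {..<n}. (\<Prod>j<Suc m. c (I j) (x j)) * \<phi> (\<lambda>j. if j < Suc m then e (I j) else x j))"
    by (rule sum_PiE_Suc[symmetric]) simp
  finally show ?case .
qed

lemma multilinear_expand:
  assumes "coords e c" "multilinear_form smul k \<phi>"
  shows "\<phi> x = (\<Sum>I\<in>{..<k} \<rightarrow>\<^sub>E {..<n}. (\<Prod>j<k. c (I j) (x j)) * \<phi> (\<lambda>j. e (I j)))"
proof -
  have "\<phi> (\<lambda>j. if j < k then e (I j) else x j) = \<phi> (\<lambda>j. e (I j))" for I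
    by (rule multilinear_form_cong[OF assms(2)]) simp
  then show ?thesis using multilinear_expand_partial[OF assms order_refl, of x] by simp
qed

lemma multilinear_coords:
  assumes "coords e c" "I \<in> {..<k} \<rightarrow>\<^sub>E {..<n}"
  shows "multilinear_form smul k (\<lambda>x. \<Prod>j<k. c (I j) (x j))"
  using assms by (intro multilinear_form_prod) (auto simp: coords_def PiE_iff)

text \<open>The coordinates of \<open>z\<close> are its values at products of coordinate
  functionals. Tensors are functions of all \<open>\<phi>\<close>, so equality is also checked where
  \<open>\<phi>\<close> is not multilinear and both sides vanish.\<close>

lemma tensor_expand:
  assumes ec: "coords e c" and "k > 0" "z \<in> tensor_power smul k"
  shows "z = (\<Sum>I\<in>{..<k} \<rightarrow>\<^sub>E {..<n}. (\<lambda>\<phi>. z (\<lambda>x. \<Prod>j<k. c (I j) (x j)) * elementary_tensor smul k (\<lambda>j. e (I j)) \<phi>))"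
proof
  fix \<phi>
  obtain m :: nat and x where z: "z = (\<Sum>i<m. elementary_tensor smul k (x i))"
    using tensor_power_rep[OF assms(2,3)] by blast
  have zI: "z (\<lambda>x. \<Prod>j<k. c (I j) (x j)) = (\<Sum>i<m. \<Prod>j<k. c (I j) (x i j))"
    if "I \<in> {..<k} \<rightarrow>\<^sub>E {..<n}" for I
    unfolding z sum_elementary_tensor_apply using multilinear_coords[OF ec that] by simp
  show "z \<phi> = (\<Sum>I\<in>{..<k} \<rightarrow>\<^sub>E {..<n}. (\<lambda>\<phi>. z (\<lambda>x. \<Prod>j<k. c (I j) (x j)) * elementary_tensor smul k (\<lambda>j. e (I j)) \<phi>)) \<phi>"
  proof (cases "multilinear_form smul k \<phi>")
    case True
    have "z \<phi> = (\<Sum>i<m. \<Sum>I\<in>{..<k} \<rightarrow>\<^sub>E {..<n}. (\<Prod>j<k. c (I j) (x i j)) * \<phi> (\<lambda>j. e (I j)))"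
      unfolding z sum_elementary_tensor_apply if_P[OF True]
      by (intro sum.cong refl multilinear_expand[OF ec True])
    also have "\<dots> = (\<Sum>I\<in>{..<k} \<rightarrow>\<^sub>E {..<n}. (\<Sum>i<m. \<Prod>j<k. c (I j) (x i j)) * \<phi> (\<lambda>j. e (I j)))"
      by (subst sum.swap) (simp add: sum_distrib_right)
    also have "\<dots> = (\<Sum>I\<in>{..<k} \<rightarrow>\<^sub>E {..<n}. z (\<lambda>x. \<Prod>j<k. c (I j) (x j)) * elementary_tensor smul k (\<lambda>j. e (I j)) \<phi>)"
      using True by (intro sum.cong) (auto simp: zI elementary_tensor_def)
    finally show ?thesis by (simp add: sum_fun_apply)
  next
    case False
    then have "z \<phi> = 0" unfolding z sum_elementary_tensor_apply by simp
    then show ?thesis using False unfolding sum_fun_apply by (simp add: elementary_tensor_def)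
  qed
qed

lemma projective_norm_comb_le:
  assumes "k > 0" "finite A" "z = (\<Sum>I\<in>A. (\<lambda>\<phi>. d I * elementary_tensor smul k (x I) \<phi>))"
  shows "projective_norm smul N k z \<le> (\<Sum>I\<in>A. norm (d I) * (\<Prod>j<k. N (x I j)))"
proof -
  have "z = (\<Sum>I\<in>A. elementary_tensor smul k ((x I)(0 := smul (d I) (x I 0))))"
    unfolding assms(3) by (simp add: tensor_scale_elementary[OF assms(1)])
  from projective_norm_le[OF assms(2) this]
  have "projective_norm smul N k z \<le> (\<Sum>I\<in>A. \<Prod>j<k. N (((x I)(0 := smul (d I) (x I 0))) j))" .
  also have "\<dots> = (\<Sum>I\<in>A. norm (d I) * (\<Prod>j<k. N (x I j)))"
  proof (intro sum.cong refl)
    fix I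
    have "(\<Prod>j\<in>{..<k} - {0}. N (((x I)(0 := smul (d I) (x I 0))) j)) = (\<Prod>j\<in>{..<k} - {0}. N (x I j))"
      by (intro prod.cong) auto
    then show "(\<Prod>j<k. N (((x I)(0 := smul (d I) (x I 0))) j)) = norm (d I) * (\<Prod>j<k. N (x I j))"
      using assms(1) by (simp add: prod.remove[of "{..<k}" 0] norm_scale)
  qed
  finally show ?thesis .
qed

section \<open>The projective norm as a seminorm on a finitely spanned space\<close>

lemma projective_norm_add_le:
  assumes "k > 0" "z \<in> tensor_power smul k" "w \<in> tensor_power smul k"
  shows "projective_norm smul N k (z + w) \<le> projective_norm smul N k z + projective_norm smul N k w"
proof -
  have *: "projective_norm smul N k (z + w) \<le> (\<Sum>i<m. \<Prod>j<k. N (x i j)) + (\<Sum>i<m'. \<Prod>j<k. N (y i j))"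
    if z: "z = (\<Sum>i<m. elementary_tensor smul k (x i))" and w: "w = (\<Sum>i<m'. elementary_tensor smul k (y i))"
    for m m' :: nat and x y
  proof -
    have "z + w = (\<Sum>i\<in>{..<m} <+> {..<m'}. elementary_tensor smul k (case_sum x y i))"
      unfolding z w by (simp add: sum.Plus)
    from projective_norm_le[OF _ this] show ?thesis by (simp add: sum.Plus)
  qed
  have "projective_norm smul N k (z + w) - projective_norm smul N k z \<le> (\<Sum>i<m'. \<Prod>j<k. N (y i j))"
    if w: "w = (\<Sum>i<m'. elementary_tensor smul k (y i))" for m' :: nat and y
  proof -
    have "projective_norm smul N k (z + w) - (\<Sum>i<m'. \<Prod>j<k. N (y i j)) \<le> projective_norm smul N k z"
      using *[OF _ w] by (intro projective_norm_greatest[OF assms(1,2)]) (simp add: algebra_simps)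
    then show ?thesis by simp
  qed
  from projective_norm_greatest[OF assms(1,3) this] show ?thesis by simp
qed

text \<open>Scaling representations gives one inequality, and the same inequality for the inverse
  scalar gives the other. For \<open>a = 0\<close> the empty sum represents the tensor.\<close>

lemma projective_norm_scale:
  assumes "k > 0" "z \<in> tensor_power smul k"
  shows "projective_norm smul N k (\<lambda>\<phi>. a * z \<phi>) = norm a * projective_norm smul N k z"
proof -
  interpret T: vector_space "\<lambda>c (z :: ('k, 'a) tensor) \<phi>. c * z \<phi>" by (rule vector_space_tensor)
  have mem: "(\<lambda>\<phi>. a * w \<phi>) \<in> tensor_power smul k" if "w \<in> tensor_power smul k" for a w
    using that unfolding tensor_power_def by (rule T.span_scale)
  have le: "projective_norm smul N k (\<lambda>\<phi>. a * w \<phi>) \<le> norm a * projective_norm smul N k w"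
    if w: "w \<in> tensor_power smul k" and a: "a \<noteq> 0" for a w
  proof -
    have "projective_norm smul N k (\<lambda>\<phi>. a * w \<phi>) / norm a \<le> projective_norm smul N k w"
    proof (rule projective_norm_greatest[OF assms(1) w])
      fix m :: nat and x assume w: "w = (\<Sum>i<m. elementary_tensor smul k (x i))"
      have "(\<lambda>\<phi>. a * w \<phi>) = (\<Sum>i<m. (\<lambda>\<phi>. a * elementary_tensor smul k (x i) \<phi>))"
        unfolding w by (simp add: sum_fun_apply fun_eq_iff sum_distrib_left)
      from projective_norm_comb_le[OF assms(1) _ this]
      show "projective_norm smul N k (\<lambda>\<phi>. a * w \<phi>) / norm a \<le> (\<Sum>i<m. \<Prod>j<k. N (x i j))"
        using a by (simp add: field_simps sum_distrib_left)
    qed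
    then show ?thesis using a by (simp add: field_simps)
  qed
  show ?thesis
  proof (cases "a = 0")
    case True
    have "projective_norm smul N k (\<lambda>\<phi>. 0) \<le> 0"
      using projective_norm_le[of "{} :: nat set" "\<lambda>\<phi>. 0" k] by (simp add: zero_fun_def)
    moreover have "(\<lambda>\<phi>. 0) \<in> tensor_power smul k" using mem[OF assms(2), of 0] by simp
    then have "0 \<le> projective_norm smul N k (\<lambda>\<phi>. 0)" by (rule projective_norm_nonneg[OF assms(1)])
    ultimately show ?thesis using True by simp
  next
    case False
    have "projective_norm smul N k (\<lambda>\<phi>. inverse a * (\<lambda>\<phi>. a * z \<phi>) \<phi>) \<le> norm (inverse a) * projective_norm smul N k (\<lambda>\<phi>. a * z \<phi>)"
      using False mem[OF assms(2)] by (intro le) auto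
    also have "(\<lambda>\<phi>. inverse a * (\<lambda>\<phi>. a * z \<phi>) \<phi>) = z" using False by (simp add: fun_eq_iff mult.assoc[symmetric])
    finally have "norm a * projective_norm smul N k z \<le> projective_norm smul N k (\<lambda>\<phi>. a * z \<phi>)"
      using False by (simp add: nonzero_norm_inverse) (simp add: field_simps)
    with le[OF assms(2) False] show ?thesis by simp
  qed
qed

lemma tensor_power_finite_span:
  assumes "k > 0"
  shows "\<exists>S. finite S \<and> tensor_power smul k = module.span (\<lambda>c (z :: ('k, 'a) tensor) \<phi>. c * z \<phi>) S"
proof -
  interpret T: vector_space "\<lambda>c (z :: ('k, 'a) tensor) \<phi>. c * z \<phi>" by (rule vector_space_tensor)
  obtain e c where ec: "coords e c" using exists_coords by blast
  define S where "S = (\<lambda>I. elementary_tensor smul k (\<lambda>j. e (I j))) ` ({..<k} \<rightarrow>\<^sub>E {..<n})"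
  have "finite S" unfolding S_def by (intro finite_imageI finite_PiE) auto
  moreover have "tensor_power smul k \<subseteq> T.span S"
  proof
    fix z assume z: "z \<in> tensor_power smul k"
    show "z \<in> T.span S"
      by (subst tensor_expand[OF ec assms z], intro T.span_sum T.span_scale T.span_base) (auto simp: S_def)
  qed
  moreover have "T.span S \<subseteq> tensor_power smul k"
    unfolding tensor_power_def S_def by (intro T.span_mono) auto
  ultimately show ?thesis by blast
qed

end


section \<open>Norming functionals and norming forms over both scalar fields\<close>

definition hahn_banach_property :: "('k::real_normed_field \<Rightarrow> 'v::ab_group_add \<Rightarrow> 'v) \<Rightarrow> bool" where
  "hahn_banach_property s \<longleftrightarrow> (\<forall>S p x0. finite S \<longrightarrow>
     (\<forall>x\<in>module.span s S. \<forall>y\<in>module.span s S. p (x + y) \<le> p x + p y) \<longrightarrow>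
     (\<forall>c. \<forall>x\<in>module.span s S. p (s c x) = norm c * p x) \<longrightarrow> x0 \<in> module.span s S \<longrightarrow>
     (\<exists>f. Vector_Spaces.linear s (*) f \<and> f x0 = of_real (p x0) \<and> (\<forall>x\<in>module.span s S. norm (f x) \<le> p x)))"

lemma hahn_banach_property_real:
  fixes s :: "real \<Rightarrow> 'v::ab_group_add \<Rightarrow> 'v"
  assumes "vector_space s"
  shows "hahn_banach_property s"
  unfolding hahn_banach_property_def
  using hahn_banach_real[OF assms] by (simp only: real_norm_def of_real_eq_id id_apply) blast

lemma hahn_banach_property_complex:
  fixes s :: "complex \<Rightarrow> 'v::ab_group_add \<Rightarrow> 'v"
  assumes "vector_space s"
  shows "hahn_banach_property s"
  unfolding hahn_banach_property_def
  using hahn_banach_complex[OF assms] by blast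

lemma prod_lessThan_add:
  fixes h :: "nat \<Rightarrow> 'c::comm_monoid_mult"
  shows "(\<Prod>j<k + l. h j) = (\<Prod>j<k. h j) * (\<Prod>j<l. h (j + k))"
proof -
  have "(\<Prod>j<k + l. h j) = (\<Prod>j<k. h j) * (\<Prod>j=k..<k + l. h j)"
    by (subst prod.union_disjoint[symmetric]) (auto intro!: prod.cong)
  also have "(\<Prod>j=k..<k + l. h j) = (\<Prod>j<l. h (j + k))"
    using prod.shift_bounds_nat_ivl[of h 0 k l] by (simp add: lessThan_atLeast0 add.commute)
  finally show ?thesis .
qed

text \<open>The quantity under the root in \<open>rho\<close>: supermultiplicativity holds for it
  before the root is taken.\<close>

definition ratio_sup ::
  "('k::real_normed_field \<Rightarrow> 'a::ab_group_add \<Rightarrow> 'a) \<Rightarrow> ('a \<Rightarrow> real) \<Rightarrow> nat \<Rightarrow> real" where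
  "ratio_sup smul N k = Sup (insert 0 {projective_norm smul N k z / injective_norm smul N k z | z.
                              z \<in> tensor_power smul k \<and> z \<noteq> 0})"

text \<open>Norm-controlled extension is proved separately over the two fields and so enters the
  common argument as an assumption. It is assumed twice because it is used on \<open>X\<close> and
  on the space of tensors, which have different types.\<close>

locale hahn_banach_space = normed_fin_dim smul N cj n
  for smul :: "'k::{real_normed_field, euclidean_space} \<Rightarrow> 'a::ab_group_add \<Rightarrow> 'a" and N cj n +
  assumes hb: "hahn_banach_property smul"
    and hb_tensor: "hahn_banach_property (\<lambda>c (z :: ('k, 'a) tensor) \<phi>. c * z \<phi>)"
begin

lemma norming_functional: "\<exists>f\<in>dual_unit_ball smul N. f x = of_real (N x)"
proof -
  obtain B where "finite B" "span B = UNIV" using has_dim unfolding has_dimension_def by blast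
  then have "\<exists>f. Vector_Spaces.linear smul (*) f \<and> f x = of_real (N x) \<and> (\<forall>x\<in>span B. norm (f x) \<le> N x)"
    using hb[unfolded hahn_banach_property_def, rule_format, of B N x] norm_add_le norm_scale by simp
  then show ?thesis using \<open>span B = UNIV\<close> by (auto simp: dual_unit_ball_def)
qed

text \<open>The hard half of the duality: a functional on the tensor power that norms
  \<open>z\<close> becomes a \<open>k\<close>-linear form when evaluated at elementary
  tensors.\<close>

lemma norming_form:
  assumes "k > 0" "z \<in> tensor_power smul k"
  shows "\<exists>\<phi>. multilinear_form smul k \<phi> \<and> (\<forall>x. norm (\<phi> x) \<le> (\<Prod>j<k. N (x j))) \<and>
           z \<phi> = of_real (projective_norm smul N k z)"
proof -
  let ?s = "\<lambda>c (z :: ('k, 'a) tensor) \<phi>. c * z \<phi>"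
  obtain S where S: "finite S" "tensor_power smul k = module.span ?s S"
    using tensor_power_finite_span[OF assms(1)] by blast
  have "\<exists>g. Vector_Spaces.linear ?s (*) g \<and> g z = of_real (projective_norm smul N k z) \<and>
      (\<forall>w\<in>tensor_power smul k. norm (g w) \<le> projective_norm smul N k w)"
    by (rule hb_tensor[unfolded hahn_banach_property_def, rule_format, OF S(1), folded S(2),
          OF projective_norm_add_le[OF assms(1)] projective_norm_scale[OF assms(1)] assms(2)])
  then obtain g where g: "Vector_Spaces.linear ?s (*) g" "g z = of_real (projective_norm smul N k z)"
      "\<And>w. w \<in> tensor_power smul k \<Longrightarrow> norm (g w) \<le> projective_norm smul N k w"
    by blast
  interpret g: Vector_Spaces.linear ?s "(*)" g by fact
  interpret K: vector_space "(*) :: 'k \<Rightarrow> 'k \<Rightarrow> 'k" by unfold_locales (auto simp: algebra_simps)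
  define \<phi> where "\<phi> x = g (elementary_tensor smul k x)" for x
  have "multilinear_form smul k \<phi>"
    unfolding multilinear_form_def
  proof (intro conjI allI impI)
    show "\<phi> x = \<phi> y" if "\<forall>i<k. x i = y i" for x y
    proof -
      have "elementary_tensor smul k x = elementary_tensor smul k y"
        using that multilinear_form_cong[of smul k _ x y] by (auto simp: elementary_tensor_def)
      then show ?thesis by (simp add: \<phi>_def)
    qed
    show "Vector_Spaces.linear smul (*) (\<lambda>v. \<phi> (x(i := v)))" if "i < k" for i x
      unfolding \<phi>_def using that
      by unfold_locales (simp_all add: elementary_tensor_add elementary_tensor_smul g.add g.scale)
  qed
  moreover have "norm (\<phi> x) \<le> (\<Prod>j<k. N (x j))" for x
  proof -
    have "norm (\<phi> x) \<le> projective_norm smul N k (elementary_tensor smul k x)"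
      unfolding \<phi>_def by (intro g(3) elementary_tensor_in_tensor_power)
    also have "\<dots> \<le> (\<Prod>j<k. N (x j))"
      using projective_norm_le[of "{0::nat}" "elementary_tensor smul k x" k "\<lambda>_. x"] by simp
    finally show ?thesis .
  qed
  moreover have "z \<phi> = g z"
  proof -
    obtain m :: nat and x where z: "z = (\<Sum>i<m. elementary_tensor smul k (x i))"
      using tensor_power_rep[OF assms] by blast
    show ?thesis
      unfolding z sum_elementary_tensor_apply if_P[OF \<open>multilinear_form smul k \<phi>\<close>] g.sum \<phi>_def ..
  qed
  ultimately show ?thesis using g(2) by (intro exI[of _ \<phi>]) simp
qed

section \<open>Comparison of the projective and the injective norm\<close>

context
  fixes e c
  assumes ec: "coords e c"
    and trace_le: "\<And>(J :: (nat \<Rightarrow> nat) set) w. finite J \<Longrightarrow> feasible J w \<Longrightarrow> (\<Sum>j\<in>J. \<Sum>i<n. (norm (c i (w j)))\<^sup>2) \<le> n"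
begin

text \<open>Homogeneity carries the trace bound over to any constant \<open>C\<close>; for
  \<open>C = 0\<close> all vectors \<open>w j\<close> vanish. The hypothesis \<open>trace_le\<close>
  concerns coordinates only and does not mention maximality, so it can be supplied for every
  orthonormal basis of the ellipsoid. Its index type is that of multi-indices.\<close>

lemma trace_le_scaled:
  fixes J :: "(nat \<Rightarrow> nat) set" and C :: real
  assumes "finite J" "C \<ge> 0" and w: "\<And>a. N (\<Sum>j\<in>J. smul (a j) (w j)) \<le> C * L2_set (\<lambda>j. norm (a j)) J"
  shows "(\<Sum>j\<in>J. \<Sum>i<n. (norm (c i (w j)))\<^sup>2) \<le> n * C\<^sup>2"
proof (cases "C = 0")
  case True
  have "w j = 0" if "j \<in> J" for j
  proof -
    have "(\<Sum>i\<in>J. smul (if i = j then 1 else 0) (w i)) = w j"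
      using that assms(1) by (simp add: if_distrib[of "\<lambda>z. smul z _"] cong: if_cong)
    then have "N (w j) \<le> 0" using w[of "\<lambda>i. if i = j then 1 else 0"] True by simp
    then show ?thesis using N_pos[of "w j"] by force
  qed
  moreover have "c i 0 = 0" if "i < n" for i using coords_sum[OF ec that, of "\<lambda>_. 0" _ "{}"] by simp
  ultimately show ?thesis using True by simp
next
  case False
  then have C: "C > 0" using assms by simp
  define w' where "w' j = smul (of_real (1 / C)) (w j)" for j
  have "feasible J w'"
    unfolding feasible_def
  proof
    fix a :: "(nat \<Rightarrow> nat) \<Rightarrow> 'k"
    have "(\<Sum>j\<in>J. smul (a j) (w' j)) = smul (of_real (1 / C)) (\<Sum>j\<in>J. smul (a j) (w j))"
      by (simp add: w'_def scale_sum_right mult.commute)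
    then show "N (\<Sum>j\<in>J. smul (a j) (w' j)) \<le> L2_set (\<lambda>j. norm (a j)) J"
      using w[of a] C by (simp add: norm_scale norm_divide field_simps)
  qed
  from trace_le[OF assms(1) this] have "(\<Sum>j\<in>J. \<Sum>i<n. (norm (c i (w' j)))\<^sup>2) \<le> n" .
  moreover have "(norm (c i (w' j)))\<^sup>2 = (norm (c i (w j)))\<^sup>2 / C\<^sup>2" if "i < n" for i j
    using coords_sum[OF ec that, of "\<lambda>_. of_real (1 / C)" "\<lambda>_. w j" "{()}"] C
    by (simp add: w'_def norm_divide power_divide)
  ultimately have "(\<Sum>j\<in>J. \<Sum>i<n. (norm (c i (w j)))\<^sup>2) / C\<^sup>2 \<le> n"
    by (simp add: sum_divide_distrib)
  then show ?thesis using C by (simp add: field_simps)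
qed

text \<open>
  By induction, the last slot being paired with a functional \<open>f\<close>: the remaining sum of squares is
  then a quadratic form in \<open>f\<close> dominated by the square of the dual norm, and \<open>trace_le\<close> bounds its trace.
\<close>

lemma sum_norm_sq_le:
  fixes Z :: "(nat \<Rightarrow> nat) \<Rightarrow> 'k" and C :: real
  assumes "C \<ge> 0"
    and "\<And>f. (\<And>j. j < k \<Longrightarrow> f j \<in> dual_unit_ball smul N) \<Longrightarrow>
           norm (\<Sum>I\<in>{..<k} \<rightarrow>\<^sub>E {..<n}. Z I * (\<Prod>j<k. f j (e (I j)))) \<le> C"
  shows "(\<Sum>I\<in>{..<k} \<rightarrow>\<^sub>E {..<n}. (norm (Z I))\<^sup>2) \<le> real n ^ k * C\<^sup>2"
  using assms
proof (induction k arbitrary: Z C)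
  case 0
  have "norm (Z (\<lambda>_. undefined)) \<le> C" using "0.prems"(2)[of "\<lambda>_ _. 0"] by simp
  then show ?case by (simp add: power_mono)
next
  case (Suc k)
  let ?I = "{..<k} \<rightarrow>\<^sub>E {..<n}"
  \<comment> \<open>The entries of \<open>Z\<close> with the first indices fixed as \<open>I\<close>
    and the last one free, read as a vector of \<open>X\<close>.\<close>
  define w where "w I = (\<Sum>i<n. smul (Z (I(k := i))) (e i))" for I
  have fw: "f (w I) = (\<Sum>i<n. Z (I(k := i)) * f (e i))" if "f \<in> dual_unit_ball smul N" for f I
    unfolding w_def by (rule linear_form_sum[OF dual_linear[OF that]])
  have step: "(\<Sum>I\<in>?I. (norm (f (w I)))\<^sup>2) \<le> real n ^ k * C\<^sup>2" if f: "f \<in> dual_unit_ball smul N" for f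
  proof (rule Suc.IH[OF Suc.prems(1)])
    fix h :: "nat \<Rightarrow> 'a \<Rightarrow> 'k" assume h: "\<And>j. j < k \<Longrightarrow> h j \<in> dual_unit_ball smul N"
    have "(\<Sum>I\<in>?I. f (w I) * (\<Prod>j<k. h j (e (I j))))
        = (\<Sum>I\<in>?I. \<Sum>i<n. Z (I(k := i)) * (\<Prod>j<Suc k. (h(k := f)) j (e ((I(k := i)) j))))"
      unfolding fw[OF f] sum_distrib_right
    proof (intro sum.cong refl)
      fix I i
      have "(\<Prod>j<Suc k. (h(k := f)) j (e ((I(k := i)) j))) = (\<Prod>j<k. h j (e (I j))) * f (e i)"
      proof -
        have "(\<Prod>j<k. (h(k := f)) j (e ((I(k := i)) j))) = (\<Prod>j<k. h j (e (I j)))"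
          by (intro prod.cong) auto
        then show ?thesis unfolding prod.lessThan_Suc by simp
      qed
      then show "Z (I(k := i)) * f (e i) * (\<Prod>j<k. h j (e (I j)))
        = Z (I(k := i)) * (\<Prod>j<Suc k. (h(k := f)) j (e ((I(k := i)) j)))" by (simp only: mult_ac)
    qed
    also have "\<dots> = (\<Sum>I\<in>{..<Suc k} \<rightarrow>\<^sub>E {..<n}. Z I * (\<Prod>j<Suc k. (h(k := f)) j (e (I j))))"
      by (rule sum_PiE_Suc[symmetric]) simp
    also have "norm \<dots> \<le> C"
      using f h by (intro Suc.prems(2)) (auto simp: less_Suc_eq)
    finally show "norm (\<Sum>I\<in>?I. f (w I) * (\<Prod>j<k. h j (e (I j)))) \<le> C" .
  qed
  define D where "D = sqrt (real n ^ k * C\<^sup>2)"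
  have D: "D \<ge> 0" "D\<^sup>2 = real n ^ k * C\<^sup>2" by (auto simp: D_def)
  have "(\<Sum>I\<in>?I. \<Sum>i<n. (norm (c i (w I)))\<^sup>2) \<le> n * D\<^sup>2"
  proof (rule trace_le_scaled[OF _ D(1)])
    show "finite ?I" by (auto intro: finite_PiE)
    fix a :: "(nat \<Rightarrow> nat) \<Rightarrow> 'k"
    \<comment> \<open>A functional that norms the combination, followed by Cauchy-Schwarz, converts
      the bound \<open>step\<close> for all dual functionals into feasibility of \<open>w\<close> up
      to the factor \<open>D\<close>.\<close>
    obtain f where f: "f \<in> dual_unit_ball smul N" "f (\<Sum>I\<in>?I. smul (a I) (w I)) = of_real (N (\<Sum>I\<in>?I. smul (a I) (w I)))"
      using norming_functional by blast
    have "N (\<Sum>I\<in>?I. smul (a I) (w I)) = norm (f (\<Sum>I\<in>?I. smul (a I) (w I)))" by (simp add: f(2))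
    also have "f (\<Sum>I\<in>?I. smul (a I) (w I)) = (\<Sum>I\<in>?I. a I * f (w I))"
      by (rule linear_form_sum[OF dual_linear[OF f(1)]])
    also have "norm \<dots> \<le> (\<Sum>I\<in>?I. \<bar>norm (a I)\<bar> * \<bar>norm (f (w I))\<bar>)"
      by (intro order.trans[OF norm_sum]) (simp add: norm_mult)
    also have "\<dots> \<le> L2_set (\<lambda>I. norm (a I)) ?I * L2_set (\<lambda>I. norm (f (w I))) ?I" by (rule L2_set_mult_ineq)
    also have "\<dots> \<le> L2_set (\<lambda>I. norm (a I)) ?I * D"
      using step[OF f(1)] by (intro mult_left_mono) (simp_all add: L2_set_def D_def sum_nonneg)
    finally show "N (\<Sum>I\<in>?I. smul (a I) (w I)) \<le> D * L2_set (\<lambda>I. norm (a I)) ?I" by (simp add: mult.commute)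
  qed
  also have "(\<Sum>I\<in>?I. \<Sum>i<n. (norm (c i (w I)))\<^sup>2) = (\<Sum>I\<in>?I. \<Sum>i<n. (norm (Z (I(k := i))))\<^sup>2)"
    unfolding w_def by (intro sum.cong) (auto simp: coords_comb[OF ec])
  also have "\<dots> = (\<Sum>I\<in>{..<Suc k} \<rightarrow>\<^sub>E {..<n}. (norm (Z I))\<^sup>2)"
    by (rule sum_PiE_Suc[symmetric]) simp
  finally show ?case by (simp add: D(2) mult.assoc)
qed

lemma projective_le_injective:
  assumes "k > 0" "z \<in> tensor_power smul k"
  shows "projective_norm smul N k z \<le> sqrt (n * (\<Sum>i<n. (N (e i))\<^sup>2)) ^ k * injective_norm smul N k z"
proof -
  let ?I = "{..<k} \<rightarrow>\<^sub>E {..<n}"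
  define Z where "Z I = z (\<lambda>x. \<Prod>j<k. c (I j) (x j))" for I
  define \<epsilon> where "\<epsilon> = injective_norm smul N k z"
  have \<epsilon>: "\<epsilon> \<ge> 0" unfolding \<epsilon>_def by (rule injective_norm_nonneg[OF assms])
  have z: "z = (\<Sum>I\<in>?I. (\<lambda>\<phi>. Z I * elementary_tensor smul k (\<lambda>j. e (I j)) \<phi>))"
    unfolding Z_def by (rule tensor_expand[OF ec assms])
  have "(\<Sum>I\<in>?I. (norm (Z I))\<^sup>2) \<le> real n ^ k * \<epsilon>\<^sup>2"
  proof (rule sum_norm_sq_le[OF \<epsilon>])
    fix f :: "nat \<Rightarrow> 'a \<Rightarrow> 'k" assume f: "\<And>j. j < k \<Longrightarrow> f j \<in> dual_unit_ball smul N"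
    have "multilinear_form smul k (\<lambda>x. \<Prod>j<k. f j (x j))"
      using f by (intro multilinear_form_prod dual_linear)
    then have "tensor_functional k f z = (\<Sum>I\<in>?I. Z I * (\<Prod>j<k. f j (e (I j))))"
      unfolding tensor_functional_def by (subst z) (simp add: sum_fun_apply elementary_tensor_def)
    then show "norm (\<Sum>I\<in>?I. Z I * (\<Prod>j<k. f j (e (I j)))) \<le> \<epsilon>"
      using injective_norm_upper[of k z f, OF assms f] unfolding \<epsilon>_def by simp
  qed
  then have "L2_set (\<lambda>I. norm (Z I)) ?I \<le> sqrt (real n ^ k * \<epsilon>\<^sup>2)" by (simp add: L2_set_def)
  also have "\<dots> = sqrt n ^ k * \<epsilon>" using \<epsilon> by (simp add: real_sqrt_mult real_sqrt_power)
  finally have LZ: "L2_set (\<lambda>I. norm (Z I)) ?I \<le> sqrt n ^ k * \<epsilon>" .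
  \<comment> \<open>The weights \<open>N (e i)\<close> are kept rather than bounded by 1: the
    equality case relies on the gain when one of them is smaller.\<close>
  have "(\<Sum>I\<in>?I. (\<Prod>j<k. N (e (I j)))\<^sup>2) = (\<Sum>i<n. (N (e i))\<^sup>2) ^ k"
    unfolding prod_power_distrib by (subst prod_sum_PiE[symmetric]) auto
  then have LN: "L2_set (\<lambda>I. \<Prod>j<k. N (e (I j))) ?I = sqrt (\<Sum>i<n. (N (e i))\<^sup>2) ^ k"
    by (simp add: L2_set_def real_sqrt_power)
  have "projective_norm smul N k z \<le> (\<Sum>I\<in>?I. norm (Z I) * (\<Prod>j<k. N (e (I j))))"
    by (rule projective_norm_comb_le[OF assms(1) _ z]) (auto intro: finite_PiE)
  also have "\<dots> = (\<Sum>I\<in>?I. \<bar>norm (Z I)\<bar> * \<bar>\<Prod>j<k. N (e (I j))\<bar>)" by (simp add: abs_prod)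
  also have "\<dots> \<le> L2_set (\<lambda>I. norm (Z I)) ?I * L2_set (\<lambda>I. \<Prod>j<k. N (e (I j))) ?I" by (rule L2_set_mult_ineq)
  also have "\<dots> \<le> (sqrt n ^ k * \<epsilon>) * sqrt (\<Sum>i<n. (N (e i))\<^sup>2) ^ k"
    unfolding LN using LZ by (intro mult_right_mono) (simp_all add: sum_nonneg)
  also have "\<dots> = sqrt (n * (\<Sum>i<n. (N (e i))\<^sup>2)) ^ k * \<epsilon>"
    by (simp add: real_sqrt_mult power_mult_distrib)
  finally show ?thesis by (simp add: \<epsilon>_def)
qed

lemma ratio_le:
  assumes "k > 0" "z \<in> tensor_power smul k"
  shows "projective_norm smul N k z / injective_norm smul N k z \<le> sqrt (n * (\<Sum>i<n. (N (e i))\<^sup>2)) ^ k"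
proof (cases "injective_norm smul N k z = 0")
  case False
  then have "injective_norm smul N k z > 0" using injective_norm_nonneg[OF assms] by simp
  then show ?thesis using projective_le_injective[OF assms] by (simp add: divide_le_eq)
qed (auto simp: sum_nonneg)

lemma ratio_sup_le:
  assumes "k > 0"
  shows "ratio_sup smul N k \<le> sqrt (n * (\<Sum>i<n. (N (e i))\<^sup>2)) ^ k"
  unfolding ratio_sup_def using ratio_le[OF assms] by (intro cSup_least) (auto simp: sum_nonneg)

lemma ratio_sup_ge:
  assumes "k > 0" "z \<in> tensor_power smul k" "z \<noteq> 0"
  shows "projective_norm smul N k z / injective_norm smul N k z \<le> ratio_sup smul N k"
  unfolding ratio_sup_def
proof (rule cSup_upper)
  show "bdd_above (insert 0 {projective_norm smul N k z / injective_norm smul N k z | z. z \<in> tensor_power smul k \<and> z \<noteq> 0})"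
    using ratio_le[OF assms(1)] by (intro bdd_aboveI[of _ "sqrt (n * (\<Sum>i<n. (N (e i))\<^sup>2)) ^ k"]) (auto simp: sum_nonneg)
qed (use assms in auto)

lemma ratio_sup_nonneg:
  assumes "k > 0"
  shows "0 \<le> ratio_sup smul N k"
  unfolding ratio_sup_def
proof (rule cSup_upper)
  show "bdd_above (insert 0 {projective_norm smul N k z / injective_norm smul N k z | z. z \<in> tensor_power smul k \<and> z \<noteq> 0})"
    using ratio_le[OF assms] by (intro bdd_aboveI[of _ "sqrt (n * (\<Sum>i<n. (N (e i))\<^sup>2)) ^ k"]) (auto simp: sum_nonneg)
qed simp

text \<open>
  The tensor \<open>z \<otimes> w\<close> is obtained by concatenating the tuples in representations of \<open>z\<close> and \<open>w\<close>. Its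
  projective norm is at least \<open>\<pi>(z) \<pi>(w)\<close> because a product of norming forms pairs with it to that value.
\<close>

lemma ratio_sup_supermult:
  assumes k: "k > 0" and l: "l > 0"
  shows "ratio_sup smul N k * ratio_sup smul N l \<le> ratio_sup smul N (k + l)"
proof -
  let ?R = "ratio_sup smul N"
  have kl: "k + l > 0" using k by simp
  have one: "projective_norm smul N k z / injective_norm smul N k z * (projective_norm smul N l w / injective_norm smul N l w) \<le> ?R (k + l)"
    if z: "z \<in> tensor_power smul k" "z \<noteq> 0" and w: "w \<in> tensor_power smul l" "w \<noteq> 0" for z w
  proof (cases "projective_norm smul N k z = 0 \<or> projective_norm smul N l w = 0")
    case True
    then show ?thesis using ratio_sup_nonneg[OF kl] by auto
  next
    case False
    obtain m :: nat and x where zx: "z = (\<Sum>i<m. elementary_tensor smul k (x i))"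
      using tensor_power_rep[OF k z(1)] by blast
    obtain m' :: nat and y where wy: "w = (\<Sum>i<m'. elementary_tensor smul l (y i))"
      using tensor_power_rep[OF l w(1)] by blast
    define cat where "cat u v j = (if j < k then u j else v (j - k))" for u v :: "nat \<Rightarrow> 'a" and j
    define t where "t = (\<Sum>p\<in>{..<m} \<times> {..<m'}. elementary_tensor smul (k + l) (cat (x (fst p)) (y (snd p))))"
    have t: "t \<in> tensor_power smul (k + l)" unfolding t_def by (rule sum_elementary_in_tensor_power)
    obtain \<phi> where \<phi>: "multilinear_form smul k \<phi>" "\<And>x. norm (\<phi> x) \<le> (\<Prod>j<k. N (x j))" "z \<phi> = of_real (projective_norm smul N k z)"
      using norming_form[OF k z(1)] by blast
    obtain \<psi> where \<psi>: "multilinear_form smul l \<psi>" "\<And>x. norm (\<psi> x) \<le> (\<Prod>j<l. N (x j))" "w \<psi> = of_real (projective_norm smul N l w)"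
      using norming_form[OF l w(1)] by blast
    define \<theta> where "\<theta> u = \<phi> u * \<psi> (\<lambda>j. u (j + k))" for u
    interpret K: vector_space "(*) :: 'k \<Rightarrow> 'k \<Rightarrow> 'k" by unfold_locales (auto simp: algebra_simps)
    have \<theta>: "multilinear_form smul (k + l) \<theta>"
      unfolding multilinear_form_def
    proof (intro conjI allI impI)
      show "\<theta> u = \<theta> v" if "\<forall>i<k + l. u i = v i" for u v
        unfolding \<theta>_def using that
        by (intro arg_cong2[where f = "(*)"] multilinear_form_cong[OF \<phi>(1)] multilinear_form_cong[OF \<psi>(1)]) auto
      fix i u assume i: "i < k + l"
      show "Vector_Spaces.linear smul (*) (\<lambda>v. \<theta> (u(i := v)))"
      proof (cases "i < k")
        case True
        have "(\<lambda>j. (u(i := v)) (j + k)) = (\<lambda>j. u (j + k))" for v using True by auto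
        then have eq: "\<theta> (u(i := v)) = \<phi> (u(i := v)) * \<psi> (\<lambda>j. u (j + k))" for v by (simp add: \<theta>_def)
        show ?thesis
          unfolding eq by unfold_locales
            (simp_all add: multilinear_form_add[OF \<phi>(1) True] multilinear_form_smul[OF \<phi>(1) True] algebra_simps)
      next
        case False
        have il: "i - k < l" using False i by simp
        have "(\<lambda>j. (u(i := v)) (j + k)) = (\<lambda>j. u (j + k))(i - k := v)" for v using False by (auto simp: fun_eq_iff)
        moreover have "\<phi> (u(i := v)) = \<phi> u" for v using False by (intro multilinear_form_cong[OF \<phi>(1)]) auto
        ultimately have eq: "\<theta> (u(i := v)) = \<phi> u * \<psi> ((\<lambda>j. u (j + k))(i - k := v))" for v by (simp add: \<theta>_def)
        show ?thesis
          unfolding eq by unfold_locales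
            (simp_all add: multilinear_form_add[OF \<psi>(1) il] multilinear_form_smul[OF \<psi>(1) il] algebra_simps)
      qed
    qed
    have \<theta>cat: "\<theta> (cat u v) = \<phi> u * \<psi> v" for u v
      unfolding \<theta>_def
      by (intro arg_cong2[where f = "(*)"] multilinear_form_cong[OF \<phi>(1)] multilinear_form_cong[OF \<psi>(1)]) (auto simp: cat_def)
    have "t \<theta> = (\<Sum>p\<in>{..<m} \<times> {..<m'}. \<phi> (x (fst p)) * \<psi> (y (snd p)))"
      unfolding t_def sum_elementary_tensor_apply if_P[OF \<theta>] \<theta>cat ..
    also have "\<dots> = z \<phi> * w \<psi>"
      unfolding zx wy sum_elementary_tensor_apply if_P[OF \<phi>(1)] if_P[OF \<psi>(1)] sum_product sum.cartesian_product
      by (simp add: case_prod_unfold)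
    finally have t\<theta>: "t \<theta> = of_real (projective_norm smul N k z * projective_norm smul N l w)" by (simp add: \<phi>(3) \<psi>(3))
    have nn: "projective_norm smul N k z > 0" "projective_norm smul N l w > 0"
      using False projective_norm_nonneg[OF k z(1)] projective_norm_nonneg[OF l w(1)] by auto
    have "norm (t \<theta>) \<le> 1 * projective_norm smul N (k + l) t"
    proof (rule tensor_apply_le[OF kl t \<theta>])
      show "norm (\<theta> u) \<le> 1 * (\<Prod>j<k + l. N (u j))" for u
        unfolding prod_lessThan_add \<theta>_def norm_mult using \<phi>(2)[of u] \<psi>(2)[of "\<lambda>j. u (j + k)"]
        by (simp add: mult_mono prod_nonneg)
    qed simp
    then have pt: "projective_norm smul N k z * projective_norm smul N l w \<le> projective_norm smul N (k + l) t"
      using nn by (simp add: t\<theta> norm_mult)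
    have "t \<noteq> 0" using t\<theta> nn by (metis mult_pos_pos of_real_eq_0_iff order_less_irrefl zero_fun_apply)
    have ie: "injective_norm smul N (k + l) t \<le> injective_norm smul N k z * injective_norm smul N l w"
    proof (rule injective_norm_least)
      fix f :: "nat \<Rightarrow> 'a \<Rightarrow> 'k" assume f: "\<And>i. i < k + l \<Longrightarrow> f i \<in> dual_unit_ball smul N"
      have f1: "\<And>i. i < k \<Longrightarrow> f i \<in> dual_unit_ball smul N" and f2: "\<And>i. i < l \<Longrightarrow> f (i + k) \<in> dual_unit_ball smul N"
        using f by auto
      have "tensor_functional (k + l) f t = (\<Sum>p\<in>{..<m} \<times> {..<m'}. (\<Prod>j<k. f j (x (fst p) j)) * (\<Prod>j<l. f (j + k) (y (snd p) j)))"
        unfolding t_def using f by (subst tensor_functional_sum) (auto simp: prod_lessThan_add cat_def)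
      also have "\<dots> = (\<Sum>i<m. \<Prod>j<k. f j (x i j)) * (\<Sum>i<m'. \<Prod>j<l. f (j + k) (y i j))"
        by (simp add: sum_product sum.cartesian_product case_prod_unfold)
      also have "\<dots> = tensor_functional k f z * tensor_functional l (\<lambda>j. f (j + k)) w"
        unfolding zx wy using f1 f2 by (simp add: tensor_functional_sum)
      finally show "norm (tensor_functional (k + l) f t) \<le> injective_norm smul N k z * injective_norm smul N l w"
        using injective_norm_upper[OF k z(1), of f] injective_norm_upper[OF l w(1), of "\<lambda>j. f (j + k)"] f1 f2
        by (simp add: norm_mult mult_mono injective_norm_nonneg[OF k z(1)])
    qed
    have "projective_norm smul N (k + l) t > 0" using pt nn by (meson mult_pos_pos less_le_trans)
    then have tpos: "injective_norm smul N (k + l) t > 0"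
      using projective_le_injective[OF kl t] injective_norm_nonneg[OF kl t] by (cases "injective_norm smul N (k + l) t = 0") auto
    have "projective_norm smul N k z / injective_norm smul N k z * (projective_norm smul N l w / injective_norm smul N l w)
       = (projective_norm smul N k z * projective_norm smul N l w) / (injective_norm smul N k z * injective_norm smul N l w)" by simp
    also have "\<dots> \<le> projective_norm smul N (k + l) t / injective_norm smul N (k + l) t"
      using nn by (intro frac_le pt ie tpos) (use pt nn in \<open>meson mult_pos_pos less_imp_le order_trans\<close>)
    also have "\<dots> \<le> ?R (k + l)" by (rule ratio_sup_ge[OF kl t \<open>t \<noteq> 0\<close>])
    finally show ?thesis .
  qed
  \<comment> \<open>The suprema are taken one factor at a time, with the other factor fixed as
    \<open>B\<close>; \<open>C \<ge> 0\<close> accounts for the 0 inserted into the set of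
    ratios.\<close>
  have le_of_ratio: "B * ?R j \<le> C"
    if "j > 0" "B \<ge> 0" "C \<ge> 0"
      and *: "\<And>w. w \<in> tensor_power smul j \<Longrightarrow> w \<noteq> 0 \<Longrightarrow> B * (projective_norm smul N j w / injective_norm smul N j w) \<le> C"
    for B C and j :: nat
  proof (cases "B = 0")
    case False
    then have B: "B > 0" using that by simp
    have "?R j \<le> C / B"
      unfolding ratio_sup_def using * B \<open>C \<ge> 0\<close>
      by (intro cSup_least) (auto simp: field_simps)
    then show ?thesis using B by (simp add: field_simps)
  qed (use that in simp)
  have "?R l * ?R k \<le> ?R (k + l)"
  proof (rule le_of_ratio[OF k ratio_sup_nonneg[OF l] ratio_sup_nonneg[OF kl]])
    fix z :: "('k, 'a) tensor" assume z: "z \<in> tensor_power smul k" "z \<noteq> 0"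
    have "projective_norm smul N k z / injective_norm smul N k z * ?R l \<le> ?R (k + l)"
      using one[OF z] projective_norm_nonneg[OF k z(1)] injective_norm_nonneg[OF k z(1)]
      by (intro le_of_ratio[OF l _ ratio_sup_nonneg[OF kl]]) auto
    then show "?R l * (projective_norm smul N k z / injective_norm smul N k z) \<le> ?R (k + l)" by (simp add: mult.commute)
  qed
  then show ?thesis by (simp add: mult.commute)
qed

end

end

section \<open>The tensor radius\<close>

text \<open>The limit is the supremum \<open>L\<close>: writing \<open>k = q * m + r\<close> gives
  \<open>a k / k \<ge> a m / m - D / k\<close> for each fixed \<open>m\<close>. Superadditivity is
  available for positive arguments only, so a zero quotient or remainder is treated apart.\<close>

lemma fekete:
  fixes a :: "nat \<Rightarrow> real" and C :: real
  assumes super: "\<And>m n. m > 0 \<Longrightarrow> n > 0 \<Longrightarrow> a m + a n \<le> a (m + n)"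
    and bound: "\<And>k. k > 0 \<Longrightarrow> a k \<le> C * k"
  shows "convergent (\<lambda>k. a k / k)"
proof -
  define L where "L = (SUP k\<in>{0<..}. a k / k)"
  have bdd: "bdd_above ((\<lambda>k. a k / k) ` {0<..})"
    using bound by (intro bdd_aboveI[of _ C]) (auto simp: divide_le_eq)
  have up: "a k / k \<le> L" if "k > 0" for k
    unfolding L_def using bdd that by (intro cSUP_upper) auto
  have mult: "Suc q * a m \<le> a (Suc q * m)" if "m > 0" for q m
  proof (induction q)
    case (Suc q)
    have "a m + a (Suc q * m) \<le> a (m + Suc q * m)" using that by (intro super) auto
    then show ?case using Suc by (simp add: algebra_simps)
  qed simp
  have low: "\<exists>D. \<forall>k>0. a m / m - D / k \<le> a k / k" if m: "m > 0" for m
  proof -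
    define B where "B = (\<Sum>r<m. \<bar>a r\<bar>)"
    have B: "- B \<le> a r" "\<bar>a r\<bar> \<le> B" if "r < m" for r
    proof -
      have "\<bar>a r\<bar> \<le> B" unfolding B_def using that by (intro member_le_sum) auto
      then show "- B \<le> a r" "\<bar>a r\<bar> \<le> B" by auto
    qed
    have Bnn: "B \<ge> 0" by (auto simp: B_def sum_nonneg)
    have "a m / m - (B + \<bar>a m\<bar>) / k \<le> a k / k" if k: "k > 0" for k
    proof -
      define q r where "q = k div m" and "r = k mod m"
      have kqr: "k = q * m + r" and r: "r < m" using m by (auto simp: q_def r_def)
      have "q * a m - B \<le> a k"
      proof (cases q)
        case 0
        then show ?thesis using B[of r] r kqr by simp
      next
        case (Suc q')
        show ?thesis
        proof (cases "r = 0")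
          case True
          then show ?thesis using mult[OF m, of q'] kqr Suc Bnn by simp
        next
          case False
          have "q * a m + a r \<le> a (q * m) + a r" using mult[OF m, of q'] Suc by simp
          also have "\<dots> \<le> a k" unfolding kqr using m Suc False by (intro super) auto
          finally show ?thesis using B(1)[OF r] by simp
        qed
      qed
      moreover have "k * (a m / m) - \<bar>a m\<bar> \<le> q * a m"
      proof -
        have "k * (a m / m) = q * a m + r * (a m / m)" using m unfolding kqr by (simp add: field_simps)
        also have "r * (a m / m) \<le> \<bar>r * (a m / m)\<bar>" by (rule abs_ge_self)
        also have "\<dots> = (r / m) * \<bar>a m\<bar>" by (simp add: abs_mult)
        also have "\<dots> \<le> 1 * \<bar>a m\<bar>" using r by (intro mult_right_mono) auto
        finally show ?thesis by simp
      qed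
      ultimately have "k * (a m / m) - (B + \<bar>a m\<bar>) \<le> a k" by simp
      then have "(k * (a m / m) - (B + \<bar>a m\<bar>)) / k \<le> a k / k" by (intro divide_right_mono) auto
      then show ?thesis using k by (simp add: diff_divide_distrib)
    qed
    then show ?thesis by blast
  qed
  have "(\<lambda>k. a k / k) \<longlonglongrightarrow> L"
  proof (rule LIMSEQ_I)
    fix \<epsilon> :: real assume \<epsilon>: "\<epsilon> > 0"
    have "\<exists>m\<in>{0<..}. L - \<epsilon> / 2 < a m / m"
      using \<epsilon> bdd less_cSUP_iff[of "{0::nat<..}" "\<lambda>k. a k / k" "L - \<epsilon> / 2"] by (auto simp: L_def)
    then obtain m where m: "m > 0" "L - \<epsilon> / 2 < a m / m" by auto
    obtain D where D: "\<And>k. k > 0 \<Longrightarrow> a m / m - D / k \<le> a k / k" using low[OF m(1)] by blast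
    have "(\<lambda>k. D / real k) \<longlonglongrightarrow> 0" by (rule lim_const_over_n)
    then obtain K where K: "\<And>k. k \<ge> K \<Longrightarrow> \<bar>D / real k\<bar> < \<epsilon> / 2"
      using LIMSEQ_D[of "\<lambda>k. D / real k" 0 "\<epsilon> / 2"] \<epsilon> unfolding real_norm_def diff_0_right
      by (metis half_gt_zero)
    have "norm (a k / k - L) < \<epsilon>" if "k \<ge> Suc K" for k
    proof -
      have "k > 0" "k \<ge> K" using that by auto
      then show ?thesis using up[of k] D[of k] K[of k] m(2) unfolding real_norm_def by linarith
    qed
    then show "\<exists>K. \<forall>k\<ge>K. norm (a k / k - L) < \<epsilon>" by blast
  qed
  then show ?thesis by (rule convergentI)
qed

section \<open>Lower bound from sign tensors, and existence of the limit\<close>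

context hahn_banach_space begin

text \<open>On the vector with coefficients \<open>cj (f (e i))\<close> the functional takes the
  value \<open>L\<^sup>2\<close>, while feasibility bounds the norm of that vector by
  \<open>L\<close>.\<close>

lemma dual_L2_le:
  assumes "feasible {..<n} e" "f \<in> dual_unit_ball smul N"
  shows "L2_set (\<lambda>i. norm (f (e i))) {..<n} \<le> 1"
proof -
  define L where "L = L2_set (\<lambda>i. norm (f (e i))) {..<n}"
  have "f (\<Sum>i<n. smul (cj (f (e i))) (e i)) = of_real (\<Sum>i<n. (norm (f (e i)))\<^sup>2)"
    unfolding linear_form_sum[OF dual_linear[OF assms(2)]] by (simp add: mult.commute[of "cj _"] mult_cj)
  also have "(\<Sum>i<n. (norm (f (e i)))\<^sup>2) = L\<^sup>2" by (simp add: L_def L2_set_def sum_nonneg)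
  finally have "L\<^sup>2 = norm (f (\<Sum>i<n. smul (cj (f (e i))) (e i)))" by (simp add: norm_power)
  also have "\<dots> \<le> N (\<Sum>i<n. smul (cj (f (e i))) (e i))" by (rule dual_le[OF assms(2)])
  also have "\<dots> \<le> L2_set (\<lambda>i. norm (cj (f (e i)))) {..<n}" by (rule feasibleD[OF assms(1)])
  also have "\<dots> = L" by (simp add: L_def norm_cj)
  finally have "L * L \<le> 1 * L" by (simp add: power2_eq_square)
  moreover have "L \<ge> 0" by (simp add: L_def)
  ultimately have "L \<le> 1" by (cases "L = 0") (auto simp: less_le)
  then show ?thesis by (simp add: L_def)
qed

context
  fixes e0 c0
  assumes ec0: "coords e0 c0"
    and trace_le: "\<And>(J :: (nat \<Rightarrow> nat) set) w. finite J \<Longrightarrow> feasible J w \<Longrightarrow> (\<Sum>j\<in>J. \<Sum>i<n. (norm (c0 i (w j)))\<^sup>2) \<le> n"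
begin

text \<open>The estimate \<open>\<sigma>_le\<close> is used twice, which produces
  \<open>s\<^sup>2\<close>: for the form \<open>\<phi>\<close>, where passing to \<open>N\<close>
  costs \<open>d\<close> in each slot, and for products of dual functionals, whose values on
  \<open>e\<close> have Euclidean norm at most 1. The basis \<open>e0\<close> makes the ratios
  bounded, so \<open>e\<close> may come from a different Euclidean norm.\<close>

lemma ratio_sup_lower:
  assumes ec: "coords e c" and feas: "feasible {..<n} e"
    and d: "d > 0" "\<And>x. L2_set (\<lambda>i. norm (c i x)) {..<n} \<le> d * N x"
    and n: "n > 0" and k: "k > 0" and s: "s > 0"
    and \<sigma>: "\<forall>I\<in>{..<k} \<rightarrow>\<^sub>E {..<n}. \<sigma> I = 1 \<or> \<sigma> I = -1"
    and \<sigma>_le: "\<And>v :: nat \<Rightarrow> nat \<Rightarrow> 'k. norm (\<Sum>I\<in>{..<k} \<rightarrow>\<^sub>E {..<n}. of_real (\<sigma> I) * (\<Prod>j<k. v j (I j)))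
        \<le> s * (\<Prod>j<k. L2_set (\<lambda>i. norm (v j i)) {..<n})"
  shows "real n ^ k / (s\<^sup>2 * d ^ k) \<le> ratio_sup smul N k"
proof -
  let ?I = "{..<k} \<rightarrow>\<^sub>E {..<n}"
  have finI: "finite ?I" by (auto intro: finite_PiE)
  define z where "z = (\<Sum>I\<in>?I. (\<lambda>\<phi>. of_real (\<sigma> I) * elementary_tensor smul k (\<lambda>j. e (I j)) \<phi>))"
  define \<phi> where "\<phi> x = (\<Sum>I\<in>?I. of_real (\<sigma> I) * (\<Prod>j<k. c (I j) (x j)))" for x
  have zap: "z \<psi> = (\<Sum>I\<in>?I. of_real (\<sigma> I) * \<psi> (\<lambda>j. e (I j)))" if "multilinear_form smul k \<psi>" for \<psi>
    using that by (simp add: z_def sum_fun_apply elementary_tensor_def)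
  have z: "z \<in> tensor_power smul k"
    unfolding z_def tensor_scale_elementary[OF k] by (rule sum_elementary_in_tensor_power)
  have ml: "multilinear_form smul k \<phi>"
    unfolding \<phi>_def using ec by (intro multilinear_form_sum_scaled multilinear_coords)
  have \<phi>e: "\<phi> (\<lambda>j. e (I j)) = of_real (\<sigma> I)" if I: "I \<in> ?I" for I
  proof -
    have "\<phi> (\<lambda>j. e (I j)) = (\<Sum>I'\<in>?I. if I' = I then of_real (\<sigma> I) else 0)"
      unfolding \<phi>_def
    proof (intro sum.cong refl)
      fix I' assume I': "I' \<in> ?I"
      have *: "c (I' j) (e (I j)) = (if I' j = I j then 1 else 0)" if "j < k" for j
        using ec I I' that by (auto simp: coords_def PiE_iff)
      show "of_real (\<sigma> I') * (\<Prod>j<k. c (I' j) (e (I j))) = (if I' = I then of_real (\<sigma> I) else 0)"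
      proof (cases "I' = I")
        case True
        then show ?thesis using * by simp
      next
        case False
        then obtain j where "j < k" "I' j \<noteq> I j" using I I' by (metis PiE_ext lessThan_iff)
        then have "(\<Prod>j<k. c (I' j) (e (I j))) = 0" using * by (intro prod_zero) auto
        then show ?thesis using False by simp
      qed
    qed
    then show ?thesis using I finI by simp
  qed
  have "z \<phi> = (\<Sum>I\<in>?I. 1)"
    unfolding zap[OF ml]
  proof (intro sum.cong refl)
    fix I assume "I \<in> ?I"
    then show "of_real (\<sigma> I) * \<phi> (\<lambda>j. e (I j)) = 1" using \<sigma> by (auto simp: \<phi>e)
  qed
  then have z\<phi>: "z \<phi> = of_real (real n ^ k)" by (simp add: card_PiE)
  have nk: "real n ^ k > 0" using n by simp
  then have z0: "z \<noteq> 0" using z\<phi> by (metis of_real_eq_0_iff order_less_irrefl zero_fun_apply)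
  have sd: "s * d ^ k > 0" using s d by simp
  have "norm (z \<phi>) \<le> s * d ^ k * projective_norm smul N k z"
  proof (rule tensor_apply_le[OF k z ml sd])
    fix x
    have "norm (\<phi> x) \<le> s * (\<Prod>j<k. L2_set (\<lambda>i. norm (c i (x j))) {..<n})"
      unfolding \<phi>_def using \<sigma>_le[of "\<lambda>j i. c i (x j)"] .
    also have "\<dots> \<le> s * (\<Prod>j<k. d * N (x j))"
      using s d(2) by (intro mult_left_mono prod_mono) auto
    finally show "norm (\<phi> x) \<le> s * d ^ k * (\<Prod>j<k. N (x j))" by (simp add: prod.distrib mult.assoc)
  qed
  then have p: "real n ^ k / (s * d ^ k) \<le> projective_norm smul N k z"
    using sd by (simp add: z\<phi> divide_le_eq mult.commute norm_power)
  have i: "injective_norm smul N k z \<le> s"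
  proof (rule injective_norm_least)
    fix l :: "nat \<Rightarrow> 'a \<Rightarrow> 'k" assume l: "\<And>i. i < k \<Longrightarrow> l i \<in> dual_unit_ball smul N"
    have "multilinear_form smul k (\<lambda>x. \<Prod>j<k. l j (x j))"
      using l by (intro multilinear_form_prod dual_linear)
    then have "tensor_functional k l z = (\<Sum>I\<in>?I. of_real (\<sigma> I) * (\<Prod>j<k. l j (e (I j))))"
      unfolding tensor_functional_def by (rule zap)
    also have "norm \<dots> \<le> s * (\<Prod>j<k. L2_set (\<lambda>i. norm (l j (e i))) {..<n})"
      using \<sigma>_le[of "\<lambda>j i. l j (e i)"] .
    also have "\<dots> \<le> s * (\<Prod>j<k. 1)"
      using s l by (intro mult_left_mono prod_mono conjI dual_L2_le[OF feas]) auto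
    finally show "norm (tensor_functional k l z) \<le> s" by simp
  qed
  have p0: "projective_norm smul N k z > 0" using p nk sd by (meson divide_pos_pos less_le_trans)
  then have i0: "injective_norm smul N k z > 0"
    using projective_le_injective[OF ec0 trace_le k z] injective_norm_nonneg[OF k z]
    by (cases "injective_norm smul N k z = 0") auto
  have "real n ^ k / (s\<^sup>2 * d ^ k) = real n ^ k / (s * d ^ k) / s" by (simp add: power2_eq_square)
  also have "\<dots> \<le> projective_norm smul N k z / injective_norm smul N k z"
    using p i i0 p0 by (intro frac_le) auto
  also have "\<dots> \<le> ratio_sup smul N k" by (rule ratio_sup_ge[OF ec0 trace_le k z z0])
  finally show ?thesis by simp
qed

text \<open>Under the \<open>k\<close>-th root \<open>s = q ^ k * k\<^sup>2\<close> becomes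
  \<open>q * root k k ^ 2\<close>; as \<open>s\<close> enters squared, the loss is
  \<open>q\<^sup>2\<close> and \<open>root k k ^ 4\<close>, and the latter tends to 1.\<close>

lemma rho_eventually_lower:
  assumes ec: "coords e c" and feas: "feasible {..<n} e"
    and d: "d > 0" "\<And>x. L2_set (\<lambda>i. norm (c i x)) {..<n} \<le> d * N x"
    and n: "n > 0" and \<delta>: "0 < \<delta>" "\<delta> < 1"
  shows "\<forall>\<^sub>F k in sequentially. n / (((1 + \<delta>) / (1 - \<delta>))\<^sup>2 * d) / root k k ^ 4 \<le> rho smul N k"
proof -
  define q where "q = (1 + \<delta>) / (1 - \<delta>)"
  have q: "q > 0" using \<delta> by (simp add: q_def)
  obtain C where C: "C > 0" "\<And>k. \<exists>\<sigma>. (\<forall>I\<in>{..<k} \<rightarrow>\<^sub>E {..<n}. \<sigma> I = 1 \<or> \<sigma> I = -1) \<and>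
    (\<forall>v :: nat \<Rightarrow> nat \<Rightarrow> 'k.
      norm (\<Sum>I\<in>{..<k} \<rightarrow>\<^sub>E {..<n}. of_real (\<sigma> I) * (\<Prod>j<k. v j (I j)))
        \<le> q ^ k * (C * (real k + 1)) * (\<Prod>j<k. L2_set (\<lambda>i. norm (v j i)) {..<n}))"
    using exists_sign_tensor[OF \<delta>, where ?'k = 'k and n = n] unfolding q_def by blast
  \<comment> \<open>From \<open>k \<ge> 2 * C\<close> on,
    \<open>C * (k + 1) \<le> 2 * C * k \<le> k\<^sup>2\<close>, which absorbs the constant into a
    power of \<open>k\<close>.\<close>
  have "n / (q\<^sup>2 * d) / root k k ^ 4 \<le> rho smul N k" if k: "k \<ge> max 1 (nat \<lceil>2 * C\<rceil>)" for k
  proof -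
    have k0: "k > 0" and kC: "real k \<ge> 2 * C" using k by linarith+
    define s where "s = q ^ k * (real k)\<^sup>2"
    have s: "s > 0" using q k0 by (simp add: s_def)
    have "C * (real k + 1) \<le> C * (2 * real k)" using C k0 by (intro mult_left_mono) auto
    also have "\<dots> = 2 * C * real k" by simp
    also have "\<dots> \<le> real k * real k" using kC by (intro mult_right_mono) auto
    finally have Cs: "q ^ k * (C * (real k + 1)) \<le> s"
      unfolding s_def power2_eq_square using q by (intro mult_left_mono) auto
    obtain \<sigma> where \<sigma>: "\<forall>I\<in>{..<k} \<rightarrow>\<^sub>E {..<n}. \<sigma> I = 1 \<or> \<sigma> I = -1"
      "\<And>v :: nat \<Rightarrow> nat \<Rightarrow> 'k.
        norm (\<Sum>I\<in>{..<k} \<rightarrow>\<^sub>E {..<n}. of_real (\<sigma> I) * (\<Prod>j<k. v j (I j)))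
          \<le> q ^ k * (C * (real k + 1)) * (\<Prod>j<k. L2_set (\<lambda>i. norm (v j i)) {..<n})"
      using C(2)[of k] by blast
    have "norm (\<Sum>I\<in>{..<k} \<rightarrow>\<^sub>E {..<n}. of_real (\<sigma> I) * (\<Prod>j<k. v j (I j)))
          \<le> s * (\<Prod>j<k. L2_set (\<lambda>i. norm (v j i)) {..<n})" for v :: "nat \<Rightarrow> nat \<Rightarrow> 'k"
      using Cs by (intro order.trans[OF \<sigma>(2)] mult_right_mono prod_nonneg) auto
    from ratio_sup_lower[OF ec feas d n k0 s \<sigma>(1) this]
    have low: "real n ^ k / (s\<^sup>2 * d ^ k) \<le> ratio_sup smul N k" .
    have "root k (real n ^ k / (s\<^sup>2 * d ^ k)) = n / (q\<^sup>2 * d) / root k k ^ 4"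
    proof -
      have "real n ^ k / (s\<^sup>2 * d ^ k) = (n / (q\<^sup>2 * d) / root k k ^ 4) ^ k"
      proof -
        have "(root k (real k) ^ 4) ^ k = (root k (real k) ^ k) ^ 4" by (simp add: power_mult[symmetric] mult.commute)
        also have "\<dots> = real k ^ 4" using k0 by simp
        finally have "(n / (q\<^sup>2 * d) / root k k ^ 4) ^ k = real n ^ k / ((q\<^sup>2) ^ k * d ^ k) / real k ^ 4"
          by (simp add: power_divide power_mult_distrib)
        moreover have "s\<^sup>2 = (q\<^sup>2) ^ k * real k ^ 4"
          by (simp add: s_def power_mult_distrib power_mult[symmetric] mult.commute)
        ultimately show ?thesis by (simp add: mult_ac)
      qed
      then show ?thesis using k0 q d n by (simp add: real_root_power_cancel)
    qed
    then show ?thesis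
      unfolding rho_def ratio_sup_def[symmetric] using real_root_le_mono[OF k0 low] by simp
  qed
  then show ?thesis unfolding q_def eventually_sequentially by blast
qed

text \<open>Fekete's lemma is applied to logarithms, so the ratio constants must be positive: the
  first one is by the sign tensor bound, the others by supermultiplicativity. For
  \<open>n = 0\<close> they vanish and \<open>rho\<close> is constantly 0.\<close>

lemma rho_tendsto_radius: "rho smul N \<longlonglongrightarrow> tensor_radius smul N"
proof -
  let ?R = "ratio_sup smul N"
  have rho: "rho smul N k = root k (?R k)" for k by (simp add: rho_def ratio_sup_def)
  have "convergent (rho smul N)"
  proof (cases "n = 0")
    case True
    have "rho smul N k = 0" for k
    proof (cases "k = 0")
      case False
      have "?R k \<le> sqrt (n * (\<Sum>i<n. (N (e0 i))\<^sup>2)) ^ k"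
        using False by (intro ratio_sup_le[OF ec0 trace_le]) auto
      then have "?R k \<le> 0" using True False by (simp add: power_0_left)
      moreover have "0 \<le> ?R k" using False by (intro ratio_sup_nonneg[OF ec0 trace_le]) auto
      ultimately show ?thesis by (simp add: rho)
    qed (simp add: rho)
    then have "rho smul N = (\<lambda>_. 0)" by (rule ext)
    then show ?thesis by (simp add: convergent_const)
  next
    case False
    then have n: "n > 0" by simp
    obtain e c where ec: "coords e c" "feasible {..<n} e" using exists_max_det by blast
    obtain d where d: "d > 0" "\<And>x. L2_set (\<lambda>i. norm (c i x)) {..<n} \<le> d * N x"
      using coords_bounded[OF ec(1)] by blast
    have pos1: "?R 1 > 0"
    proof -
      obtain C where C: "C > 0" "\<And>k. \<exists>\<sigma>. (\<forall>I\<in>{..<k} \<rightarrow>\<^sub>E {..<n}. \<sigma> I = 1 \<or> \<sigma> I = -1) \<and>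
        (\<forall>v :: nat \<Rightarrow> nat \<Rightarrow> 'k.
          norm (\<Sum>I\<in>{..<k} \<rightarrow>\<^sub>E {..<n}. of_real (\<sigma> I) * (\<Prod>j<k. v j (I j)))
            \<le> ((1 + 1/2) / (1 - 1/2)) ^ k * (C * (real k + 1)) * (\<Prod>j<k. L2_set (\<lambda>i. norm (v j i)) {..<n}))"
        using exists_sign_tensor[of "1/2", where ?'k = 'k and n = n] by auto
      define s where "s = ((1 + 1/2) / (1 - 1/2)) ^ 1 * (C * (real 1 + 1))"
      obtain \<sigma> where \<sigma>: "\<forall>I\<in>{..<1} \<rightarrow>\<^sub>E {..<n}. \<sigma> I = 1 \<or> \<sigma> I = -1"
        "\<And>v :: nat \<Rightarrow> nat \<Rightarrow> 'k.
          norm (\<Sum>I\<in>{..<1} \<rightarrow>\<^sub>E {..<n}. of_real (\<sigma> I) * (\<Prod>j<1. v j (I j)))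
            \<le> s * (\<Prod>j<1. L2_set (\<lambda>i. norm (v j i)) {..<n})"
        using C(2)[of 1] unfolding s_def by blast
      have s: "s > 0" using C by (simp add: s_def)
      have "real n ^ 1 / (s\<^sup>2 * d ^ 1) \<le> ?R 1"
        by (rule ratio_sup_lower[OF ec d n _ s \<sigma>]) simp
      moreover have "real n ^ 1 / (s\<^sup>2 * d ^ 1) > 0" using n s d by simp
      ultimately show ?thesis by linarith
    qed
    have pos: "?R (Suc k) > 0" for k
    proof (induction k)
      case (Suc k)
      have "0 < ?R (Suc k) * ?R 1" using Suc pos1 by simp
      also have "\<dots> \<le> ?R (Suc k + 1)" by (intro ratio_sup_supermult[OF ec0 trace_le]) auto
      finally show ?case by simp
    qed (use pos1 in simp)
    then have pos: "?R k > 0" if "k > 0" for k using that by (cases k) auto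
    define B where "B = sqrt (n * (\<Sum>i<n. (N (e0 i))\<^sup>2))"
    have RB: "?R k \<le> B ^ k" if "k > 0" for k
      unfolding B_def by (rule ratio_sup_le[OF ec0 trace_le that])
    have B: "B > 0" using RB[of 1] pos[of 1] by simp
    have "convergent (\<lambda>k. ln (?R k) / k)"
    proof (rule fekete)
      show "ln (?R m) + ln (?R l) \<le> ln (?R (m + l))" if "m > 0" "l > 0" for m l
        using ratio_sup_supermult[OF ec0 trace_le that] pos that by (simp flip: ln_mult_pos)
      show "ln (?R k) \<le> ln B * k" if "k > 0" for k
        using RB[OF that] pos[OF that] B by (simp add: ln_realpow[symmetric] mult.commute)
    qed
    then obtain L where "(\<lambda>k. ln (?R k) / k) \<longlonglongrightarrow> L" by (auto simp: convergent_def)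
    then have "(\<lambda>k. exp (ln (?R k) / k)) \<longlonglongrightarrow> exp L" by (rule tendsto_exp)
    moreover have "\<forall>\<^sub>F k in sequentially. exp (ln (?R k) / k) = rho smul N k"
      using eventually_gt_at_top[of "0::nat"]
    proof eventually_elim
      case (elim k)
      have "root k (?R k) = ?R k powr (1 / k)" using elim pos[OF elim] by (intro root_powr_inverse) auto
      then show ?case using pos[OF elim] by (simp add: rho powr_def)
    qed
    ultimately have "rho smul N \<longlonglongrightarrow> exp L" by (rule Lim_transform_eventually)
    then show ?thesis by (rule convergentI)
  qed
  then show ?thesis unfolding tensor_radius_def by (simp add: convergent_LIMSEQ_iff)
qed

lemma radius_le: "tensor_radius smul N \<le> sqrt (n * (\<Sum>i<n. (N (e0 i))\<^sup>2))"
proof (rule LIMSEQ_le_const2[OF rho_tendsto_radius], intro exI[of _ 1] allI impI)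
  fix k :: nat assume "1 \<le> k"
  then have k: "k > 0" by simp
  have "rho smul N k \<le> root k (sqrt (n * (\<Sum>i<n. (N (e0 i))\<^sup>2)) ^ k)"
    unfolding rho_def ratio_sup_def[symmetric]
    by (rule real_root_le_mono[OF k ratio_sup_le[OF ec0 trace_le k]])
  also have "\<dots> = sqrt (n * (\<Sum>i<n. (N (e0 i))\<^sup>2))"
    by (rule real_root_power_cancel[OF k]) (simp add: sum_nonneg)
  finally show "rho smul N k \<le> sqrt (n * (\<Sum>i<n. (N (e0 i))\<^sup>2))" .
qed

text \<open>The limit in \<open>k\<close> with \<open>\<delta>\<close> fixed removes
  \<open>root k k ^ 4\<close>; letting \<open>\<delta>\<close> tend to 0 then removes the loss due
  to the finite norming sets.\<close>

lemma radius_ge: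
  assumes ec: "coords e c" and feas: "feasible {..<n} e"
    and d: "d > 0" "\<And>x. L2_set (\<lambda>i. norm (c i x)) {..<n} \<le> d * N x"
    and n: "n > 0"
  shows "n / d \<le> tensor_radius smul N"
proof -
  have "n / (((1 + \<delta>) / (1 - \<delta>))\<^sup>2 * d) \<le> tensor_radius smul N" if \<delta>: "0 < \<delta>" "\<delta> < 1" for \<delta>
  proof -
    have "(\<lambda>k. n / (((1 + \<delta>) / (1 - \<delta>))\<^sup>2 * d) / root k k ^ 4) \<longlonglongrightarrow> n / (((1 + \<delta>) / (1 - \<delta>))\<^sup>2 * d) / 1 ^ 4"
      by (intro tendsto_intros LIMSEQ_root) auto
    from tendsto_le[OF _ rho_tendsto_radius this rho_eventually_lower[OF ec feas d n \<delta>]]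
    show ?thesis by simp
  qed
  then have "\<forall>\<^sub>F \<delta> in at_right 0. n / (((1 + \<delta>) / (1 - \<delta>))\<^sup>2 * d) \<le> tensor_radius smul N"
    unfolding eventually_at_right_field by (intro exI[of _ 1]) auto
  moreover have "((\<lambda>\<delta>. n / (((1 + \<delta>) / (1 - \<delta>))\<^sup>2 * d)) \<longlongrightarrow> n / (((1 + 0) / (1 - 0))\<^sup>2 * d)) (at_right 0)"
    using d by (intro tendsto_intros) auto
  ultimately have "n / (((1 + 0) / (1 - 0))\<^sup>2 * d) \<le> tensor_radius smul N"
    by (intro tendsto_upperbound) auto
  then show ?thesis by simp
qed

end

section \<open>The bounds and the equality case\<close>

theorem tensor_radius_bounds:
  "sqrt n \<le> tensor_radius smul N \<and> tensor_radius smul N \<le> n \<and>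
    (tensor_radius smul N = n \<longleftrightarrow> is_euclidean cj smul N)"
proof -
  obtain y c where y: "coords y c" "feasible {..<n} y"
    and max: "\<And>T. feasible {..<n} (\<lambda>l. \<Sum>i<n. smul (T (i, l)) (y i)) \<Longrightarrow> norm (Determinant.det (mat n n T)) \<le> 1"
    using exists_max_det by blast
  have tr: "(\<Sum>j\<in>J. \<Sum>i<n. (norm (c i (w j)))\<^sup>2) \<le> n" if "feasible J w" for J :: "(nat \<Rightarrow> nat) set" and w
    by (rule max_det_trace_le[OF y max that])
  define ip where "ip x z = (\<Sum>i<n. c i x * cj (c i z))" for x z
  have ip: "is_inner_product cj smul ip" "orthonormal ip n y"
    unfolding ip_def using coords_inner_product[OF y(1)] by auto
  have ipxx: "ip x x = of_real (\<Sum>i<n. (norm (c i x))\<^sup>2)" for x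
    unfolding ip_def using coords_inner_product(3)[OF y(1)] .
  have sq: "sq ip x = (\<Sum>i<n. (norm (c i x))\<^sup>2)" for x
    unfolding sq_def ipxx by (simp add: sum_nonneg del: of_real_sum)
  have Nsq: "(N x)\<^sup>2 \<le> sq ip x" for x
  proof -
    have "N x = N (\<Sum>i<n. smul (c i x) (y i))" using y(1) unfolding coords_def by metis
    also have "\<dots> \<le> L2_set (\<lambda>i. norm (c i x)) {..<n}" by (rule feasibleD[OF y(2)])
    finally have "(N x)\<^sup>2 \<le> (L2_set (\<lambda>i. norm (c i x)) {..<n})\<^sup>2" by (intro power_mono) auto
    then show ?thesis by (simp add: sq L2_set_def sum_nonneg)
  qed
  \<comment> \<open>The trace bound passes from \<open>y\<close> to every orthonormal basis, because
    the sum of squared coordinates of a vector is \<open>sq ip\<close> in each of them.\<close>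
  have upper: "tensor_radius smul N \<le> sqrt (n * (\<Sum>i<n. (N (e i))\<^sup>2))" if e: "orthonormal ip n e" for e
  proof (rule radius_le[OF orthonormal_coords[OF ip(1) e]])
    fix J :: "(nat \<Rightarrow> nat) set" and w assume "feasible J w"
    have "(\<Sum>i<n. (norm (ip x (e i)))\<^sup>2) = sq ip x" for x
    proof -
      have "x = (\<Sum>i<n. smul (ip x (e i)) (e i))" using orthonormal_coords[OF ip(1) e] unfolding coords_def by blast
      then show ?thesis using sq_comb[OF ip(1) e, of "\<lambda>i. ip x (e i)"] by simp
    qed
    then show "(\<Sum>j\<in>J. \<Sum>i<n. (norm (ip (w j) (e i)))\<^sup>2) \<le> n"
      using tr[OF \<open>feasible J w\<close>] by (simp add: sq)
  qed
  have sq_on: "sq ip (e i) = 1" if "orthonormal ip n e" "i < n" for e i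
    using that by (simp add: orthonormal_def sq_def)
  have le_n: "tensor_radius smul N \<le> n"
  proof -
    have "(\<Sum>i<n. (N (y i))\<^sup>2) \<le> (\<Sum>i<n. 1)"
      using Nsq sq_on[OF ip(2)] by (intro sum_mono) (metis lessThan_iff)
    then have "n * (\<Sum>i<n. (N (y i))\<^sup>2) \<le> real n * real n" by (intro mult_left_mono) auto
    then have "sqrt (n * (\<Sum>i<n. (N (y i))\<^sup>2)) \<le> sqrt (real n * real n)" by (rule real_sqrt_le_mono)
    then show ?thesis using upper[OF ip(2)] by simp
  qed
  have ge_sqrt: "sqrt n \<le> tensor_radius smul N"
  proof (cases "n = 0")
    case True
    have "0 \<le> tensor_radius smul N"
    proof (rule LIMSEQ_le_const[OF rho_tendsto_radius[OF y(1) tr]])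
      have "0 \<le> rho smul N k" for k
        unfolding rho_def ratio_sup_def[symmetric]
        using ratio_sup_nonneg[OF y(1) tr] by (cases "k = 0") (auto intro: real_root_ge_zero)
      then show "\<exists>M. \<forall>k\<ge>M. 0 \<le> rho smul N k" by blast
    qed
    then show ?thesis using True by simp
  next
    case False
    then have n: "n > 0" by simp
    have "L2_set (\<lambda>i. norm (c i x)) {..<n} \<le> sqrt n * N x" for x
    proof (cases "x = 0")
      case True
      have "c i 0 = 0" if "i < n" for i using coords_sum[OF y(1) that, of "\<lambda>_. 0" _ "{}"] by simp
      then show ?thesis using True by (simp add: L2_set_def)
    next
      case False
      have Nx: "N x > 0" by (rule N_pos[OF False])
      define u where "u = smul (of_real (1 / N x)) x"
      have Nu: "N u = 1" using Nx by (simp add: u_def norm_scale norm_divide)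
      \<comment> \<open>A single unit vector is a feasible family, indexed here by an arbitrary
        multi-index; its trace bound is \<open>sq ip u \<le> n\<close>, which gives
        \<open>d = sqrt n\<close>.\<close>
      have "feasible {\<lambda>_ :: nat. 0 :: nat} (\<lambda>_. u)"
        unfolding feasible_def by (simp add: norm_scale Nu L2_set_def)
      from tr[OF this] have "(\<Sum>i<n. (norm (c i u))\<^sup>2) \<le> n" by simp
      moreover have "(norm (c i u))\<^sup>2 = (norm (c i x))\<^sup>2 / (N x)\<^sup>2" if "i < n" for i
        using coords_sum[OF y(1) that, of "\<lambda>_. of_real (1 / N x)" "\<lambda>_. x" "{()}"] Nx
        by (simp add: u_def norm_divide power_divide)
      ultimately have "(\<Sum>i<n. (norm (c i x))\<^sup>2) / (N x)\<^sup>2 \<le> n" by (simp add: sum_divide_distrib)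
      then have "(\<Sum>i<n. (norm (c i x))\<^sup>2) \<le> n * (N x)\<^sup>2" using Nx by (simp add: divide_le_eq)
      then have "L2_set (\<lambda>i. norm (c i x)) {..<n} \<le> sqrt (n * (N x)\<^sup>2)" by (simp add: L2_set_def)
      then show ?thesis using Nx by (simp add: real_sqrt_mult)
    qed
    from radius_ge[OF y(1) tr y _ this n] have "n / sqrt n \<le> tensor_radius smul N" using n by simp
    then show ?thesis using n by (simp add: real_div_sqrt)
  qed
  have eucl: "tensor_radius smul N = n" if E: "is_euclidean cj smul N"
  proof (cases "n = 0")
    case True
    then show ?thesis using ge_sqrt le_n by simp
  next
    case False
    then have n: "n > 0" by simp
    obtain ip' where ip': "is_inner_product cj smul ip'" "\<And>x. ip' x x = of_real ((N x)\<^sup>2)"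
      using E by (auto simp: is_euclidean_def)
    \<comment> \<open>Extending the empty system yields an orthonormal basis for the inner product
      of \<open>X\<close> itself, for which \<open>d = 1\<close>.\<close>
    have "orthonormal ip' 0 (\<lambda>_. 0)" by (simp add: orthonormal_def)
    then obtain e where e: "orthonormal ip' n e" using orthonormal_extend[OF ip'(1)] by blast
    have Ne: "(N (\<Sum>i<n. smul (a i) (e i)))\<^sup>2 = (\<Sum>i<n. (norm (a i))\<^sup>2)" for a
      using sq_comb[OF ip'(1) e, of a] by (simp add: sq_def ip'(2) norm_power)
    then have Ne': "N (\<Sum>i<n. smul (a i) (e i)) = L2_set (\<lambda>i. norm (a i)) {..<n}" for a
      unfolding L2_set_def by (metis N_nonneg real_sqrt_abs abs_of_nonneg)
    have feas: "feasible {..<n} e" by (simp add: feasible_def Ne')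
    have "L2_set (\<lambda>i. norm (ip' x (e i))) {..<n} \<le> 1 * N x" for x
    proof -
      have "x = (\<Sum>i<n. smul (ip' x (e i)) (e i))" using orthonormal_coords[OF ip'(1) e] unfolding coords_def by blast
      then show ?thesis using Ne'[of "\<lambda>i. ip' x (e i)"] by simp
    qed
    from radius_ge[OF y(1) tr orthonormal_coords[OF ip'(1) e] feas _ this n]
    show ?thesis using le_n by simp
  qed
  have "is_euclidean cj smul N" if R: "tensor_radius smul N = n"
  proof -
    have "(N x)\<^sup>2 = sq ip x" for x
    proof (rule ccontr)
      assume "(N x)\<^sup>2 \<noteq> sq ip x"
      then have lt: "(N x)\<^sup>2 < sq ip x" using Nsq[of x] by simp
      then have sqx: "sq ip x > 0" by (meson order_le_less_trans zero_le_power2)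
      have n: "n > 0"
      proof (rule ccontr)
        assume "\<not> n > 0"
        then show False using sqx by (simp add: sq)
      qed
      \<comment> \<open>Rescaling puts \<open>u\<close> on the boundary of the ellipsoid, where the
        strict inequality at \<open>x\<close> becomes \<open>N u < 1\<close>.\<close>
      define r where "r = 1 / sqrt (sq ip x)"
      have r2: "r\<^sup>2 = 1 / sq ip x" using sqx by (simp add: r_def power_divide)
      define u where "u = smul (of_real r) x"
      have cu: "c i u = of_real r * c i x" if "i < n" for i
        using coords_sum[OF y(1) that, of "\<lambda>_. of_real r" "\<lambda>_. x" "{()}"] by (simp add: u_def)
      have "sq ip u = r\<^sup>2 * sq ip x"
        unfolding sq by (simp add: cu norm_mult power_mult_distrib sum_distrib_left)
      then have squ: "sq ip u = 1" using r2 sqx by simp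
      have "(N u)\<^sup>2 = (N x)\<^sup>2 / sq ip x" by (simp add: u_def norm_scale power_mult_distrib r2)
      then have Nu: "(N u)\<^sup>2 < 1" using lt sqx by simp
      have "ip u u = 1" using ip_sq[OF ip(1), of u] squ by simp
      then have "orthonormal ip 1 (\<lambda>_. u)" by (simp add: orthonormal_def)
      then obtain e where e: "orthonormal ip n e" "\<forall>i<1. e i = u"
        using orthonormal_extend[OF ip(1), of 1] n by auto
      have "(\<Sum>i<n. (N (e i))\<^sup>2) < (\<Sum>i<n. 1)"
      proof (rule sum_strict_mono_ex1)
        show "\<forall>i\<in>{..<n}. (N (e i))\<^sup>2 \<le> 1" using Nsq sq_on[OF e(1)] by (metis lessThan_iff)
        show "\<exists>i\<in>{..<n}. (N (e i))\<^sup>2 < 1" using n Nu e(2) by (intro bexI[of _ 0]) auto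
      qed simp
      then have "n * (\<Sum>i<n. (N (e i))\<^sup>2) < real n * real n" using n by simp
      then have "sqrt (n * (\<Sum>i<n. (N (e i))\<^sup>2)) < n" by (simp add: real_less_lsqrt power2_eq_square)
      then show False using upper[OF e(1)] R by simp
    qed
    then have "ip x x = of_real ((N x)\<^sup>2)" for x using ip_sq[OF ip(1), of x] by simp
    then show ?thesis unfolding is_euclidean_def using ip(1) by blast
  qed
  with eucl ge_sqrt le_n show ?thesis by blast
qed

end

section \<open>The two scalar fields\<close>

lemma tensor_radius_bounds_real:
  fixes s :: "real \<Rightarrow> 'a::ab_group_add \<Rightarrow> 'a"
  assumes "normed_space s N" "has_dimension s n"
  shows "sqrt n \<le> tensor_radius s N \<and> tensor_radius s N \<le> n \<and> (tensor_radius s N = n \<longleftrightarrow> is_euclidean (\<lambda>c. c) s N)"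
proof -
  interpret normed_space s N by fact
  interpret hahn_banach_space s N "\<lambda>c. c" n
  proof unfold_locales
    show "hahn_banach_property s" by (rule hahn_banach_property_real) unfold_locales
    show "hahn_banach_property (\<lambda>c (z :: (real, 'a) tensor) \<phi>. c * z \<phi>)"
      by (rule hahn_banach_property_real[OF vector_space_tensor])
  qed (use assms in \<open>simp_all add: power2_eq_square\<close>)
  show ?thesis by (rule tensor_radius_bounds)
qed

lemma tensor_radius_bounds_complex:
  fixes s :: "complex \<Rightarrow> 'a::ab_group_add \<Rightarrow> 'a"
  assumes "normed_space s N" "has_dimension s n"
  shows "sqrt n \<le> tensor_radius s N \<and> tensor_radius s N \<le> n \<and> (tensor_radius s N = n \<longleftrightarrow> is_euclidean cnj s N)"
proof -
  interpret normed_space s N by fact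
  interpret hahn_banach_space s N cnj n
  proof unfold_locales
    show "hahn_banach_property s" by (rule hahn_banach_property_complex) unfold_locales
    show "hahn_banach_property (\<lambda>c (z :: (complex, 'a) tensor) \<phi>. c * z \<phi>)"
      by (rule hahn_banach_property_complex[OF vector_space_tensor])
  qed (use assms in \<open>simp_all add: complex_norm_square[symmetric]\<close>)
  show ?thesis by (rule tensor_radius_bounds)
qed

theorem theorem1p1:
  fixes smulR :: "real \<Rightarrow> 'a::ab_group_add \<Rightarrow> 'a" and NR :: "'a \<Rightarrow> real"
    and smulC :: "complex \<Rightarrow> 'b::ab_group_add \<Rightarrow> 'b" and NC :: "'b \<Rightarrow> real"
    and n :: nat
  shows
    "(normed_space smulR NR \<and> has_dimension smulR n \<longrightarrow>
        sqrt (real n) \<le> tensor_radius smulR NR \<and> tensor_radius smulR NR \<le> real n \<and>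
        (tensor_radius smulR NR = real n \<longleftrightarrow> is_euclidean (\<lambda>c. c) smulR NR)) \<and>
     (normed_space smulC NC \<and> has_dimension smulC n \<longrightarrow>
        sqrt (real n) \<le> tensor_radius smulC NC \<and> tensor_radius smulC NC \<le> real n \<and>
        (tensor_radius smulC NC = real n \<longleftrightarrow> is_euclidean cnj smulC NC))"
  using tensor_radius_bounds_real tensor_radius_bounds_complex by blast

end
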